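(* Let $K=(-1,1)^d$ and therefore $|x|_K=\max\{|x_1|,\ldots,|x_d|\}$ and $|x|_{K^\circ}=\sum_{i=1}^d|x_i|$. Let also $C=\mathbb{R}^m_+\times\mathbb{R}^{d-m}$, $0\le m\le d$, and $f\in W^{\mathbf I,\nabla}_{\infty,\infty}(C)$. Then $\partial_{\mathbf I}f\in L_\infty(C)$ and the following inequalities hold. (1) The Landau–Kolmogorov inequality in the additive form: for every $h>0$, $$\|\partial_{\mathbf I}f\|_{L_\infty(C)}\le h\,\frac d{d+1}\big\||\nabla\partial_{\mathbf I}f|_{K^\circ}\big\|_{L_\infty(C)}+\frac{2^m}{h^d}\|f\|_{L_\infty(C)}.$$ (2) The Landau–Kolmogorov inequality in the multiplicative form: $$\|\partial_{\mathbf I}f\|_{L_\infty(C)}\le\big(2^m(d+1)\|f\|_{L_\infty(C)}\big)^{\frac1{d+1}}\big\||\nabla\partial_{\mathbf I}f|_{K^\circ}\big\|_{L_\infty(C)}^{\frac d{d+1}}.$$ For $m=0$ and $m=1$ the inequalities are sharp.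
   Context: Here $d\ge1$ and $\mathbb{R}_+=(0,\infty)$, so that $C$ is an open convex cone in $\mathbb{R}^d$. The norm generated by $K$ is $|x|_K=\inf\{\lambda>0: x\in\lambda K\}$, and $|\cdot|_{K^\circ}$ is its dual norm, $|z|_{K^\circ}=\sup\{(x,z): |x|_K\le1\}$, where $(x,z)$ is the dot product. For a locally integrable function $f$, $\partial_{\mathbf I}f=\dfrac{\partial^d f}{\partial x_1\cdots\partial x_d}$, where the derivatives are understood in the distributional sense; $\nabla$ denotes the distributional gradient. $W^{1,\infty}(C)$ is the Sobolev space of functions $g:C\to\mathbb{R}$ such that $g$ and all its first-order distributional partial derivatives belong to $L_\infty(C)$. $W^{\mathbf I,\nabla}_{\infty,\infty}(C)$ is the space of functions $f\in L_\infty(C)$ such that $\partial_{\mathbf I}f\in W^{1,\infty}(C)$. *)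

theory Defs
  imports "HOL-Analysis.Analysis" "HOL-Probability.Essential_Supremum"
begin

definition partial_deriv :: "'n::finite \<Rightarrow> (real^'n \<Rightarrow> real) \<Rightarrow> real^'n \<Rightarrow> real" where
  "partial_deriv i \<phi> x = frechet_derivative \<phi> (at x) (axis i 1)"

primrec iter_partial :: "'n::finite list \<Rightarrow> (real^'n \<Rightarrow> real) \<Rightarrow> real^'n \<Rightarrow> real" where
  "iter_partial [] \<phi> = \<phi>"
| "iter_partial (i # is) \<phi> = partial_deriv i (iter_partial is \<phi>)"

(* Since every iterated partial derivative is required to be Frechet differentiable, all of them
   are continuous; this is the usual class of infinitely differentiable functions. *)
definition smooth :: "(real^'n::finite \<Rightarrow> real) \<Rightarrow> bool" where
  "smooth \<phi> \<longleftrightarrow> (\<forall>is x. iter_partial is \<phi> differentiable (at x))"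

definition test_functions :: "(real^'n::finite) set \<Rightarrow> (real^'n \<Rightarrow> real) set" where
  "test_functions C =
     {\<phi>. smooth \<phi> \<and> compact (closure {x. \<phi> x \<noteq> 0}) \<and> closure {x. \<phi> x \<noteq> 0} \<subseteq> C}"

definition locally_integrable :: "(real^'n::finite) set \<Rightarrow> (real^'n \<Rightarrow> real) \<Rightarrow> bool" where
  "locally_integrable C f \<longleftrightarrow> (\<forall>S. compact S \<and> S \<subseteq> C \<longrightarrow> f absolutely_integrable_on S)"

(* Functions on C are represented by functions on the whole space; their values outside C,
   and on null subsets of C, play no role in what follows. *)
definition has_distr_deriv ::
  "(real^'n::finite) set \<Rightarrow> 'n list \<Rightarrow> (real^'n \<Rightarrow> real) \<Rightarrow> (real^'n \<Rightarrow> real) \<Rightarrow> bool" where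
  "has_distr_deriv C is f g \<longleftrightarrow>
     locally_integrable C f \<and> locally_integrable C g \<and>
     (\<forall>\<phi>\<in>test_functions C.
        (LINT x|lebesgue_on C. f x * iter_partial is \<phi> x) =
        (- 1) ^ length is * (LINT x|lebesgue_on C. g x * \<phi> x))"

(* Each coordinate is differentiated exactly once. Partial derivatives of test functions commute,
   so requiring this for every order of differentiation is the same as requiring it for one. *)
definition has_mixed_deriv ::
  "(real^'n::finite) set \<Rightarrow> (real^'n \<Rightarrow> real) \<Rightarrow> (real^'n \<Rightarrow> real) \<Rightarrow> bool" where
  "has_mixed_deriv C f g \<longleftrightarrow>
     (\<forall>is. distinct is \<and> set is = UNIV \<longrightarrow> has_distr_deriv C is f g)"

(* For open C, a distributional derivative that is a function is unique up to null sets;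
   the two choice operators below select a representative. *)
definition mixed_deriv ::
  "(real^'n::finite) set \<Rightarrow> (real^'n \<Rightarrow> real) \<Rightarrow> real^'n \<Rightarrow> real" where
  "mixed_deriv C f = (SOME g. has_mixed_deriv C f g)"

definition distr_grad ::
  "(real^'n::finite) set \<Rightarrow> (real^'n \<Rightarrow> real) \<Rightarrow> real^'n \<Rightarrow> real^'n" where
  "distr_grad C g x = (\<chi> i. (SOME u. has_distr_deriv C [i] g u) x)"

definition Linf :: "(real^'n::finite) set \<Rightarrow> (real^'n \<Rightarrow> real) set" where
  "Linf C = {f \<in> borel_measurable (lebesgue_on C).
               esssup (lebesgue_on C) (\<lambda>x. ereal \<bar>f x\<bar>) < \<infinity>}"

(* Meaningful for members of Linf C only (an infinite essential supremum is mapped to 0). *)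
definition Linf_norm :: "(real^'n::finite) set \<Rightarrow> (real^'n \<Rightarrow> real) \<Rightarrow> real" where
  "Linf_norm C f = real_of_ereal (esssup (lebesgue_on C) (\<lambda>x. ereal \<bar>f x\<bar>))"

definition W1_inf :: "(real^'n::finite) set \<Rightarrow> (real^'n \<Rightarrow> real) set" where
  "W1_inf C = {g \<in> Linf C. \<forall>i. \<exists>u\<in>Linf C. has_distr_deriv C [i] g u}"

definition W_mixed_grad :: "(real^'n::finite) set \<Rightarrow> (real^'n \<Rightarrow> real) set" where
  "W_mixed_grad C = {f \<in> Linf C. \<exists>g\<in>W1_inf C. has_mixed_deriv C f g}"

definition body_norm :: "(real^'n::finite) set \<Rightarrow> real^'n \<Rightarrow> real" where
  "body_norm K x = Inf {t. 0 < t \<and> x \<in> (\<lambda>y. t *\<^sub>R y) ` K}"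

definition dual_norm :: "(real^'n::finite) set \<Rightarrow> real^'n \<Rightarrow> real" where
  "dual_norm K z = Sup {x \<bullet> z | x. body_norm K x \<le> 1}"

definition open_cube :: "(real^'n::finite) set" where
  "open_cube = {x. \<forall>i. - 1 < x $ i \<and> x $ i < 1}"

(* The coordinates in P are positive and the others are free: the product of m open half-lines
   and d - m lines, where m = card P and d = CARD('n), up to the labelling of coordinates. *)
definition orthant_cone :: "'n::finite set \<Rightarrow> (real^'n) set" where
  "orthant_cone P = {x. \<forall>i\<in>P. 0 < x $ i}"

end

theory Submission
  imports Defs "HOL-Computational_Algebra.Polynomial"
begin

text \<open>
Write \<open>g\<close> for the mixed derivative of \<open>f\<close>, \<open>d\<close> for the dimension and \<open>m\<close> for \<open>card P\<close>. Suppose first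
that everything is smooth. Let \<open>Q\<close> be the product of the intervals \<open>[0, h]\<close> in the directions of
\<open>P\<close> and \<open>[- h, h]\<close> in the others, a box of volume \<open>2 ^ (d - m) * h ^ d\<close>. If \<open>x\<close> lies in the cone,
so does \<open>x + Q\<close>, and \<open>g x\<close> is compared with the mean of \<open>g\<close> over \<open>x + Q\<close>. The difference is at most
the mean of \<open>infnorm\<close> over \<open>Q\<close>, which is \<open>h * d / (d + 1)\<close>, times the supremum of the \<open>l1\<close> norm of the
gradient of \<open>g\<close>. The integral of a mixed derivative over a box is the alternating sum of the
values of \<open>f\<close> at the \<open>2 ^ d\<close> vertices, so that the mean itself is at most \<open>2 ^ d\<close> times the supremum
of \<open>\<bar>f\<bar>\<close>, divided by the volume of \<open>Q\<close>; the quotient \<open>2 ^ d / (2 ^ (d - m) * h ^ d)\<close> is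
\<open>2 ^ m / h ^ d\<close>. This is the additive inequality, and the best choice of \<open>h\<close> turns it into the
multiplicative one (\<open>optimise_additive_inequality\<close>).

Since \<open>f\<close>, \<open>g\<close> and the gradient are only given up to null sets and through test functions, the
argument is carried out by duality (\<open>weak_landau_kolmogorov\<close>): the functional
\<open>\<phi> \<mapsto> \<integral> g * \<phi>\<close> replaces the values of \<open>g\<close>, and translations and means are applied to \<open>\<phi>\<close>. What has
to be known is that averaging the translates of a test function over a compact family of shifts
gives a test function, whose derivatives are the averages of the derivatives. The translation
estimate uses that the mean of \<open>\<phi>\<close> over a segment of direction \<open>y\<close> has directional derivative
\<open>\<phi> x - \<phi> (x - y)\<close> (\<open>translation_estimate\<close>). The vertex sum comes from the fact that the product of the
functions \<open>sgn (x $ i - y $ i) / 2\<close> is a fundamental solution of the mixed derivative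
(\<open>sgn_kernel_integral\<close>, \<open>box_average_iter_partial\<close>). Finally a bound of \<open>\<integral> g * \<phi>\<close> by a multiple of
\<open>\<integral> \<bar>\<phi>\<bar>\<close>, for all \<open>\<phi>\<close>, is an essential bound of \<open>g\<close> (\<open>AE_le_of_test\<close>). The same duality shows that
distributional derivatives are unique up to null sets, hence that the representatives picked by
\<open>mixed_deriv\<close> and \<open>distr_grad\<close> have the properties of any other one
(\<open>mixed_deriv_representative\<close>).

For the sharpness let \<open>g\<close> be the pyramid \<open>max 0 (h - infnorm x)\<close>, whose supremum \<open>h\<close> is
approached at the vertex of the cone and which has a gradient of \<open>l1\<close> norm at most \<open>1\<close>. Integrating the restriction of \<open>g\<close> to
the cone against the fundamental solution gives a function \<open>f\<close> with mixed derivative \<open>g\<close> and with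
\<open>\<bar>f\<bar>\<close> at most \<open>2 powr (- d)\<close> times the integral of \<open>g\<close> over the cone, which is
\<open>h ^ (d + 1) / (2 ^ m * (d + 1))\<close>. With these three numbers the additive inequality for \<open>f\<close> reads
\<open>h \<le> h * d / (d + 1) + h / (d + 1)\<close>; so all the bounds are attained, and both inequalities
are equalities for \<open>f\<close> (\<open>extremal_function\<close>).
\<close>
section \<open>Smooth functions and test functions\<close>

lemma partial_deriv_eq:
  fixes \<phi> :: "real^'n::finite \<Rightarrow> real"
  assumes "(\<phi> has_derivative D) (at x)"
  shows "partial_deriv i \<phi> x = D (axis i 1)"
  unfolding partial_deriv_def using frechet_derivative_at[OF assms] by simp

lemma differentiable_has_partial_derivs:
  fixes \<phi> :: "real^'n::finite \<Rightarrow> real"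
  assumes "\<phi> differentiable (at x)"
  shows "(\<phi> has_derivative (\<lambda>v. \<Sum>i\<in>UNIV. v $ i * partial_deriv i \<phi> x)) (at x)"
proof -
  define D where "D = frechet_derivative \<phi> (at x)"
  have D: "(\<phi> has_derivative D) (at x)"
    using assms unfolding D_def by (simp add: frechet_derivative_works)
  interpret bounded_linear D using D by (rule has_derivative_bounded_linear)
  have "D v = (\<Sum>i\<in>UNIV. v $ i * partial_deriv i \<phi> x)" for v
  proof -
    have "v = (\<Sum>i\<in>UNIV. v $ i *\<^sub>R axis i 1)"
      using basis_expansion[of v] by (simp add: scalar_mult_eq_scaleR)
    then have "D v = D (\<Sum>i\<in>UNIV. v $ i *\<^sub>R axis i 1)" by simp
    also have "\<dots> = (\<Sum>i\<in>UNIV. v $ i * D (axis i 1))"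
      by (simp add: sum scaleR)
    also have "\<dots> = (\<Sum>i\<in>UNIV. v $ i * partial_deriv i \<phi> x)"
      by (simp add: partial_deriv_def D_def)
    finally show ?thesis .
  qed
  then have "D = (\<lambda>v. \<Sum>i\<in>UNIV. v $ i * partial_deriv i \<phi> x)" by auto
  with D show ?thesis by simp
qed

lemma iter_partial_append: "iter_partial (is @ js) \<phi> = iter_partial is (iter_partial js \<phi>)"
  by (induction "is") auto

lemma smooth_iter_partial: "smooth \<phi> \<Longrightarrow> smooth (iter_partial is \<phi>)"
  by (simp add: smooth_def iter_partial_append[symmetric])

lemma smooth_partial_deriv: "smooth \<phi> \<Longrightarrow> smooth (partial_deriv i \<phi>)"
  using smooth_iter_partial[of \<phi> "[i]"] by simp

lemma smooth_differentiable: "smooth \<phi> \<Longrightarrow> \<phi> differentiable (at x)"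
  unfolding smooth_def by (metis iter_partial.simps(1))

lemma smooth_continuous_on: "smooth \<phi> \<Longrightarrow> continuous_on S \<phi>"
  by (meson continuous_at_imp_continuous_on differentiable_imp_continuous_within smooth_differentiable)

text \<open>
Smoothness speaks of all iterated derivatives at once; it is proved by exhibiting a class of
differentiable functions that is stable under partial derivatives.
\<close>
lemma smooth_if_closed_family:
  assumes diff: "\<And>f x. f \<in> F \<Longrightarrow> f differentiable (at x)"
    and closed: "\<And>f i. f \<in> F \<Longrightarrow> partial_deriv i f \<in> F"
    and "\<phi> \<in> F"
  shows "smooth \<phi>"
proof -
  have "iter_partial is \<phi> \<in> F" for "is"
    by (induction "is") (use assms in auto)
  then show ?thesis unfolding smooth_def using diff by blast
qed

lemma test_functionsD:
  assumes "\<phi> \<in> test_functions C"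
  shows "smooth \<phi>" "compact (closure {x. \<phi> x \<noteq> 0})" "closure {x. \<phi> x \<noteq> 0} \<subseteq> C"
  using assms by (auto simp: test_functions_def)

lemma notin_closure_support: "x \<notin> closure {x. \<phi> x \<noteq> 0} \<Longrightarrow> \<phi> x = 0"
  using closure_subset[of "{x. \<phi> x \<noteq> 0}"] by blast

lemma test_functions_outside: "\<phi> \<in> test_functions C \<Longrightarrow> x \<notin> C \<Longrightarrow> \<phi> x = 0"
  using test_functionsD(3) notin_closure_support[of x \<phi>] by blast

lemma compact_closure_subset: "closure A \<subseteq> K \<Longrightarrow> compact K \<Longrightarrow> compact (closure A)"
  using compact_Int_closed[of K "closure A"] by (simp add: Int_absorb1)

lemma test_functions_partial_deriv:
  fixes \<phi> :: "real^'n::finite \<Rightarrow> real"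
  assumes "\<phi> \<in> test_functions C"
  shows "partial_deriv i \<phi> \<in> test_functions C"
proof -
  let ?S = "closure {x. \<phi> x \<noteq> 0}"
  have "partial_deriv i \<phi> x = 0" if "x \<notin> ?S" for x
  proof -
    have "(\<phi> has_derivative (\<lambda>_. 0)) (at x)"
    proof (rule has_derivative_transform_within_open[of "\<lambda>_. 0" _ _ _ "- ?S"])
      show "x \<in> - ?S" using that by simp
      show "0 = \<phi> y" if "y \<in> - ?S" for y
        using that notin_closure_support[of y \<phi>] by simp
    qed auto
    then show ?thesis by (simp add: partial_deriv_eq)
  qed
  then have sub: "closure {x. partial_deriv i \<phi> x \<noteq> 0} \<subseteq> ?S"
    by (intro closure_minimal) auto
  then have "compact (closure {x. partial_deriv i \<phi> x \<noteq> 0})"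
    using test_functionsD(2)[OF assms] by (rule compact_closure_subset)
  then show ?thesis
    using sub assms by (auto simp: test_functions_def smooth_partial_deriv)
qed

lemma test_functions_iter_partial: "\<phi> \<in> test_functions C \<Longrightarrow> iter_partial is \<phi> \<in> test_functions C"
  by (induction "is") (auto intro: test_functions_partial_deriv)

lemma test_functions_bounded:
  assumes "\<phi> \<in> test_functions C"
  obtains B where "0 \<le> B" "\<And>x. \<bar>\<phi> x\<bar> \<le> B"
proof -
  let ?S = "closure {x. \<phi> x \<noteq> 0}"
  have "compact (\<phi> ` ?S)"
    using test_functionsD[OF assms] by (intro compact_continuous_image smooth_continuous_on)
  then obtain B where B: "\<And>y. y \<in> \<phi> ` ?S \<Longrightarrow> \<bar>y\<bar> \<le> B"
    using compact_imp_bounded bounded_real by metis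
  have "\<bar>\<phi> x\<bar> \<le> max B 0" for x
  proof (cases "\<phi> x = 0")
    case False
    then have "x \<in> ?S" using notin_closure_support[of x \<phi>] by blast
    then show ?thesis using B[of "\<phi> x"] by auto
  qed auto
  then show ?thesis using that[of "max B 0"] by auto
qed

lemma test_functions_measurable:
  fixes \<phi> :: "real^'n::finite \<Rightarrow> real"
  shows "\<phi> \<in> test_functions C \<Longrightarrow> \<phi> \<in> borel_measurable borel"
  by (simp add: borel_measurable_continuous_onI smooth_continuous_on test_functionsD)

lemma integrable_bounded_compact_support:
  fixes f :: "'a::euclidean_space \<Rightarrow> real"
  assumes "f \<in> borel_measurable borel" "compact S" "\<And>x. \<bar>f x\<bar> \<le> B * indicat_real S x"
  shows "integrable lborel f"
proof (rule Bochner_Integration.integrable_bound)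
  show "integrable lborel (\<lambda>x. B * indicat_real S x)"
    using emeasure_compact_finite[OF assms(2)] assms(2)
    by (intro integrable_mult_right integrable_real_indicator) (auto simp: compact_imp_closed borel_closed)
  show "AE x in lborel. norm (f x) \<le> norm (B * indicat_real S x)"
    using order_trans[OF assms(3) abs_ge_self] by simp
qed (use assms in auto)

lemma test_functions_le_indicator:
  assumes "\<And>x. \<bar>\<phi> x\<bar> \<le> B"
  shows "\<bar>\<phi> x\<bar> \<le> B * indicat_real (closure {x. \<phi> x \<noteq> 0}) x"
proof (cases "\<phi> x = 0")
  case True then show ?thesis using assms[of x] by (auto simp: indicator_def)
next
  case False
  then have "x \<in> closure {x. \<phi> x \<noteq> 0}" using notin_closure_support[of x \<phi>] by blast
  then show ?thesis using assms by simp
qed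

lemma test_functions_integrable:
  fixes \<phi> :: "real^'n::finite \<Rightarrow> real"
  assumes "\<phi> \<in> test_functions C"
  shows "integrable lborel \<phi>"
proof -
  obtain B where "0 \<le> B" "\<And>x. \<bar>\<phi> x\<bar> \<le> B" using test_functions_bounded[OF assms] by blast
  then show ?thesis
    using assms by (intro integrable_bounded_compact_support[OF _ test_functionsD(2)[OF assms]] test_functions_le_indicator)
      (auto intro: test_functions_measurable)
qed

lemma integrable_bounded_mult:
  fixes w \<phi> :: "'a \<Rightarrow> real"
  assumes [measurable]: "w \<in> borel_measurable M" and w: "AE x in M. \<bar>w x\<bar> \<le> B"
    and \<phi>: "integrable M \<phi>"
  shows "integrable M (\<lambda>x. w x * \<phi> x)"
proof (rule Bochner_Integration.integrable_bound)
  show "integrable M (\<lambda>x. B * \<phi> x)" using \<phi> by simp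
  show "AE x in M. norm (w x * \<phi> x) \<le> norm (B * \<phi> x)"
    using w by eventually_elim (auto simp: abs_mult intro!: mult_right_mono)
qed (use \<phi> in auto)

section \<open>Averages of translates\<close>

text \<open>
The shift \<open>s\<close> is arbitrary, so that one lemma serves both for averages over boxes
(\<open>s\<close> the identity) and for averages over segments (\<open>s t\<close> a multiple of a fixed vector). The proof
is differentiation under the integral; the derivative is assembled from coordinate functionals to
see that it depends continuously, in operator norm, on the point and on the shift.
\<close>
lemma translate_average_has_derivative:
  fixes s :: "'b::euclidean_space \<Rightarrow> real^'n::finite" and \<phi> :: "real^'n \<Rightarrow> real"
  assumes s: "continuous_on (cbox a b) s" and \<phi>: "smooth \<phi>"
  shows "((\<lambda>x. integral (cbox a b) (\<lambda>t. \<phi> (x - s t))) has_derivative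
    (\<lambda>v. \<Sum>i\<in>UNIV. v $ i * integral (cbox a b) (\<lambda>t. partial_deriv i \<phi> (x - s t)))) (at x)"
proof -
  define fx :: "real^'n \<Rightarrow> 'b \<Rightarrow> (real^'n) \<Rightarrow>\<^sub>L real" where "fx x t = (\<Sum>i\<in>UNIV. partial_deriv i \<phi> (x - s t) *\<^sub>R blinfun_inner_left (axis i 1))" for x t
  have cont: "continuous_on (UNIV \<times> cbox a b) (\<lambda>(x, t). x - s t)"
    using s by (auto simp: case_prod_beta intro!: continuous_intros
        continuous_on_compose2[where f=snd and g=s])
  have contp: "continuous_on (UNIV \<times> cbox a b) (\<lambda>(x, t). partial_deriv i \<phi> (x - s t))" for i
    using continuous_on_compose2[OF smooth_continuous_on[OF smooth_partial_deriv[OF \<phi>], of UNIV i] cont]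
    by (auto simp: case_prod_beta)
  have contfx: "continuous_on (UNIV \<times> cbox a b) (\<lambda>(x, t). fx x t)"
    unfolding fx_def case_prod_beta using contp
    by (intro continuous_intros) (simp add: case_prod_beta)
  have contx: "continuous_on (cbox a b) (\<lambda>t. x - s t)" for x
    using s by (intro continuous_intros)
  have ii: "(\<lambda>t. \<psi> (x - s t)) integrable_on cbox a b" if "smooth \<psi>" for \<psi> x
    by (rule integrable_continuous, rule continuous_on_compose2[OF smooth_continuous_on[OF that, of UNIV] contx]) simp
  have cfx: "continuous_on (cbox a b) (fx x)" for x
    unfolding fx_def
    by (intro continuous_intros continuous_on_compose2[OF smooth_continuous_on[OF smooth_partial_deriv[OF \<phi>], of UNIV] contx]) auto
  have "((\<lambda>x. integral (cbox a b) (\<lambda>t. \<phi> (x - s t))) has_derivative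
     blinfun_apply (integral (cbox a b) (fx x))) (at x within UNIV)"
  proof (rule leibniz_rule[OF _ _ contfx])
    fix x t
    have "(\<phi> has_derivative (\<lambda>v. \<Sum>i\<in>UNIV. v $ i * partial_deriv i \<phi> (x - s t))) (at (x - s t))"
      by (intro differentiable_has_partial_derivs smooth_differentiable \<phi>)
    then have "((\<lambda>x. \<phi> (x - s t)) has_derivative (\<lambda>v. \<Sum>i\<in>UNIV. v $ i * partial_deriv i \<phi> (x - s t))) (at x)"
      by (rule has_derivative_compose[rotated]) (auto intro!: derivative_eq_intros)
    moreover have "blinfun_apply (fx x t) = (\<lambda>v. \<Sum>i\<in>UNIV. v $ i * partial_deriv i \<phi> (x - s t))"
      by (rule ext) (simp add: fx_def blinfun.sum_left blinfun.scaleR_left inner_axis mult.commute)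
    ultimately show "((\<lambda>x. \<phi> (x - s t)) has_derivative blinfun_apply (fx x t)) (at x within UNIV)"
      by simp
  qed (use ii[OF \<phi>] in auto)
  moreover have "blinfun_apply (integral (cbox a b) (fx x)) =
     (\<lambda>v. \<Sum>i\<in>UNIV. v $ i * integral (cbox a b) (\<lambda>t. partial_deriv i \<phi> (x - s t)))"
  proof
    fix v
    have "blinfun_apply (integral (cbox a b) (fx x)) v = integral (cbox a b) (\<lambda>t. blinfun_apply (fx x t) v)"
      by (rule blinfun_apply_integral[OF integrable_continuous[OF cfx]])
    also have "\<dots> = integral (cbox a b) (\<lambda>t. \<Sum>i\<in>UNIV. v $ i * partial_deriv i \<phi> (x - s t))"
      by (simp add: fx_def blinfun.sum_left blinfun.scaleR_left inner_axis mult.commute)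
    also have "\<dots> = (\<Sum>i\<in>UNIV. v $ i * integral (cbox a b) (\<lambda>t. partial_deriv i \<phi> (x - s t)))"
      by (subst integral_sum)
        (simp_all add: integrable_on_mult_right[OF ii[OF smooth_partial_deriv[OF \<phi>]]])
    finally show "blinfun_apply (integral (cbox a b) (fx x)) v = \<dots>" .
  qed
  ultimately show ?thesis by simp
qed

lemma translate_average_partial_deriv:
  fixes s :: "'b::euclidean_space \<Rightarrow> real^'n::finite" and \<phi> :: "real^'n \<Rightarrow> real"
  assumes s: "continuous_on (cbox a b) s" and \<phi>: "smooth \<phi>"
  shows "partial_deriv i (\<lambda>x. integral (cbox a b) (\<lambda>t. \<phi> (x - s t))) =
         (\<lambda>x. integral (cbox a b) (\<lambda>t. partial_deriv i \<phi> (x - s t)))"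
  by (subst partial_deriv_eq[OF translate_average_has_derivative[OF assms], abs_def])
     (simp add: axis_def if_distrib[of "\<lambda>a. a * _"] cong: if_cong)

lemma translate_average_iter_partial:
  fixes s :: "'b::euclidean_space \<Rightarrow> real^'n::finite" and \<phi> :: "real^'n \<Rightarrow> real"
  assumes s: "continuous_on (cbox a b) s" and \<phi>: "smooth \<phi>"
  shows "iter_partial is (\<lambda>x. integral (cbox a b) (\<lambda>t. \<phi> (x - s t))) =
         (\<lambda>x. integral (cbox a b) (\<lambda>t. iter_partial is \<phi> (x - s t)))"
  by (induction "is") (auto simp: translate_average_partial_deriv[OF s] smooth_iter_partial \<phi>)

lemma translate_average_smooth:
  fixes s :: "'b::euclidean_space \<Rightarrow> real^'n::finite" and \<phi> :: "real^'n \<Rightarrow> real"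
  assumes s: "continuous_on (cbox a b) s" and \<phi>: "smooth \<phi>"
  shows "smooth (\<lambda>x. integral (cbox a b) (\<lambda>t. \<phi> (x - s t)))"
  unfolding smooth_def translate_average_iter_partial[OF assms]
  using translate_average_has_derivative[OF s smooth_iter_partial[OF \<phi>]] by (blast intro: differentiableI)

lemma translate_average_test_function:
  fixes s :: "'b::euclidean_space \<Rightarrow> real^'n::finite" and \<phi> :: "real^'n \<Rightarrow> real"
  assumes s: "continuous_on (cbox a b) s" and \<phi>: "\<phi> \<in> test_functions C"
    and shift: "\<And>x t. x \<in> C \<Longrightarrow> t \<in> cbox a b \<Longrightarrow> x + s t \<in> C"
  shows "(\<lambda>x. integral (cbox a b) (\<lambda>t. \<phi> (x - s t))) \<in> test_functions C"
proof -
  let ?S = "closure {x. \<phi> x \<noteq> 0}" and ?\<psi> = "\<lambda>x. integral (cbox a b) (\<lambda>t. \<phi> (x - s t))"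
  note T = test_functionsD[OF \<phi>]
  define K where "K = (\<lambda>(x, t). x + s t) ` (?S \<times> cbox a b)"
  have "compact K" unfolding K_def using s T
    by (intro compact_continuous_image compact_Times)
      (auto simp: case_prod_beta intro!: continuous_intros continuous_on_compose2[where f=snd and g=s])
  have "?\<psi> x = 0" if "x \<notin> K" for x
  proof -
    have "\<phi> (x - s t) = 0" if "t \<in> cbox a b" for t
    proof (rule ccontr)
      assume "\<phi> (x - s t) \<noteq> 0"
      then have "x - s t \<in> ?S" using notin_closure_support[of "x - s t" \<phi>] by blast
      then have "x \<in> K" unfolding K_def using that by (force simp: image_iff)
      with \<open>x \<notin> K\<close> show False by simp
    qed
    then show ?thesis by (simp cong: integral_cong)
  qed
  then have sub: "closure {x. ?\<psi> x \<noteq> 0} \<subseteq> K"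
    using \<open>compact K\<close> by (intro closure_minimal) (auto dest: compact_imp_closed)
  moreover have "K \<subseteq> C" unfolding K_def using T shift by auto
  moreover have "compact (closure {x. ?\<psi> x \<noteq> 0})"
    using sub \<open>compact K\<close> by (rule compact_closure_subset)
  ultimately show ?thesis using translate_average_smooth[OF s T(1)] by (auto simp: test_functions_def)
qed

section \<open>Translation invariance\<close>

lemma integral_lborel_shift:
  fixes f :: "'a::euclidean_space \<Rightarrow> real"
  assumes [measurable]: "f \<in> borel_measurable borel"
  shows "(\<integral>x. f (c + x) \<partial>lborel) = (\<integral>x. f x \<partial>lborel)"
proof -
  have "(\<integral>x. f x \<partial>lborel) = (\<integral>x. f x \<partial>distr lborel borel ((+) c))" by (simp add: lborel_distr_plus)
  also have "\<dots> = (\<integral>x. f (c + x) \<partial>lborel)" by (rule integral_distr) auto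
  finally show ?thesis by simp
qed

lemma integrable_lborel_shift:
  fixes f :: "'a::euclidean_space \<Rightarrow> real"
  assumes f: "integrable lborel f"
  shows "integrable lborel (\<lambda>x. f (c + x))"
proof -
  have "integrable (distr lborel borel ((+) c)) f" using f by (simp add: lborel_distr_plus)
  then show ?thesis using f by (subst (asm) integrable_distr_eq) auto
qed

section \<open>Weak derivatives of Lipschitz functions\<close>

lemma DERIV_at_0_sequence:
  fixes f :: "real \<Rightarrow> real"
  assumes "(f has_real_derivative D) (at 0)"
  shows "(\<lambda>k. (f (1 / Suc k) - f 0) * Suc k) \<longlonglongrightarrow> D"
proof -
  have "((\<lambda>h. (f h - f 0) / h) \<longlongrightarrow> D) (at 0)" using assms by (simp add: DERIV_def)
  moreover have "filterlim (\<lambda>k. 1 / real (Suc k)) (at 0) sequentially"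
    by (rule filterlim_atI) (use LIMSEQ_Suc[OF lim_1_over_n] in auto)
  ultimately have "(\<lambda>k. (f (1 / Suc k) - f 0) / (1 / Suc k)) \<longlonglongrightarrow> D"
    by (rule filterlim_compose)
  then show ?thesis by simp
qed

lemma smooth_has_line_derivative:
  fixes \<phi> :: "real^'n::finite \<Rightarrow> real"
  assumes "smooth \<phi>"
  shows "((\<lambda>s. \<phi> (x + s *\<^sub>R v)) has_real_derivative
    (\<Sum>i\<in>UNIV. v $ i * partial_deriv i \<phi> (x + s *\<^sub>R v))) (at s)"
proof -
  have "((\<lambda>s. \<phi> (x + s *\<^sub>R v)) has_derivative
     (\<lambda>h. \<Sum>i\<in>UNIV. (h *\<^sub>R v) $ i * partial_deriv i \<phi> (x + s *\<^sub>R v))) (at s)"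
    by (rule has_derivative_compose[OF _ differentiable_has_partial_derivs[OF smooth_differentiable[OF assms]]])
      (auto intro!: derivative_eq_intros)
  moreover have "(\<lambda>h. \<Sum>i\<in>UNIV. (h *\<^sub>R v) $ i * partial_deriv i \<phi> (x + s *\<^sub>R v)) =
     (*) (\<Sum>i\<in>UNIV. v $ i * partial_deriv i \<phi> (x + s *\<^sub>R v))"
    by (rule ext) (simp add: sum_distrib_left sum_distrib_right mult_ac)
  ultimately show ?thesis by (simp add: has_field_derivative_def)
qed

lemma sum_axis_mult: "(\<Sum>j\<in>UNIV. (axis i c :: real^'n::finite) $ j * f j) = c * f i"
  by (simp add: axis_def if_distrib[of "\<lambda>a. a * _"] cong: if_cong)

lemma smooth_has_axis_derivative:
  fixes \<phi> :: "real^'n::finite \<Rightarrow> real"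
  assumes "smooth \<phi>"
  shows "((\<lambda>s. \<phi> (x + s *\<^sub>R axis i 1)) has_real_derivative partial_deriv i \<phi> (x + s *\<^sub>R axis i 1)) (at s)"
  using smooth_has_line_derivative[OF assms, of x "axis i 1" s] by (simp add: sum_axis_mult)

lemma smooth_axis_lipschitz:
  fixes \<phi> :: "real^'n::finite \<Rightarrow> real"
  assumes "smooth \<phi>" "\<And>x. \<bar>partial_deriv i \<phi> x\<bar> \<le> B"
  shows "\<bar>\<phi> (x + t *\<^sub>R axis i 1) - \<phi> x\<bar> \<le> B * \<bar>t\<bar>"
  using field_differentiable_bound[of UNIV "\<lambda>s. \<phi> (x + s *\<^sub>R axis i 1)"
     "\<lambda>s. partial_deriv i \<phi> (x + s *\<^sub>R axis i 1)" B t 0]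
    smooth_has_axis_derivative[OF assms(1)] assms(2) by auto

text \<open>
Integration by parts in one coordinate, without Fubini: the difference quotient of step \<open>1 / Suc k\<close>
is moved from \<open>\<phi>\<close> to \<open>w\<close> by translation invariance, and dominated convergence gives the limit on
both sides. On the left the quotients of \<open>\<phi>\<close> are bounded and live on a fixed compact set, on the
right the Lipschitz constant of \<open>w\<close> times \<open>\<bar>\<phi>\<bar>\<close> dominates.
\<close>
lemma weak_partial_deriv_of_lipschitz:
  fixes w u \<phi> :: "real^'n::finite \<Rightarrow> real"
  assumes [measurable]: "w \<in> borel_measurable borel" "u \<in> borel_measurable borel"
    and bdd: "\<And>x. \<bar>w x\<bar> \<le> B"
    and lip: "\<And>x t. \<bar>w (x + t *\<^sub>R axis i 1) - w x\<bar> \<le> M * \<bar>t\<bar>"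
    and lim: "AE x in lborel. (\<lambda>k. (w (x + (1 / Suc k) *\<^sub>R axis i 1) - w x) * Suc k) \<longlonglongrightarrow> u x"
    and \<phi>: "\<phi> \<in> test_functions C"
  shows "(\<integral>x. w x * partial_deriv i \<phi> x \<partial>lborel) = - (\<integral>x. u x * \<phi> x \<partial>lborel)"
proof -
  let ?e = "axis i 1 :: real^'n" and ?t = "\<lambda>k. 1 / real (Suc k)"
  note T = test_functionsD[OF \<phi>]
  note [measurable] = test_functions_measurable[OF \<phi>] test_functions_measurable[OF test_functions_partial_deriv[OF \<phi>, of i]]
  obtain D where D: "0 \<le> D" "\<And>x. \<bar>partial_deriv i \<phi> x\<bar> \<le> D"
    using test_functions_bounded[OF test_functions_partial_deriv[OF \<phi>]] by blast
  \<comment> \<open>The support of \<open>\<phi>\<close>, thickened by the largest step of the difference quotients.\<close>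
  define S where "S = (\<lambda>(x, r). x + r *\<^sub>R ?e) ` (closure {x. \<phi> x \<noteq> 0} \<times> {0..1})"
  have "compact S" unfolding S_def using T
    by (intro compact_continuous_image compact_Times) (auto simp: case_prod_beta intro!: continuous_intros)
  have in_S: "x + r *\<^sub>R ?e \<in> S" if "\<phi> x \<noteq> 0" "0 \<le> r" "r \<le> 1" for x r
    unfolding S_def using notin_closure_support[of x \<phi>] that by force
  define a where "a k x = w x * ((\<phi> (x - ?t k *\<^sub>R ?e) - \<phi> x) * Suc k)" for k x
  define b where "b k x = ((w (x + ?t k *\<^sub>R ?e) - w x) * Suc k) * \<phi> x" for k x
  have [measurable]: "a k \<in> borel_measurable borel" "b k \<in> borel_measurable borel" for k
    unfolding a_def b_def by measurable
  have B: "0 \<le> B" using bdd[of 0] by simp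
  have quot: "\<bar>(\<phi> (x - ?t k *\<^sub>R ?e) - \<phi> x) * Suc k\<bar> \<le> D" for x k
  proof -
    have "\<bar>\<phi> (x - ?t k *\<^sub>R ?e) - \<phi> x\<bar> \<le> D * ?t k"
      using smooth_axis_lipschitz[OF T(1) D(2), of x "- ?t k"] by simp
    then have "\<bar>\<phi> (x - ?t k *\<^sub>R ?e) - \<phi> x\<bar> * Suc k \<le> D * ?t k * Suc k"
      by (rule mult_right_mono) simp
    then show ?thesis unfolding abs_mult by simp
  qed
  have a_bound: "\<bar>a k x\<bar> \<le> B * D * indicat_real S x" for k x
  proof (cases "x \<in> S")
    case True
    then show ?thesis using mult_mono[OF bdd[of x] quot[of x k] B] by (simp add: a_def abs_mult)
  next
    case False
    have "\<phi> x = 0" using in_S[of x 0] False by auto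
    moreover have "\<phi> (x - ?t k *\<^sub>R ?e) = 0" using in_S[of "x - ?t k *\<^sub>R ?e" "?t k"] False by auto
    ultimately show ?thesis using False by (simp add: a_def)
  qed
  have b_bound: "\<bar>b k x\<bar> \<le> M * \<bar>\<phi> x\<bar>" for k x
  proof -
    have "\<bar>(w (x + ?t k *\<^sub>R ?e) - w x) * Suc k\<bar> \<le> M"
    proof -
      have "\<bar>w (x + ?t k *\<^sub>R ?e) - w x\<bar> * Suc k \<le> M * ?t k * Suc k"
        using lip[of x "?t k"] by (intro mult_right_mono) auto
      then show ?thesis unfolding abs_mult by simp
    qed
    then show ?thesis by (simp add: b_def abs_mult mult_right_mono del: of_nat_Suc)
  qed
  have "(\<integral>x. a k x \<partial>lborel) = (\<integral>x. b k x \<partial>lborel)" for k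
  proof -
    have i1: "integrable lborel (\<lambda>x. w x * \<phi> x)"
      by (rule integrable_bounded_mult[of _ _ B]) (use bdd test_functions_integrable[OF \<phi>] in auto)
    have i2: "integrable lborel (\<lambda>x. w (?t k *\<^sub>R ?e + x) * \<phi> x)"
      by (rule integrable_bounded_mult[of _ _ B]) (use bdd test_functions_integrable[OF \<phi>] in auto)
    have i3: "integrable lborel (\<lambda>x. w x * \<phi> (x - ?t k *\<^sub>R ?e))"
      using integrable_lborel_shift[OF i2, of "- ?t k *\<^sub>R ?e"] by (simp add: algebra_simps)
    have "(\<integral>x. w x * \<phi> (x - ?t k *\<^sub>R ?e) \<partial>lborel) = (\<integral>x. w (?t k *\<^sub>R ?e + x) * \<phi> x \<partial>lborel)"
      by (subst integral_lborel_shift[where c="?t k *\<^sub>R ?e", symmetric]) auto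
    then show ?thesis unfolding a_def b_def
      using i1 i2 i3 by (simp add: algebra_simps)
  qed
  moreover have "(\<lambda>k. \<integral>x. a k x \<partial>lborel) \<longlonglongrightarrow> (\<integral>x. - (w x * partial_deriv i \<phi> x) \<partial>lborel)"
  proof (rule integral_dominated_convergence[where w="\<lambda>x. B * D * indicat_real S x"])
    show "integrable lborel (\<lambda>x. B * D * indicat_real S x)"
      by (rule integrable_bounded_compact_support[OF _ \<open>compact S\<close>, of _ "B * D"])
        (use \<open>compact S\<close> B D in \<open>auto simp: abs_mult compact_imp_closed\<close>)
    show "AE x in lborel. (\<lambda>k. a k x) \<longlonglongrightarrow> - (w x * partial_deriv i \<phi> x)"
    proof (rule AE_I2)
      fix x
      have "((\<lambda>s. \<phi> (x - s *\<^sub>R ?e)) has_real_derivative - partial_deriv i \<phi> x) (at 0)"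
        using DERIV_chain2[of "\<lambda>s. \<phi> (x + s *\<^sub>R ?e)" _ "\<lambda>s. - s" 0 "-1" UNIV,
            OF smooth_has_axis_derivative[OF T(1)]] DERIV_minus[OF DERIV_ident, of "0::real" UNIV]
        by simp
      from tendsto_mult_left[OF DERIV_at_0_sequence[OF this], of "w x"]
      show "(\<lambda>k. a k x) \<longlonglongrightarrow> - (w x * partial_deriv i \<phi> x)" by (simp add: a_def)
    qed
  qed (use a_bound in auto)
  moreover have "(\<lambda>k. \<integral>x. b k x \<partial>lborel) \<longlonglongrightarrow> (\<integral>x. u x * \<phi> x \<partial>lborel)"
  proof (rule integral_dominated_convergence[where w="\<lambda>x. M * \<bar>\<phi> x\<bar>"])
    show "integrable lborel (\<lambda>x. M * \<bar>\<phi> x\<bar>)" using test_functions_integrable[OF \<phi>] by auto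
    show "AE x in lborel. (\<lambda>k. b k x) \<longlonglongrightarrow> u x * \<phi> x"
      using lim by eventually_elim (auto simp: b_def intro: tendsto_mult_right)
  qed (use b_bound in auto)
  ultimately show ?thesis using LIMSEQ_unique by fastforce
qed

section \<open>The fundamental solution of the mixed derivative\<close>

text \<open>
The fundamental solution of the mixed derivative is a product of sign functions. To differentiate
it with the previous lemma, the sign function is replaced by the Lipschitz ramp of slope \<open>n\<close>, which
converges to it as \<open>n\<close> grows.
\<close>
definition ramp :: "real \<Rightarrow> real \<Rightarrow> real" where
  "ramp n s = max (- 1) (min 1 (n * s))"

definition ramp_slope :: "real \<Rightarrow> real \<Rightarrow> real" where
  "ramp_slope n s = (if \<bar>s\<bar> \<le> 1 / n then n else 0)"

lemma ramp_measurable [measurable]: "ramp n \<in> borel_measurable borel" "ramp_slope n \<in> borel_measurable borel"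
  unfolding ramp_def ramp_slope_def by measurable

lemma abs_ramp_le: "\<bar>ramp n s\<bar> \<le> 1"
  by (auto simp: ramp_def)

lemma abs_ramp_slope_le: "0 \<le> n \<Longrightarrow> \<bar>ramp_slope n s\<bar> \<le> n"
  by (auto simp: ramp_slope_def)

lemma ramp_lipschitz:
  assumes "0 \<le> n"
  shows "\<bar>ramp n s - ramp n t\<bar> \<le> n * \<bar>s - t\<bar>"
proof -
  have "\<bar>ramp n s - ramp n t\<bar> \<le> \<bar>n * s - n * t\<bar>" by (auto simp: ramp_def min_def max_def)
  also have "\<dots> = n * \<bar>s - t\<bar>" using assms by (simp add: abs_mult right_diff_distrib[symmetric])
  finally show ?thesis .
qed

lemma DERIV_ramp:
  assumes "0 < n" "\<bar>s\<bar> \<noteq> 1 / n"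
  shows "(ramp n has_real_derivative ramp_slope n s) (at s)"
proof -
  consider "s < - (1 / n)" | "\<bar>s\<bar> < 1 / n" | "s > 1 / n" using assms by linarith
  then show ?thesis
  proof cases
    case 1
    show ?thesis
    proof (rule has_field_derivative_transform_within_open[where S="{..< - (1 / n)}"])
      show "((\<lambda>_. - 1) has_real_derivative ramp_slope n s) (at s)"
        using 1 assms by (auto simp: ramp_slope_def)
    qed (use 1 assms in \<open>auto simp: ramp_def field_simps\<close>)
  next
    case 2
    show ?thesis
    proof (rule has_field_derivative_transform_within_open[where S="{- (1 / n) <..< 1 / n}"])
      show "((*) n has_real_derivative ramp_slope n s) (at s)"
        using 2 assms by (auto simp: ramp_slope_def intro!: derivative_eq_intros)
    qed (use 2 assms in \<open>auto simp: ramp_def abs_less_iff field_simps\<close>)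
  next
    case 3
    show ?thesis
    proof (rule has_field_derivative_transform_within_open[where S="{1 / n <..}"])
      show "((\<lambda>_. 1) has_real_derivative ramp_slope n s) (at s)"
        using 3 assms by (auto simp: ramp_slope_def)
    qed (use 3 assms in \<open>auto simp: ramp_def field_simps\<close>)
  qed
qed

lemma ramp_tendsto_sgn: "(\<lambda>k. ramp (real (Suc k)) s) \<longlonglongrightarrow> sgn s"
proof (rule tendsto_eventually)
  consider "s = 0" | "s > 0" | "s < 0" by linarith
  then show "eventually (\<lambda>k. ramp (real (Suc k)) s = sgn s) sequentially"
  proof cases
    case 1 then show ?thesis by (simp add: ramp_def)
  next
    case 2
    then obtain N where N: "inverse (real (Suc N)) < s" using reals_Archimedean by blast
    show ?thesis
    proof (rule eventually_sequentiallyI[of N])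
      fix k assume "N \<le> k"
      have "1 < real (Suc N) * s" using N by (simp add: field_simps)
      also have "\<dots> \<le> real (Suc k) * s" using \<open>N \<le> k\<close> 2 by (intro mult_right_mono) auto
      finally show "ramp (real (Suc k)) s = sgn s" using 2 unfolding ramp_def by simp
    qed
  next
    case 3
    then obtain N where N: "inverse (real (Suc N)) < - s" using reals_Archimedean[of "-s"] by auto
    show ?thesis
    proof (rule eventually_sequentiallyI[of N])
      fix k assume "N \<le> k"
      have "1 < real (Suc N) * (- s)" using N by (simp add: field_simps)
      also have "\<dots> \<le> real (Suc k) * (- s)" using \<open>N \<le> k\<close> 3 by (intro mult_right_mono) auto
      finally show "ramp (real (Suc k)) s = sgn s" using 3 unfolding ramp_def by simp
    qed
  qed
qed

lemma AE_lborel_component_neq: "AE x in lborel. (x :: real^'n::finite) $ i \<noteq> c"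
proof -
  have "negligible {x :: real^'n. axis i 1 \<bullet> x = c}"
    by (rule negligible_hyperplane) (simp add: axis_eq_0_iff)
  then have "AE x in lebesgue. (x :: real^'n) $ i \<noteq> c"
    by (intro AE_I'[of "{x. x $ i = c}"]) (auto simp: negligible_iff_null_sets inner_axis')
  then show ?thesis by (simp add: AE_completion_iff)
qed

text \<open>
In the directions of \<open>S\<close> the ramp has already been differentiated.
\<close>
definition ramp_prod :: "real \<Rightarrow> real^'n \<Rightarrow> 'n set \<Rightarrow> real^'n::finite \<Rightarrow> real" where
  "ramp_prod n y S x = (\<Prod>j\<in>UNIV. (if j \<in> S then ramp_slope else ramp) n (x $ j - y $ j))"

lemma ramp_prod_measurable [measurable]: "ramp_prod n y S \<in> borel_measurable borel"
  unfolding ramp_prod_def[abs_def] by (intro borel_measurable_prod) auto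

lemma abs_ramp_factor_le: "1 \<le> n \<Longrightarrow> \<bar>(if b then ramp_slope else ramp) n s\<bar> \<le> n"
  using abs_ramp_slope_le[of n s] abs_ramp_le[of n s] by auto

lemma ramp_prod_integral_step:
  fixes y :: "real^'n::finite"
  assumes n: "1 \<le> n" and i: "i \<notin> S" and \<phi>: "\<phi> \<in> test_functions C"
  shows "(\<integral>x. ramp_prod n y S x * partial_deriv i \<phi> x \<partial>lborel) =
         - (\<integral>x. ramp_prod n y (insert i S) x * \<phi> x \<partial>lborel)"
proof (rule weak_partial_deriv_of_lipschitz[OF _ _ _ _ _ \<phi>])
  let ?F = "\<lambda>S x j. (if j \<in> S then ramp_slope else ramp) n ((x :: real^'n) $ j - y $ j)"
  let ?R = "\<lambda>x. \<Prod>j\<in>UNIV - {i}. ?F S x j"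
  show "\<bar>ramp_prod n y S x\<bar> \<le> n ^ CARD('n)" for x
    unfolding ramp_prod_def abs_prod
    by (rule order_trans[OF prod_mono[where g="\<lambda>_. n"]]) (use abs_ramp_factor_le[OF n] in auto)
  have split: "ramp_prod n y S x = ramp n (x $ i - y $ i) * ?R x" for x
    unfolding ramp_prod_def using i by (subst prod.remove[of _ i]) auto
  have split': "ramp_prod n y (insert i S) x = ramp_slope n (x $ i - y $ i) * ?R x" for x
    unfolding ramp_prod_def by (subst prod.remove[of _ i]) (auto intro!: prod.cong)
  have R_shift: "?R (x + t *\<^sub>R axis i 1) = ?R x" for x t
    by (intro prod.cong) (auto simp: axis_def)
  have R_bound: "\<bar>?R x\<bar> \<le> n ^ (CARD('n) - 1)" for x
    unfolding abs_prod
    by (rule order_trans[OF prod_mono[where g="\<lambda>_. n"]]) (use abs_ramp_factor_le[OF n] in auto)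
  have diff: "ramp_prod n y S (x + t *\<^sub>R axis i 1) - ramp_prod n y S x =
     (ramp n (x $ i - y $ i + t) - ramp n (x $ i - y $ i)) * ?R x" for x t
    unfolding split R_shift by (simp add: algebra_simps)
  show "\<bar>ramp_prod n y S (x + t *\<^sub>R axis i 1) - ramp_prod n y S x\<bar> \<le> (n * n ^ (CARD('n) - 1)) * \<bar>t\<bar>" for x t
    using mult_mono[OF ramp_lipschitz[of n "x $ i - y $ i + t" "x $ i - y $ i"] R_bound[of x]] n
    unfolding diff abs_mult by (simp add: mult_ac)
  have "AE x in lborel. x $ i \<noteq> y $ i + 1 / n" "AE x in lborel. x $ i \<noteq> y $ i - 1 / n"
    by (rule AE_lborel_component_neq)+
  then show "AE x in lborel. (\<lambda>k. (ramp_prod n y S (x + (1 / real (Suc k)) *\<^sub>R axis i 1) - ramp_prod n y S x)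
      * real (Suc k)) \<longlonglongrightarrow> ramp_prod n y (insert i S) x"
  proof eventually_elim
    case (elim x)
    have "\<bar>x $ i - y $ i\<bar> \<noteq> 1 / n" using elim by (auto simp: abs_if split: if_splits)
    then have "(ramp n has_real_derivative ramp_slope n (x $ i - y $ i)) (at (x $ i - y $ i))"
      using n by (intro DERIV_ramp) auto
    then have "((\<lambda>s. ramp n (x $ i - y $ i + s)) has_real_derivative ramp_slope n (x $ i - y $ i)) (at 0)"
      using DERIV_shift[of "ramp n" _ 0 "x $ i - y $ i"] by (simp add: add.commute)
    from tendsto_mult_right[OF DERIV_at_0_sequence[OF this], of "?R x"]
    show ?case unfolding diff split' by (simp add: mult_ac)
  qed
qed auto

lemma ramp_prod_integral:
  fixes y :: "real^'n::finite"
  assumes n: "1 \<le> n" and \<phi>: "\<phi> \<in> test_functions C"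
    and "distinct is" "S \<inter> set is = {}"
  shows "(\<integral>x. ramp_prod n y S x * iter_partial is \<phi> x \<partial>lborel) =
         (- 1) ^ length is * (\<integral>x. ramp_prod n y (S \<union> set is) x * \<phi> x \<partial>lborel)"
  using assms(3-)
proof (induction "is" arbitrary: S)
  case (Cons i "is")
  have "(\<integral>x. ramp_prod n y S x * iter_partial (i # is) \<phi> x \<partial>lborel) =
        - (\<integral>x. ramp_prod n y (insert i S) x * iter_partial is \<phi> x \<partial>lborel)"
    using Cons.prems by (simp add: ramp_prod_integral_step[OF n _ test_functions_iter_partial[OF \<phi>]])
  then show ?case using Cons by simp
qed simp

lemma measure_lborel_cbox_cart:
  fixes a b :: "real^'n::finite"
  assumes "\<And>i. a $ i \<le> b $ i"
  shows "measure lborel (cbox a b) = (\<Prod>i\<in>UNIV. b $ i - a $ i)"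
  using assms by (intro content_cbox_cart) (simp add: interval_ne_empty_cart)

text \<open>
Once every factor is differentiated, an approximate identity of total mass \<open>2 ^ CARD('n)\<close> is left.
\<close>
lemma ramp_prod_UNIV:
  fixes x y :: "real^'n::finite"
  assumes "0 < n"
  shows "ramp_prod n y UNIV x = n ^ CARD('n) * indicator (cbox (y - (\<chi> i. 1 / n)) (y + (\<chi> i. 1 / n))) x"
proof (cases "\<forall>i. \<bar>x $ i - y $ i\<bar> \<le> 1 / n")
  case True
  then have "x \<in> cbox (y - (\<chi> i. 1 / n)) (y + (\<chi> i. 1 / n))"
    by (auto simp: mem_box_cart abs_le_iff algebra_simps)
  then show ?thesis using True by (simp add: ramp_prod_def ramp_slope_def)
next
  case False
  then obtain i where i: "\<not> \<bar>x $ i - y $ i\<bar> \<le> 1 / n" by blast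
  then have "x \<notin> cbox (y - (\<chi> i. 1 / n)) (y + (\<chi> i. 1 / n))"
    by (auto simp: mem_box_cart abs_le_iff algebra_simps dest!: spec[of _ i])
  then show ?thesis using i by (auto simp: ramp_prod_def ramp_slope_def intro!: bexI[of _ i])
qed

text \<open>
Each integration by parts costs a sign and the jump of each sign function is \<open>2\<close>, whence the factor
\<open>- 2\<close> for every coordinate. The formula for the ramps passes to the limit on the left by dominated
convergence, on the right because \<open>\<phi>\<close> is continuous at \<open>y\<close>.
\<close>
lemma sgn_kernel_integral:
  fixes y :: "real^'n::finite"
  assumes \<phi>: "\<phi> \<in> test_functions C" and "distinct is" "set is = UNIV"
  shows "(\<integral>x. (\<Prod>j\<in>UNIV. sgn (x $ j - y $ j)) * iter_partial is \<phi> x \<partial>lborel) = (- 2) ^ CARD('n) * \<phi> y"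
proof -
  let ?n = "\<lambda>k. real (Suc k)" and ?d = "CARD('n)"
  note [measurable] = test_functions_measurable[OF \<phi>] test_functions_measurable[OF test_functions_iter_partial[OF \<phi>]]
  have len: "length is = ?d" using assms(2,3) by (metis distinct_card)
  have "(\<lambda>k. \<integral>x. ramp_prod (?n k) y {} x * iter_partial is \<phi> x \<partial>lborel) \<longlonglongrightarrow>
    (\<integral>x. (\<Prod>j\<in>UNIV. sgn (x $ j - y $ j)) * iter_partial is \<phi> x \<partial>lborel)"
  proof (rule integral_dominated_convergence[where w="\<lambda>x. \<bar>iter_partial is \<phi> x\<bar>"])
    show "integrable lborel (\<lambda>x. \<bar>iter_partial is \<phi> x\<bar>)"
      using test_functions_integrable[OF test_functions_iter_partial[OF \<phi>]] by auto
    show "AE x in lborel. (\<lambda>k. ramp_prod (?n k) y {} x * iter_partial is \<phi> x) \<longlonglongrightarrow>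
       (\<Prod>j\<in>UNIV. sgn (x $ j - y $ j)) * iter_partial is \<phi> x"
      unfolding ramp_prod_def by (intro AE_I2 tendsto_intros) (simp add: ramp_tendsto_sgn del: of_nat_Suc)
    show "AE x in lborel. norm (ramp_prod (?n k) y {} x * iter_partial is \<phi> x) \<le> \<bar>iter_partial is \<phi> x\<bar>" for k
    proof (rule AE_I2)
      fix x
      have "\<bar>ramp_prod (?n k) y {} x\<bar> \<le> 1"
        unfolding ramp_prod_def abs_prod by (rule prod_le_1) (simp add: abs_ramp_le del: of_nat_Suc)
      then show "norm (ramp_prod (?n k) y {} x * iter_partial is \<phi> x) \<le> \<bar>iter_partial is \<phi> x\<bar>"
        by (simp add: abs_mult mult_left_le_one_le)
    qed
  qed measurable
  moreover have "(\<integral>x. ramp_prod (?n k) y {} x * iter_partial is \<phi> x \<partial>lborel) =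
      (- 1) ^ ?d * (\<integral>x. ramp_prod (?n k) y UNIV x * \<phi> x \<partial>lborel)" for k
    using ramp_prod_integral[OF _ \<phi> assms(2), of "?n k" "{}" y] assms(3) len by simp
  moreover have "(\<lambda>k. \<integral>x. ramp_prod (?n k) y UNIV x * \<phi> x \<partial>lborel) \<longlonglongrightarrow> 2 ^ ?d * \<phi> y"
  proof (rule LIMSEQ_I)
    fix e :: real assume "0 < e"
    define e' where "e' = e / 2 / 2 ^ ?d"
    have e': "0 < e'" using \<open>0 < e\<close> by (simp add: e'_def)
    have "isCont \<phi> y"
      using smooth_continuous_on[OF test_functionsD(1)[OF \<phi>], of UNIV] by (simp add: continuous_on_eq_continuous_at)
    then obtain r where r: "0 < r" "\<And>x. dist x y < r \<Longrightarrow> \<bar>\<phi> x - \<phi> y\<bar> < e'"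
      using e' unfolding continuous_at_eps_delta dist_real_def by blast
    \<comment> \<open>A cube of half-side \<open>1 / Suc N\<close> around \<open>y\<close> lies in the ball of radius \<open>r\<close>, as the norm is at most the sum of the coordinates.\<close>
    obtain N where N: "inverse (real (Suc N)) < r / (real ?d + 1)"
      using reals_Archimedean[of "r / (real ?d + 1)"] r by auto
    have "\<bar>(\<integral>x. ramp_prod (?n k) y UNIV x * \<phi> x \<partial>lborel) - 2 ^ ?d * \<phi> y\<bar> < e" if "N \<le> k" for k
    proof -
      let ?Q = "cbox (y - (\<chi> i. 1 / ?n k)) (y + (\<chi> i. 1 / ?n k))"
      have Q: "measure lborel ?Q = (2 / ?n k) ^ ?d"
        by (subst measure_lborel_cbox_cart) simp_all
      have small: "\<bar>\<phi> x - \<phi> y\<bar> \<le> e'" if "x \<in> ?Q" for x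
      proof -
        have "\<bar>(x - y) $ i\<bar> \<le> 1 / ?n k" for i
          using that by (auto simp: mem_box_cart abs_le_iff algebra_simps simp del: of_nat_Suc dest!: spec[of _ i])
        then have "norm (x - y) \<le> (\<Sum>i\<in>(UNIV::'n set). 1 / ?n k)"
          by (intro order_trans[OF norm_le_l1_cart] sum_mono)
        also have "\<dots> = real ?d * inverse (?n k)" by (simp add: field_simps)
        also have "\<dots> \<le> real ?d * inverse (?n N)"
          using \<open>N \<le> k\<close> by (intro mult_left_mono) auto
        also have "\<dots> \<le> real ?d * (r / (real ?d + 1))"
          using N by (intro mult_left_mono) auto
        also have "\<dots> < r" using r by (simp add: field_simps)
        finally show ?thesis using r(2)[of x] by (simp add: dist_norm)
      qed
      have iQ: "integrable lborel (\<lambda>x. ?n k ^ ?d * indicat_real ?Q x)"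
        by (intro integrable_mult_right integrable_real_indicator) (auto simp: emeasure_lborel_cbox_eq)
      have intQ: "(\<integral>x. ?n k ^ ?d * indicat_real ?Q x \<partial>lborel) = 2 ^ ?d"
        using Q by (simp add: power_divide del: of_nat_Suc)
      obtain B where B: "\<And>x. \<bar>\<phi> x\<bar> \<le> B" using test_functions_bounded[OF \<phi>] by blast
      have i1: "integrable lborel (\<lambda>x. \<phi> x * (?n k ^ ?d * indicat_real ?Q x))"
        by (rule integrable_bounded_mult[OF _ _ iQ, of _ B]) (use B in auto)
      have "(\<integral>x. ramp_prod (?n k) y UNIV x * \<phi> x \<partial>lborel) - 2 ^ ?d * \<phi> y =
        (\<integral>x. \<phi> x * (?n k ^ ?d * indicat_real ?Q x) \<partial>lborel) - \<phi> y * (\<integral>x. ?n k ^ ?d * indicat_real ?Q x \<partial>lborel)"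
        unfolding intQ by (simp add: ramp_prod_UNIV mult_ac del: of_nat_Suc)
      also have "\<dots> = (\<integral>x. \<phi> x * (?n k ^ ?d * indicat_real ?Q x) - \<phi> y * (?n k ^ ?d * indicat_real ?Q x) \<partial>lborel)"
        using i1 iQ by (subst Bochner_Integration.integral_diff) (simp_all del: of_nat_Suc)
      finally have eq: "(\<integral>x. ramp_prod (?n k) y UNIV x * \<phi> x \<partial>lborel) - 2 ^ ?d * \<phi> y = \<dots>" .
      have "\<bar>(\<integral>x. ramp_prod (?n k) y UNIV x * \<phi> x \<partial>lborel) - 2 ^ ?d * \<phi> y\<bar> \<le>
         (\<integral>x. \<bar>\<phi> x * (?n k ^ ?d * indicat_real ?Q x) - \<phi> y * (?n k ^ ?d * indicat_real ?Q x)\<bar> \<partial>lborel)"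
        unfolding eq by (rule integral_abs_bound)
      also have "\<dots> \<le> (\<integral>x. e' * (?n k ^ ?d * indicat_real ?Q x) \<partial>lborel)"
      proof (rule integral_mono)
        show "integrable lborel (\<lambda>x. \<bar>\<phi> x * (?n k ^ ?d * indicat_real ?Q x) - \<phi> y * (?n k ^ ?d * indicat_real ?Q x)\<bar>)"
          using i1 iQ by auto
        show "integrable lborel (\<lambda>x. e' * (?n k ^ ?d * indicat_real ?Q x))" using iQ by auto
        fix x
        have "\<bar>\<phi> x * (?n k ^ ?d * indicat_real ?Q x) - \<phi> y * (?n k ^ ?d * indicat_real ?Q x)\<bar> =
           \<bar>\<phi> x - \<phi> y\<bar> * (?n k ^ ?d * indicat_real ?Q x)"
          by (simp add: left_diff_distrib[symmetric] abs_mult del: of_nat_Suc)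
        also have "\<dots> \<le> e' * (?n k ^ ?d * indicat_real ?Q x)"
        proof (cases "x \<in> ?Q")
          case True
          then show ?thesis by (intro mult_right_mono small) auto
        next
          case False
          then have out: "indicat_real ?Q x = 0" by (rule indicator_simps)
          show ?thesis unfolding out by simp
        qed
        finally show "\<bar>\<phi> x * (?n k ^ ?d * indicat_real ?Q x) - \<phi> y * (?n k ^ ?d * indicat_real ?Q x)\<bar> \<le> \<dots>" .
      qed
      also have "\<dots> = e' * 2 ^ ?d" using intQ by (simp del: of_nat_Suc)
      also have "\<dots> < e" using \<open>0 < e\<close> by (simp add: e'_def)
      finally show ?thesis .
    qed
    then show "\<exists>no. \<forall>k\<ge>no. norm ((\<integral>x. ramp_prod (?n k) y UNIV x * \<phi> x \<partial>lborel) - 2 ^ ?d * \<phi> y) < e"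
      by auto
  qed
  from tendsto_mult_left[OF this, of "(- 1) ^ ?d"]
  have "(\<lambda>k. (- 1) ^ ?d * (\<integral>x. ramp_prod (?n k) y UNIV x * \<phi> x \<partial>lborel)) \<longlonglongrightarrow> (- 2) ^ ?d * \<phi> y"
    by (simp add: power_mult_distrib[symmetric] mult.assoc[symmetric])
  ultimately show ?thesis by (simp add: LIMSEQ_unique del: of_nat_Suc)
qed

section \<open>Smooth bump functions\<close>

text \<open>
The polynomial factor makes the family stable under differentiation, including at \<open>0\<close>.
\<close>
definition expo :: "real poly \<Rightarrow> real \<Rightarrow> real" where
  "expo p s = (if 0 < s then poly p (1 / s) * exp (- (1 / s)) else 0)"

lemma tendsto_poly_mult_exp_uminus:
  "((\<lambda>z::real. poly p z * exp (- z)) \<longlongrightarrow> 0) at_top"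
proof -
  have "((\<lambda>z::real. \<Sum>i\<le>degree p. coeff p i * (z ^ i / exp z)) \<longlongrightarrow> (\<Sum>i\<le>degree p. coeff p i * 0)) at_top"
    by (intro tendsto_intros tendsto_power_div_exp_0)
  then show ?thesis
    by (simp add: poly_altdef sum_distrib_right exp_minus divide_inverse mult.assoc)
qed

lemma expo_tendsto_0: "(expo p \<longlongrightarrow> 0) (at 0)"
proof (rule filterlim_split_at)
  have "eventually (\<lambda>s. s < 0) (at_left (0::real))" by (simp add: eventually_at_filter)
  then show "(expo p \<longlongrightarrow> 0) (at_left 0)"
    by (intro tendsto_eventually) (auto elim!: eventually_mono simp: expo_def)
  have "((\<lambda>s. poly p (inverse s) * exp (- (inverse s))) \<longlongrightarrow> 0) (at_right 0)"
    by (rule filterlim_compose[OF tendsto_poly_mult_exp_uminus filterlim_inverse_at_top_right])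
  moreover have "eventually (\<lambda>s. poly p (inverse s) * exp (- (inverse s)) = expo p s) (at_right (0::real))"
    by (auto simp: eventually_at_filter expo_def inverse_eq_divide)
  ultimately show "(expo p \<longlongrightarrow> 0) (at_right 0)" by (rule Lim_transform_eventually)
qed

lemma DERIV_expo: "(expo p has_real_derivative expo ([:0, 0, 1:] * (p - pderiv p)) s) (at s)"
proof -
  consider "s < 0" | "s = 0" | "0 < s" by linarith
  then show ?thesis
  proof cases
    case 1
    show ?thesis
    proof (rule has_field_derivative_transform_within_open[where S="{..<0}"])
      show "((\<lambda>_. 0) has_real_derivative expo ([:0, 0, 1:] * (p - pderiv p)) s) (at s)"
        using 1 by (simp add: expo_def)
    qed (use 1 in \<open>auto simp: expo_def\<close>)
  next
    case 2
    have "eventually (\<lambda>h. expo (pCons 0 p) h = (expo p (0 + h) - expo p 0) / h) (at (0::real))"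
      by (auto simp: eventually_at_filter expo_def)
    then have "((\<lambda>h. (expo p (0 + h) - expo p 0) / h) \<longlongrightarrow> 0) (at 0)"
      by (rule Lim_transform_eventually[OF expo_tendsto_0])
    then show ?thesis using 2 by (simp add: DERIV_def expo_def)
  next
    case 3
    show ?thesis
    proof (rule has_field_derivative_transform_within_open[where S="{0<..}"])
      have alg: "Q * (- 1 / s^2) * e + e * (1 / s^2) * R = 1 / s * (1 / s * (R - Q)) * e" for Q e R
        using 3 by (simp add: field_simps power2_eq_square)
      have 1: "((\<lambda>s. poly p (1 / s)) has_real_derivative poly (pderiv p) (1 / s) * (- 1 / s^2)) (at s)"
        using 3 by (intro DERIV_chain2[OF poly_DERIV]) (auto intro!: derivative_eq_intros simp: power2_eq_square)
      have 2: "((\<lambda>s. exp (- (1 / s))) has_real_derivative exp (- (1 / s)) * (1 / s^2)) (at s)"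
        using 3 by (auto intro!: derivative_eq_intros simp: power2_eq_square)
      show "((\<lambda>s. poly p (1 / s) * exp (- (1 / s))) has_real_derivative
          expo ([:0, 0, 1:] * (p - pderiv p)) s) (at s)"
        by (rule DERIV_cong[OF DERIV_mult[OF 1 2]], subst alg) (use 3 in \<open>simp add: expo_def\<close>)
    qed (use 3 in \<open>auto simp: expo_def\<close>)
  qed
qed

text \<open>
A class that contains the bump functions below and is stable under partial derivatives, by the
chain, sum and product rules.
\<close>
inductive_set expo_algebra :: "(real^'n::finite \<Rightarrow> real) set" where
  atom: "(\<lambda>x. expo p (c * x $ i + e)) \<in> expo_algebra"
| const: "(\<lambda>x. c) \<in> expo_algebra"
| add: "f \<in> expo_algebra \<Longrightarrow> g \<in> expo_algebra \<Longrightarrow> (\<lambda>x. f x + g x) \<in> expo_algebra"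
| mult: "f \<in> expo_algebra \<Longrightarrow> g \<in> expo_algebra \<Longrightarrow> (\<lambda>x. f x * g x) \<in> expo_algebra"

lemma expo_algebra_has_derivative:
  assumes "f \<in> expo_algebra"
  shows "\<exists>g. (\<forall>i. g i \<in> expo_algebra) \<and> (\<forall>x. (f has_derivative (\<lambda>v. \<Sum>i\<in>UNIV. v $ i * g i x)) (at x))"
  using assms
proof induction
  case (atom p c i e)
  define g where "g = (\<lambda>j x. (if j = i then c else 0) * expo ([:0, 0, 1:] * (p - pderiv p)) (c * (x :: real^'a) $ i + e))"
  have "g j \<in> expo_algebra" for j
    unfolding g_def by (intro expo_algebra.intros)
  moreover have "((\<lambda>x. expo p (c * x $ i + e)) has_derivative (\<lambda>v. \<Sum>j\<in>UNIV. v $ j * g j x)) (at x)" for x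
  proof -
    have "((\<lambda>x :: real^'a. c * x $ i + e) has_derivative (\<lambda>v. c * v $ i)) (at x)"
      by (auto intro!: derivative_eq_intros bounded_linear.has_derivative[OF bounded_linear_vec_nth])
    from has_derivative_compose[OF this DERIV_expo[unfolded has_field_derivative_def]]
    have "((\<lambda>x :: real^'a. expo p (c * x $ i + e)) has_derivative
      (\<lambda>v. expo ([:0, 0, 1:] * (p - pderiv p)) (c * x $ i + e) * (c * v $ i))) (at x)" .
    moreover have "(\<lambda>v. expo ([:0, 0, 1:] * (p - pderiv p)) (c * x $ i + e) * (c * v $ i)) =
      (\<lambda>v. \<Sum>j\<in>UNIV. v $ j * g j x)"
      unfolding g_def by (rule ext) (simp add: if_distrib[of "\<lambda>a. a * _"] if_distrib[of "\<lambda>a. _ * a"] mult_ac cong: if_cong)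
    ultimately show ?thesis by simp
  qed
  ultimately show ?case by blast
next
  case (const c)
  show ?case by (intro exI[of _ "\<lambda>_ _. 0"]) (auto intro: expo_algebra.const)
next
  case (add f g)
  then obtain f' g' where
    "\<And>i. f' i \<in> expo_algebra" "\<And>x. (f has_derivative (\<lambda>v. \<Sum>i\<in>UNIV. v $ i * f' i x)) (at x)"
    "\<And>i. g' i \<in> expo_algebra" "\<And>x. (g has_derivative (\<lambda>v. \<Sum>i\<in>UNIV. v $ i * g' i x)) (at x)"
    by blast
  then show ?case
    by (intro exI[of _ "\<lambda>i x. f' i x + g' i x"])
      (auto intro: expo_algebra.add intro!: derivative_eq_intros simp: distrib_left sum.distrib)
next
  case (mult f g)
  then obtain f' g' where
    fg: "\<And>i. f' i \<in> expo_algebra" "\<And>x. (f has_derivative (\<lambda>v. \<Sum>i\<in>UNIV. v $ i * f' i x)) (at x)"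
    "\<And>i. g' i \<in> expo_algebra" "\<And>x. (g has_derivative (\<lambda>v. \<Sum>i\<in>UNIV. v $ i * g' i x)) (at x)"
    by blast
  have "((\<lambda>x. f x * g x) has_derivative (\<lambda>v. \<Sum>i\<in>UNIV. v $ i * (f x * g' i x + f' i x * g x))) (at x)" for x
    by (rule has_derivative_eq_rhs[OF has_derivative_mult[OF fg(2,4)]])
      (auto simp: distrib_left sum.distrib sum_distrib_left sum_distrib_right mult_ac)
  moreover have "(\<lambda>x. f x * g' i x + f' i x * g x) \<in> expo_algebra" for i
    by (intro expo_algebra.add expo_algebra.mult fg mult.hyps)
  ultimately show ?case by (intro exI[of _ "\<lambda>i x. f x * g' i x + f' i x * g x"]) blast
qed

lemma expo_algebra_smooth:
  assumes "f \<in> expo_algebra"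
  shows "smooth f"
proof (rule smooth_if_closed_family[OF _ _ assms])
  fix f :: "real^'a \<Rightarrow> real" and x i assume "f \<in> expo_algebra"
  then obtain g where g: "\<And>i. g i \<in> expo_algebra" "\<And>x. (f has_derivative (\<lambda>v. \<Sum>i\<in>UNIV. v $ i * g i x)) (at x)"
    using expo_algebra_has_derivative by blast
  show "f differentiable (at x)" using g(2) by (rule differentiableI)
  have "partial_deriv i f = g i"
    by (rule ext) (simp add: partial_deriv_eq[OF g(2)] sum_axis_mult)
  then show "partial_deriv i f \<in> expo_algebra" using g(1) by simp
qed

lemma expo_algebra_prod:
  "finite A \<Longrightarrow> (\<And>a. a \<in> A \<Longrightarrow> f a \<in> expo_algebra) \<Longrightarrow> (\<lambda>x. \<Prod>a\<in>A. f a x) \<in> expo_algebra"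
  by (induction A rule: finite_induct) (auto intro: expo_algebra.intros)

text \<open>
The parameter \<open>n\<close> sharpens the bump: for \<open>n\<close> to infinity it tends to the indicator function of the
open box.
\<close>
definition bump :: "real \<Rightarrow> real^'n \<Rightarrow> real^'n \<Rightarrow> real^'n::finite \<Rightarrow> real" where
  "bump n a b x = (\<Prod>i\<in>UNIV. expo 1 (n * (x $ i - a $ i)) * expo 1 (n * (b $ i - x $ i)))"

lemma expo_1_bounds: "0 \<le> expo 1 s" "expo 1 s \<le> 1"
  by (auto simp: expo_def)

lemma bump_bounds: "0 \<le> bump n a b x" "bump n a b x \<le> 1"
  unfolding bump_def by (auto intro!: prod_nonneg prod_le_1 mult_le_one simp: expo_1_bounds)

lemma bump_smooth: "smooth (bump n a b)"
proof (rule expo_algebra_smooth)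
  have "(\<lambda>x. expo 1 (n * (x $ i - a $ i)) * expo 1 (n * (b $ i - x $ i))) \<in> expo_algebra" for i
    using expo_algebra.mult[OF expo_algebra.atom[of 1 n i "- (n * a $ i)"] expo_algebra.atom[of 1 "- n" i "n * b $ i"]]
    by (simp add: algebra_simps)
  then show "bump n a b \<in> expo_algebra"
    unfolding bump_def[abs_def] by (intro expo_algebra_prod) auto
qed

lemma bump_eq_0:
  assumes "0 < n" "x \<notin> box a b"
  shows "bump n a b x = 0"
proof -
  obtain i where i: "\<not> (a $ i < x $ i \<and> x $ i < b $ i)" using assms(2) by (auto simp: mem_box_cart)
  then have "expo 1 (n * (x $ i - a $ i)) * expo 1 (n * (b $ i - x $ i)) = 0"
    using assms(1) by (auto simp: expo_def zero_less_mult_iff)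
  then show ?thesis unfolding bump_def by (intro prod_zero) (auto simp del: mult_eq_0_iff)
qed

lemma bump_test_function:
  assumes "0 < n" "cbox a b \<subseteq> C"
  shows "bump n a b \<in> test_functions C"
proof -
  have "closure {x. bump n a b x \<noteq> 0} \<subseteq> cbox a b"
    using bump_eq_0[OF assms(1)] box_subset_cbox by (intro closure_minimal) blast+
  then show ?thesis
    using assms compact_closure_subset[OF _ compact_cbox] by (auto simp: test_functions_def bump_smooth)
qed

lemma bump_tendsto_indicator: "(\<lambda>k. bump (real (Suc k)) a b x) \<longlonglongrightarrow> indicator (box a b) x"
proof (cases "x \<in> box a b")
  case True
  have *: "(\<lambda>k. expo 1 (real (Suc k) * t)) \<longlonglongrightarrow> 1" if "0 < t" for t
  proof -
    have "(\<lambda>k. exp (- (inverse (real (Suc k)) * (1 / t)))) \<longlonglongrightarrow> exp (- (0 * (1 / t)))"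
      by (intro tendsto_intros LIMSEQ_inverse_real_of_nat)
    then show ?thesis using that by (simp add: expo_def divide_inverse del: of_nat_Suc)
  qed
  have "(\<lambda>k. bump (real (Suc k)) a b x) \<longlonglongrightarrow> (\<Prod>i\<in>(UNIV::'a set). 1 * 1)"
    unfolding bump_def using True by (intro tendsto_prod tendsto_mult *) (auto simp: mem_box_cart)
  then show ?thesis using True by simp
next
  case False
  then have "bump (real (Suc k)) a b x = 0" for k by (intro bump_eq_0) auto
  then show ?thesis using False by simp
qed

section \<open>Essential bounds from test functions\<close>

lemma integral_lebesgue_on_test:
  assumes "\<phi> \<in> test_functions C" "C \<in> sets lebesgue"
  shows "(LINT x|lebesgue_on C. u x * \<phi> x) = (LINT x|lebesgue. u x * \<phi> x)"
proof -
  have "(LINT x|lebesgue_on C. u x * \<phi> x) = (LINT x|lebesgue. indicator C x *\<^sub>R (u x * \<phi> x))"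
    using assms(2) by (intro integral_restrict_space) auto
  also have "\<dots> = (LINT x|lebesgue. u x * \<phi> x)"
    using test_functions_outside[OF assms(1)]
    by (intro Bochner_Integration.integral_cong) (auto simp: indicator_def)
  finally show ?thesis .
qed

text \<open>
The hypothesis is applied to bump functions that converge to the indicator function of the box.
\<close>
lemma box_integral_le_of_test:
  fixes u :: "real^'n::finite \<Rightarrow> real"
  assumes C: "C \<in> sets lebesgue" and Q: "cbox a b \<subseteq> C" and u: "u absolutely_integrable_on cbox a b"
    and le: "\<And>\<phi>. \<phi> \<in> test_functions C \<Longrightarrow>
      \<bar>LINT x|lebesgue_on C. u x * \<phi> x\<bar> \<le> M * (LINT x|lebesgue_on C. \<bar>\<phi> x\<bar>)"
    and M: "0 \<le> M"
  shows "\<bar>integral (cbox a b) u\<bar> \<le> M * measure lborel (cbox a b)"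
proof -
  let ?b = "\<lambda>k. bump (real (Suc k)) a b"
  have T: "?b k \<in> test_functions C" for k by (rule bump_test_function) (use Q in auto)
  have m[measurable]: "?b k \<in> borel_measurable borel" for k using T by (rule test_functions_measurable)
  have ml: "?b k \<in> borel_measurable lebesgue" for k
    using m[of k] by (simp add: borel_measurable_if_I measurable_completion)
  have iu: "integrable lebesgue (\<lambda>x. indicator (cbox a b) x *\<^sub>R u x)" using u by (simp add: set_integrable_def)
  have bQ: "?b k x = indicator (cbox a b) x * ?b k x" for k x
    using bump_eq_0[of "real (Suc k)" x a b] box_subset_cbox[of a b] by (auto simp: indicator_def)
  have lim: "(\<lambda>k. LINT x|lebesgue. u x * ?b k x) \<longlonglongrightarrow> (LINT x|lebesgue. indicator (box a b) x *\<^sub>R u x)"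
  proof (rule integral_dominated_convergence[where w="\<lambda>x. \<bar>indicator (cbox a b) x *\<^sub>R u x\<bar>"])
    have eq: "indicator (box a b) x *\<^sub>R u x = indicator (box a b) x * (indicator (cbox a b) x *\<^sub>R u x)" for x
      using box_subset_cbox[of a b] by (auto simp: indicator_def)
    show "(\<lambda>x. indicator (box a b) x *\<^sub>R u x) \<in> borel_measurable lebesgue"
      unfolding eq using iu by (intro borel_measurable_times borel_measurable_indicator) auto
    have eq2: "u x * ?b k x = ?b k x * (indicator (cbox a b) x *\<^sub>R u x)" for k x
      using bQ[of k x] by (auto simp: indicator_def)
    show "(\<lambda>x. u x * ?b k x) \<in> borel_measurable lebesgue" for k
      unfolding eq2 using iu ml by (intro borel_measurable_times) auto
    show "AE x in lebesgue. norm (u x * ?b k x) \<le> \<bar>indicator (cbox a b) x *\<^sub>R u x\<bar>" for k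
      unfolding eq2 using bump_bounds[of "real (Suc k)" a b]
      by (auto simp: abs_mult intro!: mult_left_le_one_le)
    show "AE x in lebesgue. (\<lambda>k. u x * ?b k x) \<longlonglongrightarrow> indicator (box a b) x *\<^sub>R u x"
    proof (rule AE_I2)
      fix x
      show "(\<lambda>k. u x * ?b k x) \<longlonglongrightarrow> indicator (box a b) x *\<^sub>R u x"
        using tendsto_mult_left[OF bump_tendsto_indicator[of a b x], of "u x"]
        by (simp only: real_scaleR_def mult.commute)
    qed
  qed (use iu in auto)
  have "(LINT x|lebesgue. indicator (box a b) x *\<^sub>R u x) = integral (box a b) u"
  proof -
    have "set_integrable lebesgue (box a b) u"
      using u by (rule set_integrable_subset) (auto simp: box_subset_cbox)
    from set_lebesgue_integral_eq_integral(2)[OF this] show ?thesis by (simp add: set_lebesgue_integral_def)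
  qed
  then have lim: "(\<lambda>k. \<bar>LINT x|lebesgue. u x * ?b k x\<bar>) \<longlonglongrightarrow> \<bar>integral (cbox a b) u\<bar>"
    using tendsto_rabs[OF lim] by (simp add: integral_open_interval)
  have "\<bar>LINT x|lebesgue. u x * ?b k x\<bar> \<le> M * measure lborel (cbox a b)" for k
  proof -
    have "\<bar>LINT x|lebesgue. u x * ?b k x\<bar> \<le> M * (LINT x|lebesgue. \<bar>?b k x\<bar>)"
      using le[OF T[of k]] integral_lebesgue_on_test[OF T C, of u k] 
        integral_lebesgue_on_test[OF T C, of "\<lambda>_. 1" k] bump_bounds[of "real (Suc k)" a b] by simp
    also have "(LINT x|lebesgue. \<bar>?b k x\<bar>) = (LINT x|lborel. \<bar>?b k x\<bar>)"
      by (rule integral_completion) (simp del: of_nat_Suc)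
    also have "\<dots> \<le> (LINT x|lborel. indicator (cbox a b) x)"
    proof (rule integral_mono)
      show "integrable lborel (\<lambda>x. \<bar>?b k x\<bar>)" using test_functions_integrable[OF T] by auto
      show "integrable lborel (indicat_real (cbox a b))" by (simp add: emeasure_lborel_cbox_eq)
      show "\<bar>?b k x\<bar> \<le> indicat_real (cbox a b) x" for x
        by (subst bQ) (use bump_bounds[of "real (Suc k)" a b] in \<open>auto simp: indicator_def\<close>)
    qed
    also have "\<dots> = measure lborel (cbox a b)" by simp
    finally show ?thesis using M by (simp add: mult_left_mono)
  qed
  then show ?thesis using lim by (intro LIMSEQ_le_const2[OF lim]) auto
qed

text \<open>
The mean of \<open>u\<close> over every small box is at most \<open>M\<close> in absolute value, and almost every value of
\<open>u\<close> is a limit of such means by the Lebesgue differentiation theorem. As that theorem concerns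
functions which are integrable on all boxes, \<open>u\<close> is first cut off to a box inside \<open>C\<close>; countably
many of those cover \<open>C\<close>.
\<close>
lemma AE_le_of_test:
  fixes u :: "real^'n::finite \<Rightarrow> real"
  assumes C: "open C" and u: "locally_integrable C u"
    and le: "\<And>\<phi>. \<phi> \<in> test_functions C \<Longrightarrow>
      \<bar>LINT x|lebesgue_on C. u x * \<phi> x\<bar> \<le> M * (LINT x|lebesgue_on C. \<bar>\<phi> x\<bar>)"
    and M: "0 \<le> M"
  shows "AE x in lebesgue_on C. \<bar>u x\<bar> \<le> M"
proof -
  have Cs: "C \<in> sets lebesgue" using C by (auto intro: borel_open)
  have on_box: "AE x in lebesgue. x \<in> box a b \<longrightarrow> \<bar>u x\<bar> \<le> M" if Q: "cbox a b \<subseteq> C" for a b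
  proof -
    define v where "v = (\<lambda>x. if x \<in> cbox a b then u x else 0)"
    have uQ: "u absolutely_integrable_on cbox a b"
      using u Q by (auto simp: locally_integrable_def)
    have "v absolutely_integrable_on UNIV" unfolding v_def using uQ by (simp add: absolutely_integrable_restrict_UNIV)
    then have "v integrable_on cbox c d" for c d
      by (intro set_lebesgue_integral_eq_integral(1)) (auto intro: set_integrable_subset)
    then obtain N where N: "negligible N" and lim: "\<And>x e. \<lbrakk>x \<notin> N; 0 < e\<rbrakk> \<Longrightarrow>
        \<exists>d>0. \<forall>h. 0 < h \<and> h < d \<longrightarrow> norm (integral (cbox x (x + h *\<^sub>R One)) v /\<^sub>R h ^ DIM(real^'n) - v x) < e"
      by (rule integrable_ccontinuous_explicit) blast
    have "\<bar>u x\<bar> \<le> M" if x: "x \<in> box a b" "x \<notin> N" for x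
    proof (rule field_le_epsilon)
      fix e :: real assume "0 < e"
      from lim[OF x(2) this] obtain d where d: "0 < d"
        and dl: "\<And>h. 0 < h \<Longrightarrow> h < d \<Longrightarrow> norm (integral (cbox x (x + h *\<^sub>R One)) v /\<^sub>R h ^ DIM(real^'n) - v x) < e"
        by blast
      obtain r where r: "0 < r" "ball x r \<subseteq> box a b" using x(1) open_box open_contains_ball by blast
      define h where "h = min (d / 2) (r / (real (DIM(real^'n)) + 1))"
      have h: "0 < h" "h < d" using d r by (auto simp: h_def)
      have sub: "cbox x (x + h *\<^sub>R One) \<subseteq> box a b"
      proof
        fix y assume y: "y \<in> cbox x (x + h *\<^sub>R One)"
        have "norm (y - x) \<le> (\<Sum>i\<in>Basis. \<bar>(y - x) \<bullet> i\<bar>)" by (rule norm_le_l1)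
        also have "\<dots> \<le> (\<Sum>i\<in>(Basis :: (real^'n) set). h)"
          using y by (intro sum_mono) (auto simp: mem_box inner_simps)
        also have "\<dots> = real DIM(real^'n) * h" by simp
        also have "\<dots> \<le> real DIM(real^'n) * (r / (real (DIM(real^'n)) + 1))"
          by (intro mult_left_mono) (auto simp: h_def)
        also have "\<dots> < r" using r by (simp add: field_simps)
        finally show "y \<in> box a b" using r by (auto simp: dist_norm norm_minus_commute)
      qed
      then have subQ: "cbox x (x + h *\<^sub>R One) \<subseteq> cbox a b" using box_subset_cbox by blast
      have "integral (cbox x (x + h *\<^sub>R One)) v = integral (cbox x (x + h *\<^sub>R One)) u"
        using subQ by (intro integral_cong) (auto simp: v_def)
      moreover have "\<bar>integral (cbox x (x + h *\<^sub>R One)) u\<bar> \<le> M * measure lborel (cbox x (x + h *\<^sub>R One))"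
        by (rule box_integral_le_of_test[OF Cs _ set_integrable_subset[OF uQ _ subQ] le M]) (use subQ Q in auto)
      moreover have "measure lborel (cbox x (x + h *\<^sub>R One)) = h ^ DIM(real^'n)"
        using h by (subst content_cbox) (simp_all add: inner_simps)
      ultimately have "\<bar>integral (cbox x (x + h *\<^sub>R One)) v /\<^sub>R h ^ DIM(real^'n)\<bar> \<le> M"
        using h by (simp add: abs_mult field_simps)
      moreover have "v x = u x" using x(1) box_subset_cbox by (auto simp: v_def)
      ultimately show "\<bar>u x\<bar> \<le> M + e" using dl[OF h] by (smt (verit, ccfv_threshold) real_norm_def)
    qed
    then show ?thesis
      using N by (intro AE_I'[of N]) (auto simp: negligible_iff_null_sets)
  qed
  obtain \<D> where D: "countable \<D>" "\<D> \<subseteq> Pow C" "\<And>X. X \<in> \<D> \<Longrightarrow> \<exists>a b. X = cbox a b" "\<Union>\<D> = C"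
    using open_countable_Union_open_cbox[OF C] by blast
  have "AE x in lebesgue. \<forall>X\<in>\<D>. x \<in> X \<longrightarrow> \<bar>u x\<bar> \<le> M"
  proof (rule AE_ball_countable'[OF _ D(1)])
    fix X assume "X \<in> \<D>"
    then obtain a b where X: "X = cbox a b" "cbox a b \<subseteq> C" using D by blast
    have "AE x in lebesgue. x \<notin> cbox a b - box a b"
      using negligible_frontier_interval[of a b] by (intro AE_not_in) (simp add: negligible_iff_null_sets)
    then show "AE x in lebesgue. x \<in> X \<longrightarrow> \<bar>u x\<bar> \<le> M"
      using on_box[OF X(2)] by eventually_elim (auto simp: X)
  qed
  then have "AE x in lebesgue. x \<in> C \<longrightarrow> \<bar>u x\<bar> \<le> M"
    by eventually_elim (use D(4) in blast)
  then show ?thesis using Cs by (simp add: AE_restrict_space_iff)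
qed

section \<open>Essential suprema and Borel representatives\<close>

lemma Linf_AE:
  assumes "f \<in> Linf C"
  shows "AE x in lebesgue_on C. \<bar>f x\<bar> \<le> Linf_norm C f"
proof -
  let ?e = "esssup (lebesgue_on C) (\<lambda>x. ereal \<bar>f x\<bar>)"
  have "?e < \<infinity>" using assms by (simp add: Linf_def)
  have "AE x in lebesgue_on C. ereal \<bar>f x\<bar> \<le> ?e" by (rule esssup_AE)
  then show ?thesis
  proof eventually_elim
    case (elim x)
    then show ?case using \<open>?e < \<infinity>\<close> unfolding Linf_norm_def by (cases ?e) auto
  qed
qed

lemma Linf_norm_nonneg: "0 \<le> Linf_norm C f"
proof (cases "(\<lambda>x. ereal \<bar>f x\<bar>) \<in> borel_measurable (lebesgue_on C)")
  case True
  let ?e = "esssup (lebesgue_on C) (\<lambda>x. ereal \<bar>f x\<bar>)"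
  show ?thesis
  proof (cases "emeasure (lebesgue_on C) (space (lebesgue_on C)) = 0")
    case True2: True
    then show ?thesis using esssup_zero_space[OF True2 True] by (simp add: Linf_norm_def)
  next
    case False
    have "esssup (lebesgue_on C) (\<lambda>x. 0::ereal) \<le> ?e" by (rule esssup_mono) auto
    then have "0 \<le> ?e" using esssup_const[OF False, of "0::ereal"] by simp
    then show ?thesis by (simp add: Linf_norm_def real_of_ereal_pos)
  qed
next
  case False
  then show ?thesis by (simp add: Linf_norm_def esssup_non_measurable top_ereal_def)
qed

lemma Linf_normI:
  assumes f: "f \<in> borel_measurable (lebesgue_on C)" and c: "AE x in lebesgue_on C. \<bar>f x\<bar> \<le> c" "0 \<le> c"
  shows "f \<in> Linf C" "Linf_norm C f \<le> c"
proof -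
  have e: "esssup (lebesgue_on C) (\<lambda>x. ereal \<bar>f x\<bar>) \<le> ereal c"
    using f c(1) by (intro esssup_I) auto
  then show "f \<in> Linf C" using f by (auto simp: Linf_def intro: le_less_trans)
  show "Linf_norm C f \<le> c"
    using e c(2) unfolding Linf_norm_def
    by (cases "esssup (lebesgue_on C) (\<lambda>x. ereal \<bar>f x\<bar>)") auto
qed

lemma Linf_measurable_AE_cong:
  assumes "f \<in> Linf C" "g \<in> borel_measurable (lebesgue_on C)" "AE x in lebesgue_on C. f x = g x"
  shows "g \<in> Linf C" "Linf_norm C g = Linf_norm C f"
proof -
  have "AE x in lebesgue_on C. \<bar>g x\<bar> \<le> Linf_norm C f"
    using Linf_AE[OF assms(1)] assms(3) by eventually_elim auto
  note g = Linf_normI[OF assms(2) this Linf_norm_nonneg]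
  show "g \<in> Linf C" by (rule g)
  have "AE x in lebesgue_on C. \<bar>f x\<bar> \<le> Linf_norm C g"
    using Linf_AE[OF \<open>g \<in> Linf C\<close>] assms(3) by eventually_elim auto
  then have "Linf_norm C f \<le> Linf_norm C g"
    using assms(1) by (intro Linf_normI Linf_norm_nonneg) (auto simp: Linf_def)
  then show "Linf_norm C g = Linf_norm C f" using g(2) by simp
qed

text \<open>
Fubini is applied below with respect to products of Borel measures, so that the Lebesgue
measurable members of \<open>Linf C\<close> are replaced by Borel functions; truncation makes the bound hold
everywhere.
\<close>
lemma Linf_borel_representative:
  fixes f :: "real^'n::finite \<Rightarrow> real"
  assumes f: "f \<in> Linf C" and C: "open C"
  obtains f' where "f' \<in> borel_measurable borel" "\<And>x. \<bar>f' x\<bar> \<le> Linf_norm C f"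
    "\<And>x. x \<notin> C \<Longrightarrow> f' x = 0" "AE x in lebesgue_on C. f x = f' x"
proof -
  let ?N = "Linf_norm C f"
  have Cb[measurable]: "C \<in> sets borel" using C by simp
  have Cs: "C \<in> sets lebesgue" using C by auto
  have "(\<lambda>x. if x \<in> C then f x else 0) \<in> borel_measurable lebesgue"
    using f Cs by (intro borel_measurable_if_I) (auto simp: Linf_def)
  then obtain f0 where f0[measurable]: "f0 \<in> borel_measurable borel"
    and eq: "AE x in lborel. (if x \<in> C then f x else 0) = f0 x"
    using completion_ex_borel_measurable_real by force
  define f' where "f' = (\<lambda>x. if x \<in> C then max (- ?N) (min ?N (f0 x)) else 0)"
  have "AE x in lebesgue_on C. f x = f0 x"
    using AE_completion[OF eq] Cs by (auto simp: AE_restrict_space_iff elim!: eventually_mono)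
  then have eq': "AE x in lebesgue_on C. f x = f' x"
    using Linf_AE[OF f] AE_space[of "lebesgue_on C"] by eventually_elim (auto simp: f'_def)
  have m: "f' \<in> borel_measurable borel" unfolding f'_def by measurable
  have b: "\<bar>f' x\<bar> \<le> ?N" for x using Linf_norm_nonneg[of C f] by (auto simp: f'_def)
  have o: "f' x = 0" if "x \<notin> C" for x using that by (simp add: f'_def)
  show ?thesis by (rule that[OF m b o eq'])
qed

lemma integral_test_representative:
  fixes f f' :: "real^'n::finite \<Rightarrow> real"
  assumes C: "open C" and f: "f \<in> borel_measurable (lebesgue_on C)"
    and f': "f' \<in> borel_measurable borel" and eq: "AE x in lebesgue_on C. f x = f' x"
    and \<phi>: "\<phi> \<in> test_functions C"
  shows "(LINT x|lebesgue_on C. f x * \<phi> x) = (\<integral>x. f' x * \<phi> x \<partial>lborel)"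
proof -
  have Cs: "C \<in> sets lebesgue" using C by auto
  note [measurable] = f' test_functions_measurable[OF \<phi>]
  have ml: "g \<in> borel_measurable (lebesgue_on C)" if "g \<in> borel_measurable borel" for g :: "real^'n \<Rightarrow> real"
    using that by (intro measurable_restrict_space1 measurable_completion) simp
  have "(LINT x|lebesgue_on C. f x * \<phi> x) = (LINT x|lebesgue_on C. f' x * \<phi> x)"
  proof (rule integral_cong_AE)
    show "AE x in lebesgue_on C. f x * \<phi> x = f' x * \<phi> x" using eq by eventually_elim simp
    show "(\<lambda>x. f x * \<phi> x) \<in> borel_measurable (lebesgue_on C)"
      by (rule borel_measurable_times[OF f ml[OF test_functions_measurable[OF \<phi>]]])
    show "(\<lambda>x. f' x * \<phi> x) \<in> borel_measurable (lebesgue_on C)"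
      by (rule ml) measurable
  qed
  also have "\<dots> = (LINT x|lebesgue. f' x * \<phi> x)" by (rule integral_lebesgue_on_test[OF \<phi> Cs])
  also have "\<dots> = (\<integral>x. f' x * \<phi> x \<partial>lborel)" by (rule integral_completion) simp
  finally show ?thesis .
qed

section \<open>Fubini for averages of translates\<close>

lemma integral_shift_sub:
  fixes f :: "'a::euclidean_space \<Rightarrow> real"
  assumes "f \<in> borel_measurable borel"
  shows "(\<integral>x. f (x - c) \<partial>lborel) = (\<integral>x. f x \<partial>lborel)"
  using integral_lborel_shift[OF assms, of "- c"] by simp

lemma integrable_shift_sub:
  fixes f :: "'a::euclidean_space \<Rightarrow> real"
  assumes "integrable lborel f"
  shows "integrable lborel (\<lambda>x. f (x - c))"
  using integrable_lborel_shift[OF assms, of "- c"] by simp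

lemma translate_average_eq_lborel_integral:
  fixes s :: "'b::euclidean_space \<Rightarrow> real^'n::finite" and \<phi> :: "real^'n \<Rightarrow> real"
  assumes s: "continuous_on UNIV s" and \<phi>: "smooth \<phi>"
  shows "integral (cbox a b) (\<lambda>t. \<phi> (x - s t)) = (\<integral>t. indicator (cbox a b) t * \<phi> (x - s t) \<partial>lborel)"
proof -
  have "continuous_on (cbox a b) (\<lambda>t. \<phi> (x - s t))"
    by (intro continuous_on_compose2[OF smooth_continuous_on[OF \<phi>, of UNIV]] continuous_intros
        continuous_on_subset[OF s]) auto
  then have "set_integrable lborel (cbox a b) (\<lambda>t. \<phi> (x - s t))"
    unfolding set_integrable_def by (intro borel_integrable_compact) auto
  from set_borel_integral_eq_integral(2)[OF this] show ?thesis
    by (simp add: set_lebesgue_integral_def)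
qed

lemma translate_average_Fubini:
  fixes s :: "'b::euclidean_space \<Rightarrow> real^'n::finite" and w \<phi> :: "real^'n \<Rightarrow> real"
  assumes s: "continuous_on UNIV s" and \<phi>: "\<phi> \<in> test_functions C"
    and w[measurable]: "w \<in> borel_measurable borel" and B: "\<And>x. \<bar>w x\<bar> \<le> B"
  shows "(\<integral>x. w x * integral (cbox a b) (\<lambda>t. \<phi> (x - s t)) \<partial>lborel) =
         (\<integral>t. indicator (cbox a b) t * (\<integral>x. w x * \<phi> (x - s t) \<partial>lborel) \<partial>lborel)"
    and "integrable lborel (\<lambda>t. indicator (cbox a b) t * (\<integral>x. w x * \<phi> (x - s t) \<partial>lborel))"
proof -
  note [measurable] = test_functions_measurable[OF \<phi>] borel_measurable_continuous_onI[OF s]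
  note T = test_functionsD[OF \<phi>]
  have B0: "0 \<le> B" using B[of 0] by simp
  let ?K = "\<lambda>t x. indicat_real (cbox a b) t * (w x * \<phi> (x - s t))"
  have ix: "integrable lborel (\<lambda>x. w x * \<phi> (x - s t))" for t
    by (intro integrable_bounded_mult[of _ _ B] integrable_shift_sub test_functions_integrable[OF \<phi>]) (use B in auto)
  have K: "integrable (lborel \<Otimes>\<^sub>M lborel) (case_prod ?K)"
  proof (rule lborel_pair.Fubini_integrable)
    show "integrable lborel (\<lambda>t. \<integral>x. norm (case_prod ?K (t, x)) \<partial>lborel)"
    proof (rule Bochner_Integration.integrable_bound)
      show "integrable lborel (\<lambda>t. indicat_real (cbox a b) t * (B * (\<integral>x. \<bar>\<phi> x\<bar> \<partial>lborel)))"
        by (simp add: emeasure_lborel_cbox_eq)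
      show "(\<lambda>t. \<integral>x. norm (case_prod ?K (t, x)) \<partial>lborel) \<in> borel_measurable lborel"
        by measurable
      show "AE t in lborel. norm (\<integral>x. norm (case_prod ?K (t, x)) \<partial>lborel) \<le>
          norm (indicat_real (cbox a b) t * (B * (\<integral>x. \<bar>\<phi> x\<bar> \<partial>lborel)))"
      proof (rule AE_I2)
        fix t
        have "(\<integral>x. \<bar>w x * \<phi> (x - s t)\<bar> \<partial>lborel) \<le> (\<integral>x. B * \<bar>\<phi> (x - s t)\<bar> \<partial>lborel)"
        proof (rule integral_mono[OF integrable_abs[OF ix]])
          show "integrable lborel (\<lambda>x. B * \<bar>\<phi> (x - s t)\<bar>)"
            by (intro integrable_mult_right integrable_abs integrable_shift_sub test_functions_integrable[OF \<phi>])
        qed (auto simp: abs_mult intro!: mult_right_mono B)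
        also have "\<dots> = B * (\<integral>x. \<bar>\<phi> x\<bar> \<partial>lborel)"
          using integral_shift_sub[of "\<lambda>x. \<bar>\<phi> x\<bar>" "s t"] by simp
        finally have le: "(\<integral>x. \<bar>w x * \<phi> (x - s t)\<bar> \<partial>lborel) \<le> B * (\<integral>x. \<bar>\<phi> x\<bar> \<partial>lborel)" .
        have "(\<integral>x. norm (case_prod ?K (t, x)) \<partial>lborel) = indicat_real (cbox a b) t * (\<integral>x. \<bar>w x * \<phi> (x - s t)\<bar> \<partial>lborel)"
          by (simp add: abs_mult)
        then show "norm (\<integral>x. norm (case_prod ?K (t, x)) \<partial>lborel) \<le>
          norm (indicat_real (cbox a b) t * (B * (\<integral>x. \<bar>\<phi> x\<bar> \<partial>lborel)))"
          using mult_left_mono[OF le, of "indicat_real (cbox a b) t"] B0 by (simp add: abs_mult)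
      qed
    qed
    show "AE t in lborel. integrable lborel (\<lambda>x. case_prod ?K (t, x))"
      using ix by auto
  qed measurable
  have "(\<integral>x. w x * integral (cbox a b) (\<lambda>t. \<phi> (x - s t)) \<partial>lborel) = (\<integral>x. (\<integral>t. ?K t x \<partial>lborel) \<partial>lborel)"
    by (simp add: translate_average_eq_lborel_integral[OF s T(1)] mult.left_commute[of _ "w _"])
  also have "\<dots> = (\<integral>t. (\<integral>x. ?K t x \<partial>lborel) \<partial>lborel)"
    by (rule lborel_pair.Fubini_integral[OF K])
  finally show "(\<integral>x. w x * integral (cbox a b) (\<lambda>t. \<phi> (x - s t)) \<partial>lborel) =
         (\<integral>t. indicator (cbox a b) t * (\<integral>x. w x * \<phi> (x - s t) \<partial>lborel) \<partial>lborel)"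
    by simp
  show "integrable lborel (\<lambda>t. indicator (cbox a b) t * (\<integral>x. w x * \<phi> (x - s t) \<partial>lborel))"
    using lborel_pair.integrable_fst[OF K] by simp
qed

text \<open>
Fubini with the weight \<open>w = sgn \<psi>\<close>, where \<open>\<psi>\<close> is the average, since \<open>\<bar>\<psi>\<bar> = sgn \<psi> * \<psi>\<close>.
\<close>
lemma translate_average_L1_bound:
  fixes s :: "'b::euclidean_space \<Rightarrow> real^'n::finite" and \<phi> :: "real^'n \<Rightarrow> real"
  assumes s: "continuous_on UNIV s" and \<phi>: "\<phi> \<in> test_functions C"
  shows "(\<integral>x. \<bar>integral (cbox a b) (\<lambda>t. \<phi> (x - s t))\<bar> \<partial>lborel) \<le> measure lborel (cbox a b) * (\<integral>x. \<bar>\<phi> x\<bar> \<partial>lborel)"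
proof -
  let ?\<psi> = "\<lambda>x. integral (cbox a b) (\<lambda>t. \<phi> (x - s t))"
  note [measurable] = test_functions_measurable[OF \<phi>]
  have "?\<psi> \<in> borel_measurable borel"
    using translate_average_smooth[OF continuous_on_subset[OF s] test_functionsD(1)[OF \<phi>], of a b]
    by (intro borel_measurable_continuous_onI smooth_continuous_on) auto
  then have m: "(\<lambda>x. sgn (?\<psi> x)) \<in> borel_measurable borel" by measurable
  have b: "\<bar>sgn (?\<psi> x)\<bar> \<le> 1" for x by (simp add: abs_sgn_eq)
  have "(\<integral>x. \<bar>?\<psi> x\<bar> \<partial>lborel) = (\<integral>x. sgn (?\<psi> x) * ?\<psi> x \<partial>lborel)"
    by (simp add: sgn_mult_self_eq abs_sgn mult.commute)
  also have "\<dots> = (\<integral>t. indicator (cbox a b) t * (\<integral>x. sgn (?\<psi> x) * \<phi> (x - s t) \<partial>lborel) \<partial>lborel)"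
    by (rule translate_average_Fubini(1)[OF s \<phi> m b])
  also have "\<dots> \<le> (\<integral>t. indicator (cbox a b) t * (\<integral>x. \<bar>\<phi> x\<bar> \<partial>lborel) \<partial>lborel)"
  proof (rule integral_mono[OF translate_average_Fubini(2)[OF s \<phi> m b]])
    show "integrable lborel (\<lambda>t. indicat_real (cbox a b) t * (\<integral>x. \<bar>\<phi> x\<bar> \<partial>lborel))"
      by (simp add: emeasure_lborel_cbox_eq)
    fix t
    have "(\<integral>x. sgn (?\<psi> x) * \<phi> (x - s t) \<partial>lborel) \<le> (\<integral>x. \<bar>\<phi> (x - s t)\<bar> \<partial>lborel)"
    proof (rule integral_mono)
      show "integrable lborel (\<lambda>x. sgn (?\<psi> x) * \<phi> (x - s t))"
        using m by (intro integrable_bounded_mult[of _ _ 1] integrable_shift_sub test_functions_integrable[OF \<phi>])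
          (simp_all add: b)
      show "integrable lborel (\<lambda>x. \<bar>\<phi> (x - s t)\<bar>)"
        using integrable_shift_sub[OF test_functions_integrable[OF \<phi>]] by auto
      show "sgn (?\<psi> x) * \<phi> (x - s t) \<le> \<bar>\<phi> (x - s t)\<bar>" for x
      proof (rule order_trans[OF abs_ge_self])
        show "\<bar>sgn (?\<psi> x) * \<phi> (x - s t)\<bar> \<le> \<bar>\<phi> (x - s t)\<bar>"
          using mult_right_mono[OF b[of x] abs_ge_zero[of "\<phi> (x - s t)"]] by (simp only: abs_mult mult_1)
      qed
    qed
    also have "\<dots> = (\<integral>x. \<bar>\<phi> x\<bar> \<partial>lborel)" by (rule integral_shift_sub) measurable
    finally show "indicat_real (cbox a b) t * (\<integral>x. sgn (?\<psi> x) * \<phi> (x - s t) \<partial>lborel) \<le>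
        indicat_real (cbox a b) t * (\<integral>x. \<bar>\<phi> x\<bar> \<partial>lborel)"
      by (intro mult_left_mono) auto
  qed
  also have "\<dots> = measure lborel (cbox a b) * (\<integral>x. \<bar>\<phi> x\<bar> \<partial>lborel)" by simp
  finally show ?thesis .
qed

section \<open>The mixed derivative of a box average\<close>

lemma integral_reflect:
  fixes f :: "'a::euclidean_space \<Rightarrow> real"
  assumes [measurable]: "f \<in> borel_measurable borel"
  shows "(\<integral>x. f (c - x) \<partial>lborel) = (\<integral>x. f x \<partial>lborel)"
proof -
  have "(\<integral>x. f x \<partial>lborel) = (\<integral>x. f x \<partial>density (distr lborel borel (\<lambda>x. c + (-1) *\<^sub>R x)) (\<lambda>_. \<bar>-1::real\<bar> ^ DIM('a)))"
    by (subst lborel_affine[of "-1" c]) simp_all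
  also have "\<dots> = (\<integral>x. f (c - x) \<partial>lborel)"
    by (subst integral_density) (simp_all add: integral_distr)
  finally show ?thesis by simp
qed

text \<open>
The fundamental theorem of calculus on a box: the integral of the mixed derivative of \<open>\<phi>\<close> over
the box of the points \<open>x - y\<close> is the alternating sum over its vertices. Up to a null set the indicator function of the box is the
product of the functions \<open>(sgn (y $ i - a $ i) - sgn (y $ i - b $ i)) / 2\<close>. Expanding the product
gives one fundamental solution for each vertex, that is, for each set \<open>S\<close> of coordinates in which
the upper end is chosen.
\<close>
lemma box_average_iter_partial:
  fixes \<phi> :: "real^'n::finite \<Rightarrow> real"
  assumes \<phi>: "\<phi> \<in> test_functions C" and "distinct is" "set is = UNIV" and ab: "\<And>i. a $ i \<le> b $ i"
  shows "iter_partial is (\<lambda>x. integral (cbox a b) (\<lambda>y. \<phi> (x - y))) x =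
         (\<Sum>S\<in>Pow UNIV. (- 1) ^ card S * \<phi> (x - (\<chi> i. if i \<in> S then b $ i else a $ i)))"
proof -
  let ?\<Theta> = "iter_partial is \<phi>" and ?d = "CARD('n)"
  let ?v = "\<lambda>S. \<chi> i. if i \<in> S then b $ i else a $ i"
  let ?F = "\<lambda>y. \<Prod>i\<in>UNIV. (sgn (y $ i - a $ i) - sgn (y $ i - b $ i)) / 2"
  note [measurable] = test_functions_measurable[OF test_functions_iter_partial[OF \<phi>]]
  note T = test_functionsD[OF \<phi>]
  have [measurable]: "?F \<in> borel_measurable borel" by measurable
  have "iter_partial is (\<lambda>x. integral (cbox a b) (\<lambda>y. \<phi> (x - y))) x = integral (cbox a b) (\<lambda>y. ?\<Theta> (x - y))"
    using translate_average_iter_partial[of a b "\<lambda>y. y", OF _ T(1)] by (simp add: fun_eq_iff)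
  also have "\<dots> = (\<integral>y. indicator (cbox a b) y * ?\<Theta> (x - y) \<partial>lborel)"
    by (rule translate_average_eq_lborel_integral[of "\<lambda>y. y"]) (auto simp: smooth_iter_partial T)
  also have "\<dots> = (\<integral>y. ?F y * ?\<Theta> (x - y) \<partial>lborel)"
  proof (rule integral_cong_AE)
    have "AE y in lborel. \<forall>i\<in>UNIV. (y :: real^'n) $ i \<noteq> a $ i \<and> y $ i \<noteq> b $ i"
      by (rule AE_ball_countable') (auto intro: AE_lborel_component_neq simp: countable_finite)
    then show "AE y in lborel. indicator (cbox a b) y * ?\<Theta> (x - y) = ?F y * ?\<Theta> (x - y)"
    proof eventually_elim
      case (elim y)
      show ?case
      proof (cases "y \<in> cbox a b")
        case True
        then have "(sgn (y $ i - a $ i) - sgn (y $ i - b $ i)) / 2 = 1" for i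
        proof -
          have "y $ i \<noteq> a $ i" "y $ i \<noteq> b $ i" using elim by auto
          moreover have "a $ i \<le> y $ i" "y $ i \<le> b $ i" using True by (auto simp: mem_box_cart)
          ultimately show ?thesis by (simp add: sgn_if)
        qed
        then have "?F y = 1" by simp
        then show ?thesis using True by simp
      next
        case False
        then obtain i where "y $ i < a $ i \<or> b $ i < y $ i" by (auto simp: mem_box_cart not_le)
        then have "(sgn (y $ i - a $ i) - sgn (y $ i - b $ i)) / 2 = 0"
          using ab[of i] by (auto simp: sgn_if)
        then have "?F y = 0" by (meson UNIV_I finite prod_zero)
        then show ?thesis using False by simp
      qed
    qed
  qed measurable
  also have "\<dots> = (\<integral>z. ?F (x - z) * ?\<Theta> z \<partial>lborel)"
    using integral_reflect[of "\<lambda>y. ?F y * ?\<Theta> (x - y)" x] by simp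
  also have "\<dots> = (\<integral>z. (\<Sum>S\<in>Pow UNIV. (1 / 2) ^ ?d * (- 1) ^ card (UNIV - S) *
      ((\<Prod>i\<in>UNIV. sgn (z $ i - (x - ?v S) $ i)) * ?\<Theta> z)) \<partial>lborel)"
  proof (rule Bochner_Integration.integral_cong)
    fix z
    let ?p = "\<lambda>i. sgn (z $ i - (x $ i - b $ i))" and ?q = "\<lambda>i. - sgn (z $ i - (x $ i - a $ i))"
    have "?F (x - z) = (1 / 2) ^ ?d * (\<Prod>i\<in>UNIV. ?p i + ?q i)"
    proof -
      have "(sgn ((x - z) $ i - a $ i) - sgn ((x - z) $ i - b $ i)) / 2 = 1 / 2 * (?p i + ?q i)" for i
      proof -
        have "sgn ((x - z) $ i - c) = - sgn (z $ i - (x $ i - c))" for c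
          using sgn_minus[of "z $ i - (x $ i - c)"] by (simp add: algebra_simps)
        then show ?thesis by simp
      qed
      then show ?thesis by (simp only: prod.distrib prod_constant)
    qed
    also have "(\<Prod>i\<in>UNIV. ?p i + ?q i) = (\<Sum>S\<in>Pow UNIV. prod ?p S * prod ?q (UNIV - S))"
      by (rule prod_add) simp
    also have "\<dots> = (\<Sum>S\<in>Pow UNIV. (- 1) ^ card (UNIV - S) * (\<Prod>i\<in>UNIV. sgn (z $ i - (x - ?v S) $ i)))"
    proof (rule sum.cong)
      fix S :: "'n set"
      have "(\<Prod>i\<in>UNIV. sgn (z $ i - (x - ?v S) $ i)) =
        (\<Prod>i\<in>S. sgn (z $ i - (x - ?v S) $ i)) * (\<Prod>i\<in>UNIV - S. sgn (z $ i - (x - ?v S) $ i))"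
        using prod.subset_diff[of S UNIV "\<lambda>i. sgn (z $ i - (x - ?v S) $ i)"] by (simp add: mult.commute)
      also have "(\<Prod>i\<in>S. sgn (z $ i - (x - ?v S) $ i)) = prod ?p S" by (rule prod.cong) auto
      also have "(\<Prod>i\<in>UNIV - S. sgn (z $ i - (x - ?v S) $ i)) = (\<Prod>i\<in>UNIV - S. sgn (z $ i - (x $ i - a $ i)))"
        by (rule prod.cong) auto
      finally show "prod ?p S * prod ?q (UNIV - S) =
         (- 1) ^ card (UNIV - S) * (\<Prod>i\<in>UNIV. sgn (z $ i - (x - ?v S) $ i))"
        by (simp add: prod_uminus)
    qed simp
    finally show "?F (x - z) * ?\<Theta> z = (\<Sum>S\<in>Pow UNIV. (1 / 2) ^ ?d * (- 1) ^ card (UNIV - S) *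
      ((\<Prod>i\<in>UNIV. sgn (z $ i - (x - ?v S) $ i)) * ?\<Theta> z))"
      by (simp only: sum_distrib_left sum_distrib_right mult.assoc)
  qed simp
  also have "\<dots> = (\<Sum>S\<in>Pow UNIV. (1 / 2) ^ ?d * (- 1) ^ card (UNIV - S) *
      (\<integral>z. (\<Prod>i\<in>UNIV. sgn (z $ i - (x - ?v S) $ i)) * ?\<Theta> z \<partial>lborel))"
  proof (subst Bochner_Integration.integral_sum)
    fix S :: "'n set"
    have "integrable lborel (\<lambda>z. (\<Prod>i\<in>UNIV. sgn (z $ i - (x - ?v S) $ i)) * ?\<Theta> z)"
    proof (rule integrable_bounded_mult[of _ _ 1])
      show "AE z in lborel. \<bar>\<Prod>i\<in>UNIV. sgn (z $ i - (x - ?v S) $ i)\<bar> \<le> 1"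
        by (auto simp: abs_prod abs_sgn_eq intro!: prod_le_1)
    qed (auto intro!: test_functions_integrable[OF test_functions_iter_partial[OF \<phi>]])
    then show "integrable lborel (\<lambda>z. (1 / 2) ^ ?d * (- 1) ^ card (UNIV - S) *
        ((\<Prod>i\<in>UNIV. sgn (z $ i - (x - ?v S) $ i)) * ?\<Theta> z))"
      by (rule integrable_mult_right)
  qed simp
  also have "\<dots> = (\<Sum>S\<in>Pow UNIV. (- 1) ^ card S * \<phi> (x - ?v S))"
  proof (rule sum.cong)
    fix S :: "'n set"
    have c: "card (UNIV - S) + card S = ?d" by (simp add: card_Diff_subset card_mono)
    have "(1 / 2 :: real) ^ ?d * (- 1) ^ card (UNIV - S) * (- 2) ^ ?d = (- 1) ^ card (UNIV - S) * (- 1) ^ ?d"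
      by (simp add: power_mult_distrib[symmetric])
    also have "\<dots> = ((- 1) ^ card (UNIV - S) * (- 1) ^ card (UNIV - S)) * (- 1) ^ card S"
      unfolding c[symmetric] power_add by simp
    also have "\<dots> = (- 1) ^ card S" by (simp add: power_mult_distrib[symmetric])
    finally have "(1 / 2 :: real) ^ ?d * (- 1) ^ card (UNIV - S) * (- 2) ^ ?d = (- 1) ^ card S" .
    then show "(1 / 2) ^ ?d * (- 1) ^ card (UNIV - S) *
      (\<integral>z. (\<Prod>i\<in>UNIV. sgn (z $ i - (x - ?v S) $ i)) * ?\<Theta> z \<partial>lborel) = (- 1) ^ card S * \<phi> (x - ?v S)"
      unfolding sgn_kernel_integral[OF \<phi> assms(2,3)] by (simp only: mult.assoc[symmetric])
  qed simp
  finally show ?thesis .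
qed

lemma box_average_iter_partial_L1:
  fixes \<phi> :: "real^'n::finite \<Rightarrow> real"
  assumes \<phi>: "\<phi> \<in> test_functions C" and "distinct is" "set is = UNIV" and ab: "\<And>i. a $ i \<le> b $ i"
  shows "(\<integral>x. \<bar>iter_partial is (\<lambda>x. integral (cbox a b) (\<lambda>y. \<phi> (x - y))) x\<bar> \<partial>lborel) \<le>
         2 ^ CARD('n) * (\<integral>x. \<bar>\<phi> x\<bar> \<partial>lborel)"
proof -
  let ?v = "\<lambda>S. \<chi> i. if i \<in> S then b $ i else a $ i"
  note [measurable] = test_functions_measurable[OF \<phi>]
  have i: "integrable lborel (\<lambda>x. \<phi> (x - c))" for c
    by (intro integrable_shift_sub test_functions_integrable[OF \<phi>])
  have "(\<integral>x. \<bar>iter_partial is (\<lambda>x. integral (cbox a b) (\<lambda>y. \<phi> (x - y))) x\<bar> \<partial>lborel) \<le>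
        (\<integral>x. (\<Sum>S\<in>Pow UNIV. \<bar>\<phi> (x - ?v S)\<bar>) \<partial>lborel)"
    unfolding box_average_iter_partial[OF assms]
  proof (rule integral_mono)
    show "\<bar>\<Sum>S\<in>Pow UNIV. (- 1) ^ card S * \<phi> (x - ?v S)\<bar> \<le> (\<Sum>S\<in>Pow UNIV. \<bar>\<phi> (x - ?v S)\<bar>)" for x
      by (rule order_trans[OF sum_abs]) (simp add: abs_mult power_abs)
  qed (use i in \<open>auto intro!: Bochner_Integration.integrable_sum\<close>)
  also have "\<dots> = (\<Sum>S\<in>Pow (UNIV :: 'n set). (\<integral>x. \<bar>\<phi> x\<bar> \<partial>lborel))"
    using i integral_shift_sub[of "\<lambda>x. \<bar>\<phi> x\<bar>"] by (subst Bochner_Integration.integral_sum) auto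
  also have "\<dots> = 2 ^ CARD('n) * (\<integral>x. \<bar>\<phi> x\<bar> \<partial>lborel)" by (simp add: card_Pow)
  finally show ?thesis .
qed

section \<open>The effect of a translation\<close>

lemma abs_inner_le_infnorm:
  fixes y :: "real^'n::finite"
  shows "\<bar>\<Sum>i\<in>UNIV. y $ i * z i\<bar> \<le> infnorm y * (\<Sum>i\<in>UNIV. \<bar>z i\<bar>)"
proof -
  have "\<bar>\<Sum>i\<in>UNIV. y $ i * z i\<bar> \<le> (\<Sum>i\<in>UNIV. infnorm y * \<bar>z i\<bar>)"
    by (rule order_trans[OF sum_abs])
      (auto simp: abs_mult intro!: sum_mono mult_right_mono component_le_infnorm_cart)
  then show ?thesis by (simp add: sum_distrib_left)
qed

text \<open>
The mean \<open>\<eta>\<close> of the translates of \<open>\<phi>\<close> by \<open>t * y\<close>, for \<open>t\<close> between \<open>0\<close> and \<open>1\<close>, has directional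
derivative \<open>\<phi> x - \<phi> (x - y)\<close> along \<open>y\<close> and an \<open>L1\<close> norm not larger than that of \<open>\<phi>\<close>. Testing the weak
gradient of \<open>g\<close> with \<open>\<eta>\<close> gives the estimate.
\<close>
lemma translation_estimate:
  fixes g \<phi> :: "real^'n::finite \<Rightarrow> real" and u :: "'n \<Rightarrow> real^'n \<Rightarrow> real"
  assumes g[measurable]: "g \<in> borel_measurable borel" and gB: "\<And>x. \<bar>g x\<bar> \<le> B"
    and u[measurable]: "\<And>i. u i \<in> borel_measurable borel"
    and uL: "AE x in lborel. (\<Sum>i\<in>UNIV. \<bar>u i x\<bar>) \<le> L" and L: "0 \<le> L"
    and weak: "\<And>i \<eta>. \<eta> \<in> test_functions C \<Longrightarrow>
       (\<integral>x. g x * partial_deriv i \<eta> x \<partial>lborel) = - (\<integral>x. u i x * \<eta> x \<partial>lborel)"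
    and \<phi>: "\<phi> \<in> test_functions C"
    and y: "\<And>x t. x \<in> C \<Longrightarrow> 0 \<le> t \<Longrightarrow> t \<le> 1 \<Longrightarrow> x + t *\<^sub>R y \<in> C"
  shows "\<bar>(\<integral>x. g x * \<phi> x \<partial>lborel) - (\<integral>x. g x * \<phi> (x - y) \<partial>lborel)\<bar> \<le> infnorm y * L * (\<integral>x. \<bar>\<phi> x\<bar> \<partial>lborel)"
proof -
  define \<eta> where "\<eta> = (\<lambda>x. integral (cbox 0 (1::real)) (\<lambda>t. \<phi> (x - t *\<^sub>R y)))"
  note T = test_functionsD[OF \<phi>]
  have s: "continuous_on A (\<lambda>t. t *\<^sub>R y)" for A by (intro continuous_intros)
  have \<eta>: "\<eta> \<in> test_functions C"
    unfolding \<eta>_def by (rule translate_average_test_function[OF s \<phi>]) (auto intro: y)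
  note [measurable] = test_functions_measurable[OF \<phi>] test_functions_measurable[OF \<eta>]
  have line: "(\<Sum>i\<in>UNIV. y $ i * partial_deriv i \<eta> x) = \<phi> x - \<phi> (x - y)" for x
  proof -
    have D: "((\<lambda>t. \<phi> (x - t *\<^sub>R y)) has_real_derivative - (\<Sum>i\<in>UNIV. y $ i * partial_deriv i \<phi> (x - t *\<^sub>R y))) (at t)" for t
      using smooth_has_line_derivative[OF T(1), of x "- y" t] by (simp add: sum_negf)
    have "((\<lambda>t. - (\<Sum>i\<in>UNIV. y $ i * partial_deriv i \<phi> (x - t *\<^sub>R y))) has_integral
       (\<phi> (x - 1 *\<^sub>R y) - \<phi> (x - 0 *\<^sub>R y))) {0..1::real}"
      by (rule fundamental_theorem_of_calculus)
        (auto simp: has_real_derivative_iff_has_vector_derivative[symmetric] intro: has_field_derivative_at_within[OF D])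
    from has_integral_neg[OF this]
    have "((\<lambda>t. \<Sum>i\<in>UNIV. y $ i * partial_deriv i \<phi> (x - t *\<^sub>R y)) has_integral (\<phi> x - \<phi> (x - y))) (cbox 0 (1::real))"
      by simp
    then have "integral (cbox 0 (1::real)) (\<lambda>t. \<Sum>i\<in>UNIV. y $ i * partial_deriv i \<phi> (x - t *\<^sub>R y)) = \<phi> x - \<phi> (x - y)"
      by (rule integral_unique)
    moreover have "(\<lambda>t. partial_deriv i \<phi> (x - t *\<^sub>R y)) integrable_on cbox 0 (1::real)" for i
      by (rule integrable_continuous,
          rule continuous_on_compose2[OF smooth_continuous_on[OF smooth_partial_deriv[OF T(1)], of UNIV]])
        (auto intro!: continuous_intros)
    ultimately show ?thesis
      unfolding \<eta>_def translate_average_partial_deriv[OF s T(1)]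
      by (subst (asm) integral_sum) (simp_all add: integrable_on_mult_right del: cbox_interval)
  qed
  have i0: "integrable lborel (\<lambda>x. g x * \<psi> x)" if "integrable lborel \<psi>" for \<psi>
    by (rule integrable_bounded_mult[of _ _ B]) (use gB that in auto)
  have ui: "integrable lborel (\<lambda>x. u i x * \<eta> x)" for i
  proof (rule integrable_bounded_mult[of _ _ L])
    show "AE x in lborel. \<bar>u i x\<bar> \<le> L" using uL
    proof eventually_elim
      case (elim x)
      have "\<bar>u i x\<bar> \<le> (\<Sum>i\<in>UNIV. \<bar>u i x\<bar>)" by (rule member_le_sum) auto
      then show ?case using elim by simp
    qed
  qed (auto intro: test_functions_integrable[OF \<eta>])
  have "(\<integral>x. g x * \<phi> x \<partial>lborel) - (\<integral>x. g x * \<phi> (x - y) \<partial>lborel) = (\<integral>x. g x * (\<phi> x - \<phi> (x - y)) \<partial>lborel)"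
    using i0[OF test_functions_integrable[OF \<phi>]] i0[OF integrable_shift_sub[OF test_functions_integrable[OF \<phi>]]]
    by (simp add: right_diff_distrib)
  also have "\<dots> = (\<integral>x. (\<Sum>i\<in>UNIV. y $ i * (g x * partial_deriv i \<eta> x)) \<partial>lborel)"
    unfolding line[symmetric] by (simp add: sum_distrib_left mult.left_commute)
  also have "\<dots> = (\<Sum>i\<in>UNIV. y $ i * (\<integral>x. g x * partial_deriv i \<eta> x \<partial>lborel))"
    using i0[OF test_functions_integrable[OF test_functions_partial_deriv[OF \<eta>]]]
    by (subst Bochner_Integration.integral_sum) auto
  also have "\<dots> = - (\<Sum>i\<in>UNIV. y $ i * (\<integral>x. u i x * \<eta> x \<partial>lborel))"
    by (simp add: weak[OF \<eta>] sum_negf)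
  also have "(\<Sum>i\<in>UNIV. y $ i * (\<integral>x. u i x * \<eta> x \<partial>lborel)) = (\<integral>x. (\<Sum>i\<in>UNIV. y $ i * (u i x * \<eta> x)) \<partial>lborel)"
    using ui by (subst Bochner_Integration.integral_sum) auto
  also have "\<dots> = (\<integral>x. (\<Sum>i\<in>UNIV. y $ i * u i x) * \<eta> x \<partial>lborel)"
    by (simp add: sum_distrib_right mult.assoc)
  finally have eq: "(\<integral>x. g x * \<phi> x \<partial>lborel) - (\<integral>x. g x * \<phi> (x - y) \<partial>lborel) =
      - (\<integral>x. (\<Sum>i\<in>UNIV. y $ i * u i x) * \<eta> x \<partial>lborel)" .
  have "\<bar>\<integral>x. (\<Sum>i\<in>UNIV. y $ i * u i x) * \<eta> x \<partial>lborel\<bar> \<le> (\<integral>x. \<bar>(\<Sum>i\<in>UNIV. y $ i * u i x) * \<eta> x\<bar> \<partial>lborel)"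
    by (rule integral_abs_bound)
  also have "\<dots> \<le> (\<integral>x. infnorm y * L * \<bar>\<eta> x\<bar> \<partial>lborel)"
  proof (rule integral_mono_AE)
    have "integrable lborel (\<lambda>x. \<Sum>i\<in>UNIV. y $ i * (u i x * \<eta> x))"
      using ui by (intro Bochner_Integration.integrable_sum integrable_mult_right) auto
    then show "integrable lborel (\<lambda>x. \<bar>(\<Sum>i\<in>UNIV. y $ i * u i x) * \<eta> x\<bar>)"
      by (intro integrable_abs) (simp add: sum_distrib_right mult.assoc)
    show "integrable lborel (\<lambda>x. infnorm y * L * \<bar>\<eta> x\<bar>)"
      using test_functions_integrable[OF \<eta>] by auto
    show "AE x in lborel. \<bar>(\<Sum>i\<in>UNIV. y $ i * u i x) * \<eta> x\<bar> \<le> infnorm y * L * \<bar>\<eta> x\<bar>"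
      using uL
    proof eventually_elim
      case (elim x)
      have "\<bar>\<Sum>i\<in>UNIV. y $ i * u i x\<bar> \<le> infnorm y * L"
        by (rule order_trans[OF abs_inner_le_infnorm mult_left_mono[OF elim infnorm_pos_le]])
      then show ?case by (simp add: abs_mult mult_right_mono)
    qed
  qed
  also have "\<dots> = infnorm y * L * (\<integral>x. \<bar>\<eta> x\<bar> \<partial>lborel)" by simp
  also have "\<dots> \<le> infnorm y * L * (\<integral>x. \<bar>\<phi> x\<bar> \<partial>lborel)"
    using translate_average_L1_bound[OF s \<phi>, of 0 1] L infnorm_pos_le[of y]
    by (intro mult_left_mono) (auto simp: \<eta>_def)
  finally show ?thesis unfolding eq by simp
qed

section \<open>Boxes adapted to the cone\<close>

definition cone_box_low :: "'n set \<Rightarrow> real \<Rightarrow> real^'n::finite" where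
  "cone_box_low P h = (\<chi> i. if i \<in> P then 0 else - h)"

definition cone_box :: "'n set \<Rightarrow> real \<Rightarrow> (real^'n::finite) set" where
  "cone_box P h = cbox (cone_box_low P h) (\<chi> i. h)"

lemma mem_cone_box: "x \<in> cone_box P h \<longleftrightarrow> (\<forall>i\<in>P. 0 \<le> x $ i) \<and> (\<forall>i. \<bar>x $ i\<bar> \<le> h)"
  by (auto simp: cone_box_def cone_box_low_def mem_box_cart abs_le_iff split: if_splits)
     (smt (verit))+

lemma infnorm_le_iff_cart: "infnorm (x :: real^'n::finite) \<le> s \<longleftrightarrow> (\<forall>i. \<bar>x $ i\<bar> \<le> s)"
proof
  show "infnorm x \<le> s \<Longrightarrow> \<forall>i. \<bar>x $ i\<bar> \<le> s"
    using component_le_infnorm_cart order_trans by blast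
  show "\<forall>i. \<bar>x $ i\<bar> \<le> s \<Longrightarrow> infnorm x \<le> s"
    unfolding infnorm_cart by (rule cSup_least) auto
qed

lemma measure_cone_box:
  assumes "0 \<le> h"
  shows "measure lborel (cone_box P h :: (real^'n::finite) set) = 2 ^ (CARD('n) - card P) * h ^ CARD('n)"
proof -
  have "measure lborel (cone_box P h) = (\<Prod>i\<in>UNIV. if i \<in> P then h else 2 * h)"
    unfolding cone_box_def using assms
    by (subst measure_lborel_cbox_cart) (auto simp: cone_box_low_def intro!: prod.cong)
  also have "\<dots> = h ^ card P * (2 * h) ^ (CARD('n) - card P)"
    by (simp add: prod.If_cases card_Diff_subset Compl_eq_Diff_UNIV)
  also have "\<dots> = 2 ^ (CARD('n) - card P) * h ^ CARD('n)"
    using card_mono[of UNIV P] by (simp add: power_mult_distrib power_add[symmetric])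
  finally show ?thesis .
qed

text \<open>
Layer-cake formula: the integrand is the length of \<open>{infnorm t..h}\<close>, and the points of the box with
\<open>infnorm t \<le> s\<close> form the smaller box \<open>cone_box P s\<close>, of volume proportional to \<open>s ^ CARD('n)\<close>.
\<close>
lemma integral_cone_box_pyramid:
  assumes "0 \<le> h"
  shows "(\<integral>t. indicator (cone_box P h) t * (h - infnorm (t :: real^'n::finite)) \<partial>lborel) =
         2 ^ (CARD('n) - card P) * h ^ (CARD('n) + 1) / real (CARD('n) + 1)"
proof -
  let ?d = "CARD('n)"
  define K where "K = (cone_box P h \<times> {0..h}) \<inter> {p. infnorm (fst p :: real^'n) \<le> snd p}"
  have "compact K" unfolding K_def
    by (intro compact_Int_closed compact_Times closed_Collect_le continuous_intros)
      (auto simp: cone_box_def)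
  have "integrable (lborel \<Otimes>\<^sub>M lborel) (case_prod (\<lambda>t s. indicat_real K (t, s)))"
    unfolding lborel_prod using \<open>compact K\<close> emeasure_compact_finite[OF \<open>compact K\<close>]
    by (simp add: compact_imp_closed borel_closed)
  note Fub = lborel_pair.Fubini_integral[OF this]
  have "(\<integral>t. indicator (cone_box P h) t * (h - infnorm (t :: real^'n)) \<partial>lborel) =
     (\<integral>t. (\<integral>s. indicat_real K (t, s) \<partial>lborel) \<partial>lborel)"
  proof (rule Bochner_Integration.integral_cong)
    fix t :: "real^'n"
    show "indicator (cone_box P h) t * (h - infnorm t) = (\<integral>s. indicat_real K (t, s) \<partial>lborel)"
    proof (cases "t \<in> cone_box P h")
      case True
      then have "infnorm t \<le> h" by (auto simp: infnorm_le_iff_cart mem_cone_box)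
      have "indicat_real K (t, s) = indicator {infnorm t..h} s" for s
        using True infnorm_pos_le[of t] by (auto simp: K_def indicator_def)
      then show ?thesis using True \<open>infnorm t \<le> h\<close> by simp
    next
      case False
      then have "indicat_real K (t, s) = 0" for s by (auto simp: K_def indicator_def)
      then show ?thesis using False by simp
    qed
  qed simp
  also have "\<dots> = (\<integral>s. (\<integral>t. indicat_real K (t, s) \<partial>lborel) \<partial>lborel)" by (rule Fub[symmetric])
  also have "\<dots> = (\<integral>s. 2 ^ (?d - card P) * (s ^ ?d * indicator {0..h} s) \<partial>lborel)"
  proof (rule Bochner_Integration.integral_cong)
    fix s :: real
    show "(\<integral>t. indicat_real K (t, s) \<partial>lborel) = 2 ^ (?d - card P) * (s ^ ?d * indicator {0..h} s)"
    proof (cases "s \<in> {0..h}")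
      case True
      have "indicat_real K (t, s) = indicator (cone_box P s) t" for t
        using True by (auto simp: K_def indicator_def mem_cone_box infnorm_le_iff_cart intro: order_trans)
      then have "(\<integral>t. indicat_real K (t, s) \<partial>lborel) = measure lborel (cone_box P s :: (real^'n) set)"
        by (simp add: cone_box_def)
      then show ?thesis using True by (simp add: measure_cone_box)
    next
      case False
      then have "indicat_real K (t, s) = 0" for t by (auto simp: K_def indicator_def)
      then show ?thesis using False by simp
    qed
  qed simp
  also have "\<dots> = 2 ^ (?d - card P) * h ^ (?d + 1) / real (?d + 1)"
    using integral_power[OF assms, of ?d] by simp
  finally show ?thesis .
qed

lemma integral_cone_box_infnorm:
  assumes "0 \<le> h"
  shows "(\<integral>t. indicator (cone_box P h) t * infnorm (t :: real^'n::finite) \<partial>lborel) =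
         2 ^ (CARD('n) - card P) * h ^ CARD('n) * (h * (real CARD('n) / real (CARD('n) + 1)))"
    and "integrable lborel (\<lambda>t. indicator (cone_box P h) t * infnorm (t :: real^'n::finite))"
proof -
  let ?d = "CARD('n)"
  let ?I = "indicat_real (cone_box P h :: (real^'n) set)"
  have iI: "integrable lborel ?I" by (simp add: cone_box_def emeasure_lborel_cbox_eq)
  have i: "integrable lborel (\<lambda>t. ?I t *\<^sub>R (h - infnorm t))"
    unfolding cone_box_def by (intro borel_integrable_compact compact_cbox continuous_intros)
  have i2: "integrable lborel (\<lambda>t. ?I t *\<^sub>R infnorm t)"
    unfolding cone_box_def by (intro borel_integrable_compact compact_cbox continuous_intros)
  then show "integrable lborel (\<lambda>t. ?I t * infnorm t)" by simp
  have "(\<integral>t. ?I t * (h - infnorm t) \<partial>lborel) = h * (\<integral>t. ?I t \<partial>lborel) - (\<integral>t. ?I t * infnorm t \<partial>lborel)"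
  proof -
    have "?I t * (h - infnorm t) = h * ?I t - ?I t * infnorm t" for t by (simp add: algebra_simps)
    then show ?thesis
      using Bochner_Integration.integral_diff[OF integrable_mult_right[OF iI, of h], of "\<lambda>t. ?I t * infnorm t"] i2
      by simp
  qed
  moreover have "(\<integral>t. ?I t \<partial>lborel) = 2 ^ (?d - card P) * h ^ ?d"
    using measure_cone_box[OF assms, of P] by simp
  ultimately have A: "(\<integral>t. ?I t * (h - infnorm t) \<partial>lborel) =
      h * (2 ^ (?d - card P) * h ^ ?d) - (\<integral>t. ?I t * infnorm t \<partial>lborel)" by simp
  have alg: "X = V * (h * (r / s))" if "A = h * V - X" "A = V' / s" "V' = V * h" "s = r + 1" "0 \<le> r"
    for A X V V' r s :: real
    using that by (simp add: field_simps)
  show "(\<integral>t. ?I t * infnorm t \<partial>lborel) = 2 ^ (?d - card P) * h ^ ?d * (h * (real ?d / real (?d + 1)))"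
    by (rule alg[OF A integral_cone_box_pyramid[OF assms, of P]]) simp_all
qed

section \<open>The inequality in weak form\<close>

lemma orthant_cone_open: "open (orthant_cone P)"
proof -
  have "orthant_cone P = (\<Inter>i\<in>P. {x. 0 < x $ i})" by (auto simp: orthant_cone_def)
  moreover have "open \<dots>" by (intro open_INT ballI open_Collect_less continuous_intros) simp
  ultimately show ?thesis by simp
qed

lemma orthant_cone_add_cone_box: "x \<in> orthant_cone P \<Longrightarrow> y \<in> cone_box P h \<Longrightarrow> x + y \<in> orthant_cone P"
  by (auto simp: orthant_cone_def mem_cone_box add_pos_nonneg)

text \<open>
Let \<open>\<psi>\<close> be the integral of the translates of \<open>\<phi>\<close> over the box, and \<open>V\<close> the volume of the box. Then
\<open>V * \<integral> g * \<phi>\<close> is the sum of \<open>V * \<integral> g * \<phi> - \<integral> g * \<psi>\<close>, an integral of translation errors which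
the gradient of \<open>g\<close> controls, and of \<open>\<integral> g * \<psi>\<close>, which is \<open>\<integral> f\<close> against the mixed derivative of \<open>\<psi>\<close>
up to sign, so that the vertex sum and the bound of \<open>f\<close> control it.
\<close>
lemma weak_landau_kolmogorov:
  fixes f g \<phi> :: "real^'n::finite \<Rightarrow> real" and u :: "'n \<Rightarrow> real^'n \<Rightarrow> real" and P :: "'n set"
  defines "C \<equiv> orthant_cone P"
  assumes f[measurable]: "f \<in> borel_measurable borel" and fF: "\<And>x. \<bar>f x\<bar> \<le> F"
    and g[measurable]: "g \<in> borel_measurable borel" and gB: "\<And>x. \<bar>g x\<bar> \<le> B"
    and u: "\<And>i. u i \<in> borel_measurable borel"
    and uL: "AE x in lborel. (\<Sum>i\<in>UNIV. \<bar>u i x\<bar>) \<le> L" and L: "0 \<le> L"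
    and grad: "\<And>i \<eta>. \<eta> \<in> test_functions C \<Longrightarrow>
       (\<integral>x. g x * partial_deriv i \<eta> x \<partial>lborel) = - (\<integral>x. u i x * \<eta> x \<partial>lborel)"
    and mixed: "\<And>\<eta>. \<eta> \<in> test_functions C \<Longrightarrow>
       (\<integral>x. f x * iter_partial is \<eta> x \<partial>lborel) = (- 1) ^ length is * (\<integral>x. g x * \<eta> x \<partial>lborel)"
    and "is": "distinct is" "set is = UNIV"
    and \<phi>: "\<phi> \<in> test_functions C" and h: "0 < h"
  shows "\<bar>\<integral>x. g x * \<phi> x \<partial>lborel\<bar> \<le>
    (h * (real CARD('n) / real (CARD('n) + 1)) * L + 2 ^ card P / h ^ CARD('n) * F) * (\<integral>x. \<bar>\<phi> x\<bar> \<partial>lborel)"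
proof -
  let ?d = "CARD('n)" and ?Q = "cone_box P h :: (real^'n) set" and ?N = "\<integral>x. \<bar>\<phi> x\<bar> \<partial>lborel"
  define V where "V = 2 ^ (?d - card P) * h ^ ?d"
  have V: "0 < V" using h by (simp add: V_def)
  have N: "0 \<le> ?N" by simp
  define \<psi> where "\<psi> = (\<lambda>x. integral ?Q (\<lambda>y. \<phi> (x - y)))"
  have \<psi>: "\<psi> \<in> test_functions C"
    unfolding \<psi>_def cone_box_def
    by (rule translate_average_test_function[OF _ \<phi>])
      (auto simp: C_def cone_box_def[symmetric] orthant_cone_add_cone_box)
  note [measurable] = test_functions_measurable[OF \<psi>] test_functions_measurable[OF \<phi>]
  define J where "J t = (\<integral>x. g x * \<phi> (x - t) \<partial>lborel)" for t
  have iJ: "integrable lborel (\<lambda>t. indicator ?Q t * J t)"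
    unfolding J_def cone_box_def by (rule translate_average_Fubini(2)[OF _ \<phi> g gB]) (intro continuous_intros)
  have \<psi>J: "(\<integral>x. g x * \<psi> x \<partial>lborel) = (\<integral>t. indicator ?Q t * J t \<partial>lborel)"
    unfolding J_def \<psi>_def cone_box_def by (rule translate_average_Fubini(1)[OF _ \<phi> g gB]) (intro continuous_intros)
  have iQ: "integrable lborel (indicat_real ?Q)" by (simp add: cone_box_def emeasure_lborel_cbox_eq)
  have intQ: "(\<integral>t. indicat_real ?Q t \<partial>lborel) = V"
    using measure_cone_box[of h P] h by (simp add: V_def)
  \<comment> \<open>Here \<open>J 0\<close> is the integral of \<open>g * \<phi>\<close>.\<close>
  have "V * J 0 - (\<integral>x. g x * \<psi> x \<partial>lborel) = (\<integral>t. indicat_real ?Q t * J 0 \<partial>lborel) - (\<integral>t. indicator ?Q t * J t \<partial>lborel)"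
    unfolding \<psi>J by (simp add: intQ[symmetric])
  also have "\<dots> = (\<integral>t. indicat_real ?Q t * J 0 - indicator ?Q t * J t \<partial>lborel)"
    using iQ iJ by (intro Bochner_Integration.integral_diff[symmetric] integrable_mult_left)
  finally have eq: "V * J 0 - (\<integral>x. g x * \<psi> x \<partial>lborel) = (\<integral>t. indicat_real ?Q t * J 0 - indicator ?Q t * J t \<partial>lborel)" .
  have "\<bar>V * J 0 - (\<integral>x. g x * \<psi> x \<partial>lborel)\<bar> \<le> (\<integral>t. \<bar>indicat_real ?Q t * J 0 - indicator ?Q t * J t\<bar> \<partial>lborel)"
    unfolding eq by (rule integral_abs_bound)
  also have "\<dots> \<le> (\<integral>t. (indicator ?Q t * infnorm t) * (L * ?N) \<partial>lborel)"
  proof (rule integral_mono)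
    show "integrable lborel (\<lambda>t. \<bar>indicat_real ?Q t * J 0 - indicator ?Q t * J t\<bar>)"
      using iQ iJ by (intro integrable_abs Bochner_Integration.integrable_diff integrable_mult_left)
    show "integrable lborel (\<lambda>t. (indicator ?Q t * infnorm t) * (L * ?N))"
      using integral_cone_box_infnorm(2)[of h P] h by (intro integrable_mult_left) simp
    fix t :: "real^'n"
    show "\<bar>indicat_real ?Q t * J 0 - indicator ?Q t * J t\<bar> \<le> (indicator ?Q t * infnorm t) * (L * ?N)"
    proof (cases "t \<in> ?Q")
      case True
      have "\<bar>J 0 - J t\<bar> \<le> infnorm t * L * ?N"
        unfolding J_def diff_zero
        by (rule translation_estimate[OF g gB u uL L grad \<phi>])
          (use True in \<open>auto simp: C_def orthant_cone_def mem_cone_box add_pos_nonneg\<close>)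
      then show ?thesis using True by (simp add: mult.assoc)
    qed simp
  qed
  also have "\<dots> = V * (h * (real ?d / real (?d + 1))) * (L * ?N)"
    using integral_cone_box_infnorm(1)[of h P] h by (simp add: V_def)
  finally have A: "\<bar>V * J 0 - (\<integral>x. g x * \<psi> x \<partial>lborel)\<bar> \<le> V * (h * (real ?d / real (?d + 1))) * (L * ?N)" .
  have "\<bar>\<integral>x. g x * \<psi> x \<partial>lborel\<bar> = \<bar>\<integral>x. f x * iter_partial is \<psi> x \<partial>lborel\<bar>"
    using mixed[OF \<psi>] by (simp add: abs_mult power_abs)
  also have "\<dots> \<le> (\<integral>x. \<bar>f x * iter_partial is \<psi> x\<bar> \<partial>lborel)" by (rule integral_abs_bound)
  also have "\<dots> \<le> (\<integral>x. F * \<bar>iter_partial is \<psi> x\<bar> \<partial>lborel)"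
  proof (rule integral_mono)
    note i = test_functions_integrable[OF test_functions_iter_partial[OF \<psi>], of "is"]
    show "integrable lborel (\<lambda>x. \<bar>f x * iter_partial is \<psi> x\<bar>)"
      by (intro integrable_abs integrable_bounded_mult[OF _ _ i, of _ F]) (use fF in auto)
    show "integrable lborel (\<lambda>x. F * \<bar>iter_partial is \<psi> x\<bar>)" using i by auto
    show "\<bar>f x * iter_partial is \<psi> x\<bar> \<le> F * \<bar>iter_partial is \<psi> x\<bar>" for x
      using fF[of x] by (simp add: abs_mult mult_right_mono)
  qed
  also have "\<dots> = F * (\<integral>x. \<bar>iter_partial is \<psi> x\<bar> \<partial>lborel)" by simp
  also have "\<dots> \<le> F * (2 ^ ?d * ?N)"
    unfolding \<psi>_def cone_box_def using h order_trans[OF abs_ge_zero fF[of 0]]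
    by (intro mult_left_mono box_average_iter_partial_L1[OF \<phi> "is"]) (auto simp: cone_box_low_def)
  also have "2 ^ ?d * ?N = V * (2 ^ card P / h ^ ?d) * ?N"
  proof -
    have "(2::real) ^ ?d = 2 ^ (?d - card P) * 2 ^ card P"
      using card_mono[of UNIV P] by (simp add: power_add[symmetric])
    then show ?thesis using h by (simp add: V_def)
  qed
  finally have B: "\<bar>\<integral>x. g x * \<psi> x \<partial>lborel\<bar> \<le> F * (V * (2 ^ card P / h ^ ?d) * ?N)" .
  have "V * \<bar>J 0\<bar> = \<bar>V * J 0\<bar>" using V by (simp add: abs_mult)
  also have "\<dots> \<le> V * (h * (real ?d / real (?d + 1))) * (L * ?N) + F * (V * (2 ^ card P / h ^ ?d) * ?N)"
    using A B by linarith
  also have "\<dots> = V * ((h * (real ?d / real (?d + 1)) * L + 2 ^ card P / h ^ ?d * F) * ?N)"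
    by (simp only: distrib_left distrib_right mult_ac)
  finally show ?thesis using V by (simp add: J_def)
qed

section \<open>Distributional derivatives up to null sets\<close>

lemma has_distr_derivD:
  assumes "has_distr_deriv C is f g" "\<phi> \<in> test_functions C"
  shows "(LINT x|lebesgue_on C. f x * iter_partial is \<phi> x) = (- 1) ^ length is * (LINT x|lebesgue_on C. g x * \<phi> x)"
  using assms by (auto simp: has_distr_deriv_def)

lemma integral_abs_test:
  assumes C: "open C" and \<phi>: "\<phi> \<in> test_functions C"
  shows "(LINT x|lebesgue_on C. \<bar>\<phi> x\<bar>) = (\<integral>x. \<bar>\<phi> x\<bar> \<partial>lborel)"
proof -
  note [measurable] = test_functions_measurable[OF \<phi>]
  have m: "(\<lambda>x. sgn (\<phi> x)) \<in> borel_measurable borel" by measurable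
  have "(LINT x|lebesgue_on C. sgn (\<phi> x) * \<phi> x) = (\<integral>x. sgn (\<phi> x) * \<phi> x \<partial>lborel)"
    using m by (intro integral_test_representative[OF C _ m _ \<phi>] measurable_restrict_space1 measurable_completion) auto
  then show ?thesis by (simp add: abs_sgn mult.commute)
qed

lemma integrable_locally_integrable_test:
  fixes g \<phi> :: "real^'n::finite \<Rightarrow> real"
  assumes C: "open C" and g: "locally_integrable C g" and \<phi>: "\<phi> \<in> test_functions C"
  shows "integrable (lebesgue_on C) (\<lambda>x. g x * \<phi> x)"
proof -
  let ?S = "closure {x. \<phi> x \<noteq> 0}"
  note T = test_functionsD[OF \<phi>]
  obtain B where B: "\<And>x. \<bar>\<phi> x\<bar> \<le> B" using test_functions_bounded[OF \<phi>] by blast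
  have "set_integrable lebesgue ?S g" using g T by (auto simp: locally_integrable_def)
  then have i: "integrable lebesgue (\<lambda>x. indicator ?S x *\<^sub>R g x)" by (simp add: set_integrable_def)
  have "\<phi> \<in> borel_measurable lebesgue"
    using test_functions_measurable[OF \<phi>] by (simp add: measurable_completion)
  then have "integrable lebesgue (\<lambda>x. \<phi> x * (indicator ?S x *\<^sub>R g x))"
    by (rule integrable_bounded_mult[OF _ _ i, of _ B]) (use B in auto)
  moreover have "\<phi> x * (indicator ?S x *\<^sub>R g x) = indicator C x *\<^sub>R (g x * \<phi> x)" for x
    using notin_closure_support[of x \<phi>] T(3) by (auto simp: indicator_def)
  ultimately have "integrable lebesgue (\<lambda>x. indicator C x *\<^sub>R (g x * \<phi> x))" by (simp only:)
  then show ?thesis using C by (subst integrable_restrict_space) auto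
qed

lemma has_distr_deriv_unique:
  fixes f g1 g2 :: "real^'n::finite \<Rightarrow> real"
  assumes C: "open C" and g1: "has_distr_deriv C is f g1" and g2: "has_distr_deriv C is f g2"
  shows "AE x in lebesgue_on C. g1 x = g2 x"
proof -
  have l: "locally_integrable C g1" "locally_integrable C g2"
    using g1 g2 by (auto simp: has_distr_deriv_def)
  have "AE x in lebesgue_on C. \<bar>g1 x - g2 x\<bar> \<le> 0"
  proof (rule AE_le_of_test[OF C])
    show "locally_integrable C (\<lambda>x. g1 x - g2 x)"
      using l unfolding locally_integrable_def by (blast intro: set_integral_diff(1))
    fix \<phi> assume \<phi>: "\<phi> \<in> test_functions C"
    have "(LINT x|lebesgue_on C. g1 x * \<phi> x) = (LINT x|lebesgue_on C. g2 x * \<phi> x)"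
      using has_distr_derivD[OF g1 \<phi>] has_distr_derivD[OF g2 \<phi>] by simp
    then have "(LINT x|lebesgue_on C. (g1 x - g2 x) * \<phi> x) = 0"
      using integrable_locally_integrable_test[OF C l(1) \<phi>] integrable_locally_integrable_test[OF C l(2) \<phi>]
      by (simp add: left_diff_distrib)
    then show "\<bar>LINT x|lebesgue_on C. (g1 x - g2 x) * \<phi> x\<bar> \<le> 0 * (LINT x|lebesgue_on C. \<bar>\<phi> x\<bar>)" by simp
  qed simp
  then show ?thesis by eventually_elim simp
qed

lemma has_distr_deriv_AE_cong:
  fixes f f2 g :: "real^'n::finite \<Rightarrow> real"
  assumes C: "open C" and g: "has_distr_deriv C is f g" and f2: "locally_integrable C f2"
    and eq: "AE x in lebesgue_on C. f x = f2 x"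
  shows "has_distr_deriv C is f2 g"
proof -
  have l: "locally_integrable C f" "locally_integrable C g" using g by (auto simp: has_distr_deriv_def)
  have "(LINT x|lebesgue_on C. f2 x * iter_partial is \<phi> x) = (LINT x|lebesgue_on C. f x * iter_partial is \<phi> x)"
    if \<phi>: "\<phi> \<in> test_functions C" for \<phi>
  proof (rule integral_cong_AE)
    show "AE x in lebesgue_on C. f2 x * iter_partial is \<phi> x = f x * iter_partial is \<phi> x"
      using eq by eventually_elim simp
  qed (use integrable_locally_integrable_test[OF C _ test_functions_iter_partial[OF \<phi>]] l f2 in auto)
  then show ?thesis using g f2 by (auto simp: has_distr_deriv_def)
qed

lemma Linf_AE_cong:
  fixes f g :: "real^'n::finite \<Rightarrow> real"
  assumes f: "f \<in> Linf C" and C: "open C" and eq: "AE x in lebesgue_on C. f x = g x"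
  shows "g \<in> Linf C" "Linf_norm C g = Linf_norm C f"
proof -
  have Cs: "C \<in> sets lebesgue" using C by auto
  have "(\<lambda>x. if x \<in> C then f x else 0) \<in> borel_measurable lebesgue"
    using f Cs by (intro borel_measurable_if_I) (auto simp: Linf_def)
  moreover have "AE x in lebesgue. (if x \<in> C then f x else 0) = (if x \<in> C then g x else 0)"
    using eq Cs by (auto simp: AE_restrict_space_iff elim!: eventually_mono)
  ultimately have "(\<lambda>x. if x \<in> C then g x else 0) \<in> borel_measurable lebesgue"
    by (rule borel_measurable_AE)
  then have "g \<in> borel_measurable (lebesgue_on C)" by (rule borel_measurable_if_D)
  from Linf_measurable_AE_cong[OF f this eq] show "g \<in> Linf C" "Linf_norm C g = Linf_norm C f" by auto
qed

lemma AE_representative_lborel: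
  assumes C: "open C" and eq: "AE x in lebesgue_on C. Q x" and out: "\<And>x. x \<notin> C \<Longrightarrow> Q x"
  shows "AE x in lborel. Q x"
proof -
  have "AE x in lebesgue. x \<in> C \<longrightarrow> Q x"
    using eq C by (subst (asm) AE_restrict_space_iff) auto
  then have "AE x in lborel. x \<in> C \<longrightarrow> Q x" by (simp add: AE_completion_iff)
  then show ?thesis by eventually_elim (use out in blast)
qed

text \<open>
The weak inequality for Borel representatives, read as an essential bound of \<open>g\<close>. The
gradient enters through any representatives \<open>u\<close> of its components and any bound \<open>L\<close> of their
\<open>l1\<close> norm.
\<close>
theorem landau_kolmogorov_additive:
  fixes f g :: "real^'n::finite \<Rightarrow> real" and u :: "'n \<Rightarrow> real^'n \<Rightarrow> real" and P :: "'n set"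
  defines "C \<equiv> orthant_cone P"
  assumes f: "f \<in> Linf C" and g: "g \<in> Linf C" and mixed: "has_mixed_deriv C f g"
    and u: "\<And>i. u i \<in> Linf C" "\<And>i. has_distr_deriv C [i] g (u i)"
    and uL: "AE x in lebesgue_on C. (\<Sum>i\<in>UNIV. \<bar>u i x\<bar>) \<le> L" and L: "0 \<le> L"
    and h: "0 < h"
  shows "Linf_norm C g \<le> h * (real CARD('n) / real (CARD('n) + 1)) * L + 2 ^ card P / h ^ CARD('n) * Linf_norm C f"
    (is "_ \<le> ?R")
proof -
  have C: "open C" unfolding C_def by (rule orthant_cone_open)
  have meas: "w \<in> borel_measurable (lebesgue_on C)" if "w \<in> Linf C" for w
    using that by (simp add: Linf_def)
  obtain f' where f': "f' \<in> borel_measurable borel" "\<And>x. \<bar>f' x\<bar> \<le> Linf_norm C f" "AE x in lebesgue_on C. f x = f' x"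
    using Linf_borel_representative[OF f C] by metis
  obtain g' where g': "g' \<in> borel_measurable borel" "\<And>x. \<bar>g' x\<bar> \<le> Linf_norm C g" "AE x in lebesgue_on C. g x = g' x"
    using Linf_borel_representative[OF g C] by metis
  have "\<forall>i. \<exists>v. v \<in> borel_measurable borel \<and> (\<forall>x. x \<notin> C \<longrightarrow> v x = 0) \<and> (AE x in lebesgue_on C. u i x = v x)"
    using Linf_borel_representative[OF u(1) C] by metis
  then obtain u' where u': "\<And>i. u' i \<in> borel_measurable borel" "\<And>i x. x \<notin> C \<Longrightarrow> u' i x = 0"
    "\<And>i. AE x in lebesgue_on C. u i x = u' i x" by metis
  have "AE x in lebesgue_on C. \<forall>i\<in>UNIV. u i x = u' i x"
    by (rule AE_ball_countable'[OF u'(3)]) (simp add: countable_finite)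
  then have "AE x in lebesgue_on C. (\<Sum>i\<in>UNIV. \<bar>u' i x\<bar>) \<le> L"
    using uL by eventually_elim simp
  then have u'L: "AE x in lborel. (\<Sum>i\<in>UNIV. \<bar>u' i x\<bar>) \<le> L"
    by (rule AE_representative_lborel[OF C]) (simp add: u'(2) L)
  obtain "is" :: "'n list" where "is": "distinct is" "set is = UNIV"
    using finite_distinct_list[OF finite] by blast
  have fg: "has_distr_deriv C is f g" using mixed "is" by (simp add: has_mixed_deriv_def)
  have R: "0 \<le> ?R" using L h Linf_norm_nonneg[of C f] by simp
  have key: "\<bar>LINT x|lebesgue_on C. g x * \<phi> x\<bar> \<le> ?R * (LINT x|lebesgue_on C. \<bar>\<phi> x\<bar>)"
    if \<phi>: "\<phi> \<in> test_functions C" for \<phi>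
  proof -
    have "\<bar>\<integral>x. g' x * \<phi> x \<partial>lborel\<bar> \<le> ?R * (\<integral>x. \<bar>\<phi> x\<bar> \<partial>lborel)"
    proof (rule weak_landau_kolmogorov[OF f'(1,2) g'(1,2) u'(1) u'L L _ _ "is" _ h])
      fix \<eta> assume "\<eta> \<in> test_functions (orthant_cone P)"
      then have \<eta>: "\<eta> \<in> test_functions C" by (simp add: C_def)
      show "(\<integral>x. g' x * partial_deriv i \<eta> x \<partial>lborel) = - (\<integral>x. u' i x * \<eta> x \<partial>lborel)" for i
        using has_distr_derivD[OF u(2) \<eta>, of i]
          integral_test_representative[OF C meas[OF g] g'(1,3) test_functions_partial_deriv[OF \<eta>], of i]
          integral_test_representative[OF C meas[OF u(1)] u'(1,3) \<eta>, of i] by simp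
      show "(\<integral>x. f' x * iter_partial is \<eta> x \<partial>lborel) = (- 1) ^ length is * (\<integral>x. g' x * \<eta> x \<partial>lborel)"
        using has_distr_derivD[OF fg \<eta>]
          integral_test_representative[OF C meas[OF f] f'(1,3) test_functions_iter_partial[OF \<eta>], of "is"]
          integral_test_representative[OF C meas[OF g] g'(1,3) \<eta>] by simp
    qed (use \<phi> in \<open>simp add: C_def\<close>)
    then show ?thesis
      using integral_test_representative[OF C meas[OF g] g'(1,3) \<phi>] integral_abs_test[OF C \<phi>] by simp
  qed
  have "AE x in lebesgue_on C. \<bar>g x\<bar> \<le> ?R"
    by (rule AE_le_of_test[OF C _ key R]) (use fg in \<open>auto simp: has_distr_deriv_def\<close>)
  then show ?thesis by (intro Linf_normI(2)[OF meas[OF g]] R)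
qed

section \<open>The norm of the cube and its dual\<close>

lemma infnorm_eq_Max_cart: "infnorm (x :: real^'n::finite) = Max (range (\<lambda>i. \<bar>x $ i\<bar>))"
proof (rule antisym)
  show "infnorm x \<le> Max (range (\<lambda>i. \<bar>x $ i\<bar>))"
    unfolding infnorm_le_iff_cart by simp
  show "Max (range (\<lambda>i. \<bar>x $ i\<bar>)) \<le> infnorm x"
    by (subst Max_le_iff) (auto simp: component_le_infnorm_cart)
qed

lemma infnorm_less_iff_cart: "infnorm (x :: real^'n::finite) < s \<longleftrightarrow> (\<forall>i. \<bar>x $ i\<bar> < s)"
  unfolding infnorm_eq_Max_cart by (subst Max_less_iff) auto

lemma body_norm_open_cube: "body_norm open_cube (x :: real^'n::finite) = infnorm x"
proof -
  have "{t. 0 < t \<and> x \<in> (\<lambda>y. t *\<^sub>R y) ` open_cube} = {infnorm x <..}"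
  proof (intro set_eqI iffI)
    fix t assume "t \<in> {t. 0 < t \<and> x \<in> (\<lambda>y. t *\<^sub>R y) ` open_cube}"
    then obtain y where t: "0 < t" and y: "x = t *\<^sub>R y" "y \<in> open_cube" by auto
    then have "\<bar>x $ i\<bar> < t" for i by (auto simp: open_cube_def abs_mult abs_less_iff)
    then show "t \<in> {infnorm x <..}" by (simp add: infnorm_less_iff_cart)
  next
    fix t assume "t \<in> {infnorm x <..}"
    then have lt: "\<bar>x $ i\<bar> < t" for i by (simp add: infnorm_less_iff_cart)
    then have t: "0 < t" using le_less_trans[OF abs_ge_zero] by blast
    have "x = t *\<^sub>R ((1 / t) *\<^sub>R x)" using t by simp
    moreover have "(1 / t) *\<^sub>R x \<in> open_cube"
      using lt t unfolding open_cube_def by (auto simp: abs_less_iff field_simps) (smt (verit))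
    ultimately show "t \<in> {t. 0 < t \<and> x \<in> (\<lambda>y. t *\<^sub>R y) ` open_cube}" using t by blast
  qed
  then show ?thesis by (simp add: body_norm_def)
qed

lemma dual_norm_open_cube: "dual_norm open_cube (z :: real^'n::finite) = (\<Sum>i\<in>UNIV. \<bar>z $ i\<bar>)"
  unfolding dual_norm_def body_norm_open_cube
proof (rule cSup_eq_maximum)
  let ?x = "(\<chi> i. sgn (z $ i)) :: real^'n"
  have "?x \<bullet> z = (\<Sum>i\<in>UNIV. \<bar>z $ i\<bar>)"
    by (simp add: inner_vec_def abs_sgn mult.commute)
  moreover have "infnorm ?x \<le> 1" by (simp add: infnorm_le_iff_cart abs_sgn_eq)
  ultimately show "(\<Sum>i\<in>UNIV. \<bar>z $ i\<bar>) \<in> {x \<bullet> z |x. infnorm x \<le> 1}" by (metis (mono_tags, lifting) mem_Collect_eq)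
next
  fix a assume "a \<in> {x \<bullet> z |x. infnorm x \<le> 1}"
  then obtain x where x: "a = x \<bullet> z" "infnorm x \<le> 1" by blast
  have "a \<le> \<bar>\<Sum>i\<in>UNIV. x $ i * z $ i\<bar>" by (simp add: x inner_vec_def)
  also have "\<dots> \<le> infnorm x * (\<Sum>i\<in>UNIV. \<bar>z $ i\<bar>)" by (rule abs_inner_le_infnorm)
  also have "\<dots> \<le> (\<Sum>i\<in>UNIV. \<bar>z $ i\<bar>)"
    using x(2) by (intro mult_left_le_one_le sum_nonneg infnorm_pos_le) auto
  finally show "a \<le> (\<Sum>i\<in>UNIV. \<bar>z $ i\<bar>)" .
qed

section \<open>The chosen representatives\<close>

text \<open>
The choice operators in \<open>mixed_deriv\<close> and \<open>distr_grad\<close> range over all locally integrable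
representatives; uniqueness transfers boundedness from one representative to the chosen ones.
\<close>
lemma mixed_deriv_representative:
  fixes f g :: "real^'n::finite \<Rightarrow> real"
  assumes C: "open C" and mixed: "has_mixed_deriv C f g" and g: "g \<in> Linf C"
    and u: "\<And>i. u i \<in> Linf C" "\<And>i. has_distr_deriv C [i] g (u i)"
  defines "G \<equiv> mixed_deriv C f"
  shows "has_mixed_deriv C f G" and "G \<in> Linf C" and "Linf_norm C G = Linf_norm C g"
    and "\<And>i. has_distr_deriv C [i] G (\<lambda>x. distr_grad C G x $ i)"
    and "\<And>i. AE x in lebesgue_on C. u i x = distr_grad C G x $ i"
    and "\<And>i. (\<lambda>x. distr_grad C G x $ i) \<in> Linf C"
proof -
  show G: "has_mixed_deriv C f G" unfolding G_def mixed_deriv_def by (rule someI[where P="has_mixed_deriv C f", OF mixed])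
  obtain "is" :: "'n list" where "is": "distinct is" "set is = UNIV"
    using finite_distinct_list[OF finite] by blast
  have "has_distr_deriv C is f g" "has_distr_deriv C is f G"
    using mixed G "is" by (simp_all add: has_mixed_deriv_def)
  then have eq: "AE x in lebesgue_on C. g x = G x" and lG: "locally_integrable C G"
    using has_distr_deriv_unique[OF C] by (auto simp: has_distr_deriv_def)
  show "G \<in> Linf C" "Linf_norm C G = Linf_norm C g"
    using Linf_AE_cong[OF g C eq] by auto
  have Gu: "has_distr_deriv C [i] G (u i)" for i
    by (rule has_distr_deriv_AE_cong[OF C u(2) lG eq])
  have grad: "(\<lambda>x. distr_grad C G x $ i) = (SOME u. has_distr_deriv C [i] G u)" for i
    by (simp add: distr_grad_def)
  show D: "has_distr_deriv C [i] G (\<lambda>x. distr_grad C G x $ i)" for i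
    unfolding grad by (rule someI[where P="has_distr_deriv C [i] G" for i, OF Gu])
  show A: "AE x in lebesgue_on C. u i x = distr_grad C G x $ i" for i
    by (rule has_distr_deriv_unique[OF C Gu D])
  show "(\<lambda>x. distr_grad C G x $ i) \<in> Linf C" for i
    by (rule Linf_AE_cong(1)[OF u(1) C A])
qed

lemma Linf_sum_abs:
  fixes u :: "'n::finite \<Rightarrow> real^'n \<Rightarrow> real"
  assumes u: "\<And>i. u i \<in> Linf C"
  shows "(\<lambda>x. \<Sum>i\<in>UNIV. \<bar>u i x\<bar>) \<in> Linf C"
proof (rule Linf_normI(1))
  show "(\<lambda>x. \<Sum>i\<in>UNIV. \<bar>u i x\<bar>) \<in> borel_measurable (lebesgue_on C)"
    using u by (intro borel_measurable_sum borel_measurable_abs) (simp add: Linf_def)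
  have "AE x in lebesgue_on C. \<forall>i\<in>UNIV. \<bar>u i x\<bar> \<le> Linf_norm C (u i)"
    by (rule AE_ball_countable'[OF Linf_AE[OF u]]) (simp add: countable_finite)
  then show "AE x in lebesgue_on C. \<bar>\<Sum>i\<in>UNIV. \<bar>u i x\<bar>\<bar> \<le> (\<Sum>i\<in>UNIV. Linf_norm C (u i))"
    by eventually_elim (auto intro!: sum_mono simp: sum_nonneg)
  show "0 \<le> (\<Sum>i\<in>UNIV. Linf_norm C (u i))" by (intro sum_nonneg Linf_norm_nonneg)
qed

section \<open>From the additive to the multiplicative form\<close>

text \<open>
For positive \<open>L\<close> and \<open>A\<close> the right-hand side is smallest when \<open>h ^ (d + 1) = (d + 1) * A / L\<close>. If one
of them vanishes, \<open>h\<close> tends to infinity (\<open>L = 0\<close>) or to \<open>0\<close> (\<open>A = 0\<close>) instead.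
\<close>
lemma optimise_additive_inequality:
  fixes G L A :: real
  assumes d: "0 < d" and L: "0 \<le> L" and A: "0 \<le> A"
    and le: "\<And>h. 0 < h \<Longrightarrow> G \<le> h * (real d / real (d + 1)) * L + A / h ^ d"
  shows "G \<le> (real (d + 1) * A) powr (1 / real (d + 1)) * L powr (real d / real (d + 1))"
proof -
  define c where "c = real d / real (d + 1)"
  have c: "0 < c" "c \<le> 1" using d by (auto simp: c_def)
  consider "L = 0" | "L > 0" "A = 0" | "L > 0" "A > 0" using L A by linarith
  then show ?thesis
  proof cases
    case 1
    have "G \<le> 0 + e" if "0 < e" for e
    proof -
      define h where "h = A / e + 1"
      have h: "1 \<le> h" using A that by (simp add: h_def)
      have "G \<le> A / h ^ d" using le[of h] h 1 by simp
      also have "\<dots> \<le> A / h"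
        using A h d power_increasing[of 1 d h] by (intro divide_left_mono) auto
      also have "\<dots> \<le> e" using A that h by (simp add: h_def field_simps)
      finally show ?thesis by simp
    qed
    then have "G \<le> 0" by (rule field_le_epsilon)
    then show ?thesis using 1 by simp
  next
    case 2
    have "G \<le> 0 + e" if "0 < e" for e
      using le[of "e / (c * L)", folded c_def] that 2 c by simp
    then have "G \<le> 0" by (rule field_le_epsilon)
    then show ?thesis using 2 by simp
  next
    case 3
    define q where "q = real (d + 1) * A"
    define h where "h = (q / L) powr (1 / real (d + 1))"
    have q: "0 < q" using 3 by (simp add: q_def)
    then have h: "0 < h" using 3 by (simp add: h_def)
    have "h ^ (d + 1) = q / L"
      using h q 3 unfolding h_def by (subst powr_realpow[symmetric]) (auto simp: powr_powr)
    then have hd: "h ^ d = q / L / h" using h by (subst nonzero_eq_divide_eq) (simp_all add: mult.commute)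
    have "G \<le> h * c * L + A / h ^ d" using le[OF h] by (simp add: c_def)
    also have "A / h ^ d = h * L / real (d + 1)"
      using h q 3 unfolding hd by (simp add: q_def field_simps)
    also have "h * c * L + h * L / real (d + 1) = h * L * (c + 1 / real (d + 1))" by (simp add: algebra_simps)
    also have "c + 1 / real (d + 1) = 1" by (simp add: c_def add_divide_distrib[symmetric])
    also have "h * L * 1 = h * L" by simp
    also have "\<dots> = q powr (1 / real (d + 1)) * (L powr (- (1 / real (d + 1))) * L powr 1)"
      using q 3 by (simp add: h_def powr_divide powr_minus_divide)
    also have "L powr (- (1 / real (d + 1))) * L powr 1 = L powr (real d / real (d + 1))"
      unfolding powr_add[symmetric] by (simp add: field_simps)
    finally show ?thesis by (simp add: q_def)
  qed
qed

section \<open>The pyramid and its gradient\<close>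

definition pyramid :: "real \<Rightarrow> real^'n::finite \<Rightarrow> real" where
  "pyramid h x = max 0 (h - infnorm x)"

definition pyramid_grad :: "real \<Rightarrow> 'n \<Rightarrow> real^'n::finite \<Rightarrow> real" where
  "pyramid_grad h i x = (if infnorm x < h \<and> \<bar>x $ i\<bar> = infnorm x then - sgn (x $ i) else 0)"

lemma infnorm_measurable [measurable]: "(infnorm :: real^'n::finite \<Rightarrow> real) \<in> borel_measurable borel"
  by (intro borel_measurable_continuous_onI continuous_intros)

lemma pyramid_measurable [measurable]:
  "pyramid h \<in> borel_measurable borel" "pyramid_grad h i \<in> borel_measurable borel"
  unfolding pyramid_def[abs_def] pyramid_grad_def[abs_def] by measurable

lemma pyramid_bounds: "0 < h \<Longrightarrow> 0 \<le> pyramid h x" "0 < h \<Longrightarrow> pyramid h x \<le> h"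
  using infnorm_pos_le[of x] by (auto simp: pyramid_def)

lemma abs_pyramid_grad_le: "\<bar>pyramid_grad h i x\<bar> \<le> 1"
  by (simp add: pyramid_grad_def abs_sgn_eq)

lemma infnorm_axis_add: "\<bar>infnorm (x + s *\<^sub>R axis i 1) - infnorm (x :: real^'n::finite)\<bar> \<le> \<bar>s\<bar>"
proof -
  have "infnorm (s *\<^sub>R axis i 1 :: real^'n) \<le> \<bar>s\<bar>"
    unfolding infnorm_le_iff_cart by (simp add: axis_def)
  then show ?thesis using absdiff_infnorm[of "x + s *\<^sub>R axis i 1" x] by simp
qed

lemma pyramid_lipschitz: "\<bar>pyramid h (x + s *\<^sub>R axis i 1) - pyramid h x\<bar> \<le> \<bar>s\<bar>"
  using infnorm_axis_add[of x s i] by (auto simp: pyramid_def max_def)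

text \<open>
At the points excluded here the pyramid may have an edge.
\<close>
lemma AE_generic_point:
  "AE x in lborel. (\<forall>i. (x :: real^'n::finite) $ i \<noteq> 0 \<and> \<bar>x $ i\<bar> \<noteq> h) \<and> (\<forall>i j. i \<noteq> j \<longrightarrow> \<bar>x $ i\<bar> \<noteq> \<bar>x $ j\<bar>)"
proof -
  have hyp: "AE x in lborel. (x :: real^'n) $ i + c * x $ j \<noteq> 0" if "i \<noteq> j" for i j and c :: real
  proof -
    have "(axis i 1 + c *\<^sub>R axis j 1 :: real^'n) $ i = 1" using that by (simp add: axis_def)
    then have "axis i 1 + c *\<^sub>R axis j 1 \<noteq> (0 :: real^'n)" by (metis zero_index zero_neq_one)
    then have "negligible {x :: real^'n. (axis i 1 + c *\<^sub>R axis j 1) \<bullet> x = 0}"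
      by (intro negligible_hyperplane) simp
    then have "AE x in lebesgue. (x :: real^'n) $ i + c * x $ j \<noteq> 0"
      by (intro AE_I'[of "{x. (axis i 1 + c *\<^sub>R axis j 1) \<bullet> x = 0}"])
        (auto simp: negligible_iff_null_sets inner_add_left inner_axis')
    then show ?thesis by (simp add: AE_completion_iff)
  qed
  have "AE x in lborel. i \<noteq> j \<longrightarrow> \<bar>(x :: real^'n) $ i\<bar> \<noteq> \<bar>x $ j\<bar>" for i j
  proof (cases "i = j")
    case False
    show ?thesis using hyp[OF False, of 1] hyp[OF False, of "-1"]
      by eventually_elim (auto simp: abs_eq_iff)
  qed simp
  then have 1: "AE x in lborel. \<forall>i\<in>UNIV. \<forall>j\<in>UNIV. i \<noteq> j \<longrightarrow> \<bar>(x :: real^'n) $ i\<bar> \<noteq> \<bar>x $ j\<bar>"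
    by (intro AE_ball_countable' countable_finite) auto
  have "AE x in lborel. (x :: real^'n) $ i \<noteq> 0 \<and> \<bar>x $ i\<bar> \<noteq> h" for i
    using AE_lborel_component_neq[of i 0] AE_lborel_component_neq[of i h] AE_lborel_component_neq[of i "- h"]
    by eventually_elim auto
  then have "AE x in lborel. \<forall>i\<in>UNIV. (x :: real^'n) $ i \<noteq> 0 \<and> \<bar>x $ i\<bar> \<noteq> h"
    by (intro AE_ball_countable' countable_finite) auto
  with 1 show ?thesis by eventually_elim auto
qed

lemma infnorm_attained: "\<exists>j. \<bar>(x :: real^'n::finite) $ j\<bar> = infnorm x"
proof -
  have "Max (range (\<lambda>i. \<bar>x $ i\<bar>)) \<in> range (\<lambda>i. \<bar>x $ i\<bar>)" by (rule Max_in) auto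
  then obtain j where "Max (range (\<lambda>i. \<bar>x $ i\<bar>)) = \<bar>x $ j\<bar>" by blast
  then show ?thesis by (intro exI[of _ j]) (simp add: infnorm_eq_Max_cart)
qed

text \<open>
At a generic point exactly one coordinate attains the maximum norm. A small move along axis \<open>i\<close>
changes the pyramid only if that coordinate is \<open>i\<close>, and then with slope \<open>- sgn (x $ i)\<close>.
\<close>
lemma pyramid_locally_affine:
  fixes x :: "real^'n::finite"
  assumes gen: "\<And>i. x $ i \<noteq> 0 \<and> \<bar>x $ i\<bar> \<noteq> h" "\<And>i j. i \<noteq> j \<Longrightarrow> \<bar>x $ i\<bar> \<noteq> \<bar>x $ j\<bar>"
  shows "\<exists>\<delta>>0. \<forall>s. \<bar>s\<bar> < \<delta> \<longrightarrow> pyramid h (x + s *\<^sub>R axis i 1) = pyramid h x + s * pyramid_grad h i x"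
proof -
  let ?r = "infnorm x" and ?y = "\<lambda>s. x + s *\<^sub>R axis i 1"
  have yi: "?y s $ i = x $ i + s" for s by (simp add: axis_def)
  have yj: "?y s $ j = x $ j" if "j \<noteq> i" for s j using that by (simp add: axis_def)
  obtain j where j: "\<bar>x $ j\<bar> = ?r" using infnorm_attained by blast
  then have "?r \<noteq> h" using gen(1)[of j] by simp
  consider "h < ?r" | "?r < h" "\<bar>x $ i\<bar> \<noteq> ?r" | "?r < h" "\<bar>x $ i\<bar> = ?r" using \<open>?r \<noteq> h\<close> by linarith
  then show ?thesis
  proof cases
    case 1
    show ?thesis
    proof (intro exI[of _ "?r - h"] conjI allI impI)
      fix s assume "\<bar>s\<bar> < ?r - h"
      then have "h \<le> infnorm (?y s)" using infnorm_axis_add[of x s i] by linarith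
      then show "pyramid h (?y s) = pyramid h x + s * pyramid_grad h i x"
        using 1 by (simp add: pyramid_def pyramid_grad_def)
    qed (use 1 in simp)
  next
    case 2
    have lt: "\<bar>x $ i\<bar> < ?r" using 2 component_le_infnorm_cart[of x i] by simp
    have "j \<noteq> i" using j 2 by auto
    show ?thesis
    proof (intro exI[of _ "?r - \<bar>x $ i\<bar>"] conjI allI impI)
      fix s assume s: "\<bar>s\<bar> < ?r - \<bar>x $ i\<bar>"
      have "infnorm (?y s) = ?r"
      proof (rule antisym)
        have "\<bar>?y s $ k\<bar> \<le> ?r" for k
          using s yi[of s] yj[of k s] component_le_infnorm_cart[of x k] by (cases "k = i") auto
        then show "infnorm (?y s) \<le> ?r" by (simp add: infnorm_le_iff_cart)
        show "?r \<le> infnorm (?y s)"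
          using component_le_infnorm_cart[of "?y s" j] unfolding yj[OF \<open>j \<noteq> i\<close>] j .
      qed
      then show "pyramid h (?y s) = pyramid h x + s * pyramid_grad h i x"
        using 2 by (simp add: pyramid_def pyramid_grad_def)
    qed (use lt in simp)
  next
    case 3
    \<comment> \<open>Moves shorter than these numbers stay inside the pyramid, keep the sign of \<open>x $ i\<close> and keep it the largest coordinate.\<close>
    define D where "D = insert (h - ?r) (insert ?r ((\<lambda>k. ?r - \<bar>x $ k\<bar>) ` (UNIV - {i})))"
    have pos: "0 < ?r" using gen(1)[of i] 3 by auto
    have "0 < ?r - \<bar>x $ k\<bar>" if "k \<noteq> i" for k
      using gen(2)[OF that] component_le_infnorm_cart[of x k] 3 by simp
    then have "0 < Min D" using 3 pos by (subst Min_gr_iff) (auto simp: D_def)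
    show ?thesis
    proof (intro exI[of _ "Min D"] conjI allI impI)
      fix s assume "\<bar>s\<bar> < Min D"
      then have sD: "\<bar>s\<bar> < e" if "e \<in> D" for e using that Min_le[of D e] by (auto simp: D_def)
      have s: "\<bar>s\<bar> < h - ?r" "\<bar>s\<bar> < ?r" "\<And>k. k \<noteq> i \<Longrightarrow> \<bar>s\<bar> < ?r - \<bar>x $ k\<bar>"
        by (auto intro!: sD simp: D_def)
      have i: "\<bar>x $ i + s\<bar> = ?r + s * sgn (x $ i)"
        using 3 s(2) gen(1)[of i] by (auto simp: sgn_if abs_if split: if_splits)
      have low: "?r - \<bar>s\<bar> \<le> \<bar>x $ i + s\<bar>" using 3(2) by linarith
      have "infnorm (?y s) = \<bar>x $ i + s\<bar>"
      proof (rule antisym)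
        have "\<bar>?y s $ k\<bar> \<le> \<bar>x $ i + s\<bar>" for k
          using yi[of s] yj[of k s] s(3)[of k] low by (cases "k = i") auto
        then show "infnorm (?y s) \<le> \<bar>x $ i + s\<bar>" by (simp add: infnorm_le_iff_cart)
        show "\<bar>x $ i + s\<bar> \<le> infnorm (?y s)" using component_le_infnorm_cart[of "?y s" i] yi[of s] by simp
      qed
      moreover have "\<bar>x $ i + s\<bar> \<le> h" using 3(2) s(1) by linarith
      ultimately show "pyramid h (?y s) = pyramid h x + s * pyramid_grad h i x"
        using 3 i by (simp add: pyramid_def pyramid_grad_def)
    qed (use \<open>0 < Min D\<close> in simp)
  qed
qed

lemma sum_pyramid_grad_le_1:
  fixes x :: "real^'n::finite"
  assumes gen: "\<And>i j. i \<noteq> j \<Longrightarrow> \<bar>x $ i\<bar> \<noteq> \<bar>x $ j\<bar>"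
  shows "(\<Sum>i\<in>UNIV. \<bar>pyramid_grad h i x\<bar>) \<le> 1"
proof -
  obtain j where j: "\<bar>x $ j\<bar> = infnorm x" using infnorm_attained by blast
  have "pyramid_grad h i x = 0" if "i \<noteq> j" for i
    using gen[OF that] j by (simp add: pyramid_grad_def)
  then have "(\<Sum>i\<in>UNIV. \<bar>pyramid_grad h i x\<bar>) = \<bar>pyramid_grad h j x\<bar>"
    by (subst sum.remove[of _ j]) auto
  then show ?thesis using abs_pyramid_grad_le[of h j x] by simp
qed

lemma pyramid_weak_grad:
  assumes h: "0 < h" and \<phi>: "\<phi> \<in> test_functions C"
  shows "(\<integral>x. pyramid h x * partial_deriv i \<phi> x \<partial>lborel) = - (\<integral>x. pyramid_grad h i x * \<phi> x \<partial>lborel)"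
proof (rule weak_partial_deriv_of_lipschitz[where M = 1, OF _ _ _ _ _ \<phi>])
  show "\<bar>pyramid h (x + t *\<^sub>R axis i 1) - pyramid h x\<bar> \<le> 1 * \<bar>t\<bar>" for x t
    using pyramid_lipschitz[of h x t i] by simp
  show "\<bar>pyramid h x\<bar> \<le> h" for x using pyramid_bounds[OF h, of x] by simp
  show "AE x in lborel. (\<lambda>k. (pyramid h (x + (1 / real (Suc k)) *\<^sub>R axis i 1) - pyramid h x) * real (Suc k))
      \<longlonglongrightarrow> pyramid_grad h i x"
    using AE_generic_point[of h]
  proof eventually_elim
    case (elim x)
    have "\<exists>\<delta>>0. \<forall>s. \<bar>s\<bar> < \<delta> \<longrightarrow> pyramid h (x + s *\<^sub>R axis i 1) = pyramid h x + s * pyramid_grad h i x"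
      by (rule pyramid_locally_affine) (use elim in auto)
    then obtain \<delta> where \<delta>: "0 < \<delta>"
      "\<And>s. \<bar>s\<bar> < \<delta> \<Longrightarrow> pyramid h (x + s *\<^sub>R axis i 1) = pyramid h x + s * pyramid_grad h i x"
      by blast
    have "eventually (\<lambda>k. 1 / real (Suc k) < \<delta>) sequentially"
      using order_tendstoD(2)[OF LIMSEQ_Suc[OF lim_1_over_n] \<delta>(1)] by simp
    then have "eventually (\<lambda>k. (pyramid h (x + (1 / real (Suc k)) *\<^sub>R axis i 1) - pyramid h x) * real (Suc k) =
        pyramid_grad h i x) sequentially"
    proof eventually_elim
      case (elim k)
      then have "\<bar>1 / real (Suc k)\<bar> < \<delta>" by simp
      from \<delta>(2)[OF this] show ?case by (simp del: of_nat_Suc)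
    qed
    then show ?case by (rule tendsto_eventually)
  qed
qed auto

section \<open>Primitives for the mixed derivative\<close>

text \<open>
Convolution with the fundamental solution of the mixed derivative. Each factor is at most \<open>1 / 2\<close> in
absolute value, which is half of what integration from a corner would give; this is where the
sharp constant comes from.
\<close>
definition mixed_primitive :: "(real^'n \<Rightarrow> real) \<Rightarrow> real^'n::finite \<Rightarrow> real" where
  "mixed_primitive G x = (\<integral>y. G y * (\<Prod>i\<in>UNIV. sgn (x $ i - y $ i) / 2) \<partial>lborel)"

lemma abs_prod_half_sgn_le: "\<bar>\<Prod>i\<in>(UNIV :: 'n::finite set). sgn (z i :: real) / 2\<bar> \<le> (1 / 2) ^ CARD('n)"
proof -
  have "(\<Prod>i\<in>UNIV. \<bar>sgn (z i) / 2\<bar>) \<le> (\<Prod>i\<in>(UNIV :: 'n set). 1 / 2)"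
    by (rule prod_mono) (auto simp: abs_sgn_eq)
  then show ?thesis by (simp add: abs_prod)
qed

lemma measurable_vec_nth_compose [measurable (raw)]:
  fixes f :: "'a \<Rightarrow> real^'n::finite"
  assumes "f \<in> measurable M borel"
  shows "(\<lambda>x. f x $ i) \<in> borel_measurable M"
  by (rule measurable_compose[OF assms]) (intro borel_measurable_continuous_onI continuous_intros)

lemma mixed_primitive_measurable:
  assumes [measurable]: "G \<in> borel_measurable borel"
  shows "mixed_primitive G \<in> borel_measurable borel"
  unfolding mixed_primitive_def[abs_def] by measurable

lemma abs_mixed_primitive_le:
  fixes G :: "real^'n::finite \<Rightarrow> real"
  assumes G: "integrable lborel G"
  shows "\<bar>mixed_primitive G x\<bar> \<le> (1 / 2) ^ CARD('n) * (\<integral>y. \<bar>G y\<bar> \<partial>lborel)"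
proof -
  have [measurable]: "G \<in> borel_measurable borel" using G by auto
  have "integrable lborel (\<lambda>y. (\<Prod>i\<in>UNIV. sgn (x $ i - y $ i) / 2) * G y)"
    by (rule integrable_bounded_mult[OF _ _ G, of _ "(1 / 2) ^ CARD('n)"]) (auto intro: abs_prod_half_sgn_le)
  then have i: "integrable lborel (\<lambda>y. G y * (\<Prod>i\<in>UNIV. sgn (x $ i - y $ i) / 2))" by (simp only: mult.commute)
  have "\<bar>mixed_primitive G x\<bar> \<le> (\<integral>y. \<bar>G y * (\<Prod>i\<in>UNIV. sgn (x $ i - y $ i) / 2)\<bar> \<partial>lborel)"
    unfolding mixed_primitive_def by (rule integral_abs_bound)
  also have "\<dots> \<le> (\<integral>y. \<bar>G y\<bar> * (1 / 2) ^ CARD('n) \<partial>lborel)"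
  proof (rule integral_mono[OF integrable_abs[OF i]])
    show "integrable lborel (\<lambda>y. \<bar>G y\<bar> * (1 / 2) ^ CARD('n))" using G by auto
    show "\<bar>G y * (\<Prod>i\<in>UNIV. sgn (x $ i - y $ i) / 2)\<bar> \<le> \<bar>G y\<bar> * (1 / 2) ^ CARD('n)" for y
      unfolding abs_mult by (intro mult_left_mono abs_prod_half_sgn_le) auto
  qed
  finally show ?thesis by (simp add: mult.commute)
qed

lemma mixed_primitive_weak_deriv:
  fixes G \<phi> :: "real^'n::finite \<Rightarrow> real"
  assumes G: "integrable lborel G" and \<phi>: "\<phi> \<in> test_functions C" and "is": "distinct is" "set is = UNIV"
  shows "(\<integral>x. mixed_primitive G x * iter_partial is \<phi> x \<partial>lborel) = (- 1) ^ length is * (\<integral>y. G y * \<phi> y \<partial>lborel)"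
proof -
  let ?\<Theta> = "iter_partial is \<phi>" and ?d = "CARD('n)"
  let ?s = "\<lambda>x y. \<Prod>i\<in>UNIV. sgn ((x :: real^'n) $ i - y $ i) / 2"
  let ?K = "\<lambda>x y. G y * ?s x y * ?\<Theta> x"
  note \<Theta> = test_functions_iter_partial[OF \<phi>, of "is"]
  note i\<Theta> = test_functions_integrable[OF \<Theta>]
  have [measurable]: "G \<in> borel_measurable borel" "?\<Theta> \<in> borel_measurable borel"
    using G test_functions_measurable[OF \<Theta>] by auto
  have bd: "\<bar>?K x y\<bar> \<le> (1 / 2) ^ ?d * \<bar>?\<Theta> x\<bar> * \<bar>G y\<bar>" for x y
  proof -
    have "\<bar>?K x y\<bar> = \<bar>?s x y\<bar> * (\<bar>?\<Theta> x\<bar> * \<bar>G y\<bar>)" by (simp add: abs_mult mult_ac)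
    also have "\<dots> \<le> (1 / 2) ^ ?d * (\<bar>?\<Theta> x\<bar> * \<bar>G y\<bar>)"
      by (intro mult_right_mono abs_prod_half_sgn_le) auto
    finally show ?thesis by (simp add: mult.assoc)
  qed
  have iy: "integrable lborel (\<lambda>y. ?K x y)" for x
    by (rule Bochner_Integration.integrable_bound[of _ "\<lambda>y. (1 / 2) ^ ?d * \<bar>?\<Theta> x\<bar> * \<bar>G y\<bar>"])
      (use G bd in \<open>auto intro: order_trans[OF _ abs_ge_self]\<close>)
  have "integrable (lborel \<Otimes>\<^sub>M lborel) (case_prod ?K)"
  proof (rule lborel_pair.Fubini_integrable)
    show "AE x in lborel. integrable lborel (\<lambda>y. case_prod ?K (x, y))" using iy by simp
    show "integrable lborel (\<lambda>x. \<integral>y. norm (case_prod ?K (x, y)) \<partial>lborel)"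
    proof (rule Bochner_Integration.integrable_bound)
      show "integrable lborel (\<lambda>x. ((1 / 2) ^ ?d * (\<integral>y. \<bar>G y\<bar> \<partial>lborel)) * \<bar>?\<Theta> x\<bar>)" using i\<Theta> by auto
      show "AE x in lborel. norm (\<integral>y. norm (case_prod ?K (x, y)) \<partial>lborel) \<le>
          norm (((1 / 2) ^ ?d * (\<integral>y. \<bar>G y\<bar> \<partial>lborel)) * \<bar>?\<Theta> x\<bar>)"
      proof (rule AE_I2)
        fix x
        have "(\<integral>y. \<bar>?K x y\<bar> \<partial>lborel) \<le> (\<integral>y. (1 / 2) ^ ?d * \<bar>?\<Theta> x\<bar> * \<bar>G y\<bar> \<partial>lborel)"
          by (rule integral_mono[OF integrable_abs[OF iy] _ bd]) (use G in auto)
        then show "norm (\<integral>y. norm (case_prod ?K (x, y)) \<partial>lborel) \<le>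
          norm (((1 / 2) ^ ?d * (\<integral>y. \<bar>G y\<bar> \<partial>lborel)) * \<bar>?\<Theta> x\<bar>)"
          by (simp add: abs_mult mult_ac)
      qed
    qed measurable
  qed measurable
  note Fub = lborel_pair.Fubini_integral[OF this]
  have "(\<integral>x. mixed_primitive G x * ?\<Theta> x \<partial>lborel) = (\<integral>x. (\<integral>y. ?K x y \<partial>lborel) \<partial>lborel)"
    by (simp add: mixed_primitive_def)
  also have "\<dots> = (\<integral>y. (\<integral>x. ?K x y \<partial>lborel) \<partial>lborel)" by (rule Fub[symmetric])
  also have "\<dots> = (\<integral>y. (- 1) ^ ?d * (G y * \<phi> y) \<partial>lborel)"
  proof (rule Bochner_Integration.integral_cong)
    fix y
    have "?K x y = G y * (1 / 2) ^ ?d * ((\<Prod>i\<in>UNIV. sgn (x $ i - y $ i)) * ?\<Theta> x)" for x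
      by (simp add: prod_dividef power_one_over)
    then have "(\<integral>x. ?K x y \<partial>lborel) = G y * (1 / 2) ^ ?d * ((- 2) ^ ?d * \<phi> y)"
      by (simp only: integral_mult_right_zero sgn_kernel_integral[OF \<phi> "is"])
    also have "\<dots> = ((1 / 2) ^ ?d * (- 2) ^ ?d) * (G y * \<phi> y)" by (simp only: mult_ac)
    also have "(1 / 2) ^ ?d * (- 2) ^ ?d = (- 1 :: real) ^ ?d" by (simp add: power_mult_distrib[symmetric])
    finally show "(\<integral>x. ?K x y \<partial>lborel) = (- 1) ^ ?d * (G y * \<phi> y)" .
  qed simp
  also have "\<dots> = (- 1) ^ length is * (\<integral>y. G y * \<phi> y \<partial>lborel)"
    using "is" distinct_card[of "is"] by simp
  finally show ?thesis .
qed

section \<open>The extremal function\<close>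

lemma bounded_borel_on:
  fixes w :: "real^'n::finite \<Rightarrow> real"
  assumes w: "w \<in> borel_measurable borel" and B: "\<And>x. \<bar>w x\<bar> \<le> B"
  shows "locally_integrable C w" "w \<in> borel_measurable (lebesgue_on C)" "w \<in> Linf C" "Linf_norm C w \<le> B"
proof -
  note [measurable] = w
  show "locally_integrable C w"
    unfolding locally_integrable_def
  proof (intro allI impI)
    fix S assume "compact S \<and> S \<subseteq> C"
    then have S: "compact S" by simp
    then have [measurable]: "S \<in> sets borel" by (simp add: compact_imp_closed borel_closed)
    have "integrable lborel (\<lambda>x. indicator S x *\<^sub>R w x)"
      by (rule integrable_bounded_compact_support[OF _ S, of _ B]) (use B in \<open>auto simp: indicator_def\<close>)
    then show "w absolutely_integrable_on S"
      unfolding set_integrable_def by (subst integrable_completion) auto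
  qed
  show m: "w \<in> borel_measurable (lebesgue_on C)"
    by (intro measurable_restrict_space1 measurable_completion) simp
  show "w \<in> Linf C" "Linf_norm C w \<le> B"
    using Linf_normI[OF m, of B] B order_trans[OF abs_ge_zero B[of 0]] by auto
qed

lemma has_distr_deriv_lborelI:
  fixes f g :: "real^'n::finite \<Rightarrow> real"
  assumes C: "open C" and f: "f \<in> borel_measurable borel" "\<And>x. \<bar>f x\<bar> \<le> A"
    and g: "g \<in> borel_measurable borel" "\<And>x. \<bar>g x\<bar> \<le> B"
    and eq: "\<And>\<phi>. \<phi> \<in> test_functions C \<Longrightarrow>
      (\<integral>x. f x * iter_partial is \<phi> x \<partial>lborel) = (- 1) ^ length is * (\<integral>x. g x * \<phi> x \<partial>lborel)"
  shows "has_distr_deriv C is f g"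
  unfolding has_distr_deriv_def
proof (intro conjI ballI)
  show "locally_integrable C f" "locally_integrable C g"
    using bounded_borel_on(1) f g by blast+
  fix \<phi> assume \<phi>: "\<phi> \<in> test_functions C"
  show "(LINT x|lebesgue_on C. f x * iter_partial is \<phi> x) = (- 1) ^ length is * (LINT x|lebesgue_on C. g x * \<phi> x)"
    using eq[OF \<phi>]
      integral_test_representative[OF C bounded_borel_on(2)[OF f] f(1) _ test_functions_iter_partial[OF \<phi>]]
      integral_test_representative[OF C bounded_borel_on(2)[OF g] g(1) _ \<phi>] by simp
qed

lemma integral_pyramid_cone:
  fixes P :: "'n::finite set"
  assumes h: "0 < h"
  shows "integrable lborel (\<lambda>x. indicator (orthant_cone P) x * pyramid h x)"
    and "(\<integral>x. indicator (orthant_cone P) x * pyramid h x \<partial>lborel) =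
      2 ^ (CARD('n) - card P) * h ^ (CARD('n) + 1) / real (CARD('n) + 1)"
proof -
  have [measurable]: "orthant_cone P \<in> sets borel" by (intro borel_open orthant_cone_open)
  have "indicator (orthant_cone P) x * pyramid h x = indicator (cone_box P h) x * (h - infnorm x)"
    if "\<forall>i. x $ i \<noteq> 0" for x
  proof (cases "x \<in> orthant_cone P")
    case True
    then show ?thesis
      by (auto simp: orthant_cone_def mem_cone_box pyramid_def infnorm_le_iff_cart[symmetric] indicator_def
          intro: less_imp_le)
  next
    case False
    then have "x \<notin> cone_box P h" using that by (auto simp: orthant_cone_def mem_cone_box less_le)
    then show ?thesis using False by simp
  qed
  then have eq: "AE x in lborel. indicator (orthant_cone P) x * pyramid h x = indicator (cone_box P h) x * (h - infnorm x)"
    using AE_generic_point[of h] by (auto elim!: eventually_mono)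
  have i: "integrable lborel (\<lambda>x. indicator (cone_box P h) x *\<^sub>R (h - infnorm (x :: real^'n)))"
    unfolding cone_box_def by (intro borel_integrable_compact compact_cbox continuous_intros)
  have [measurable]: "cone_box P h \<in> sets borel" by (simp add: cone_box_def)
  show "integrable lborel (\<lambda>x. indicator (orthant_cone P) x * pyramid h x)"
    by (subst integrable_cong_AE[OF _ _ eq]) (use i in auto)
  have "(\<integral>x. indicator (orthant_cone P) x * pyramid h x \<partial>lborel) =
     (\<integral>x. indicator (cone_box P h) x * (h - infnorm (x :: real^'n)) \<partial>lborel)"
    by (rule integral_cong_AE[OF _ _ eq]) measurable
  then show "(\<integral>x. indicator (orthant_cone P) x * pyramid h x \<partial>lborel) =
      2 ^ (CARD('n) - card P) * h ^ (CARD('n) + 1) / real (CARD('n) + 1)"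
    using integral_cone_box_pyramid[of h P] h by simp
qed

text \<open>
The values near \<open>h\<close> are taken close to the vertex of the cone, on a nonempty open set.
\<close>
lemma Linf_norm_pyramid:
  fixes P :: "'n::finite set"
  assumes h: "0 < h"
  shows "Linf_norm (orthant_cone P) (pyramid h) = h"
proof (rule antisym)
  let ?C = "orthant_cone P" and ?N = "Linf_norm (orthant_cone P) (pyramid h)"
  have b: "\<bar>pyramid h x\<bar> \<le> h" for x :: "real^'n" using pyramid_bounds[OF h, of x] by simp
  show "?N \<le> h" by (rule bounded_borel_on(4)[OF _ b]) simp
  show "h \<le> ?N"
  proof (rule ccontr)
    assume "\<not> h \<le> ?N"
    define S where "S = ?C \<inter> {x. infnorm x < h - ?N}"
    have "open S" unfolding S_def
      by (intro open_Int orthant_cone_open open_Collect_less continuous_intros)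
    moreover have "(\<chi> i. (h - ?N) / 2) \<in> S"
      using \<open>\<not> h \<le> ?N\<close> by (simp add: S_def orthant_cone_def infnorm_less_iff_cart)
    ultimately have "\<not> negligible S" using open_not_negligible by blast
    have "AE x in lebesgue_on ?C. \<bar>pyramid h x\<bar> \<le> ?N"
      by (rule Linf_AE[OF bounded_borel_on(3)[OF _ b]]) simp
    then have "AE x in lebesgue. x \<in> ?C \<longrightarrow> \<bar>pyramid h x\<bar> \<le> ?N"
      using orthant_cone_open[of P] by (subst (asm) AE_restrict_space_iff) auto
    then have "AE x in lebesgue. x \<notin> S"
      by eventually_elim (auto simp: S_def pyramid_def)
    then have "negligible S"
      using \<open>open S\<close> by (simp add: negligible_iff_null_sets completion.null_sets_iff_AE)
    with \<open>\<not> negligible S\<close> show False by simp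
  qed
qed

text \<open>
The estimates available directly are one-sided: the gradient norm is at most \<open>1\<close> and \<open>\<bar>f\<bar>\<close> at most
\<open>F\<close>. Since \<open>h\<close> is the norm of the mixed derivative, the additive inequality says that they cannot
both hold unless they are equalities.
\<close>
lemma extremal_function:
  fixes P :: "'n::finite set" and h :: real
  defines "C \<equiv> orthant_cone P" and "d \<equiv> CARD('n)"
  assumes h: "0 < h"
  shows "\<exists>f\<in>W_mixed_grad C. Linf_norm C (mixed_deriv C f) = h \<and>
     Linf_norm C (\<lambda>x. dual_norm open_cube (distr_grad C (mixed_deriv C f) x)) = 1 \<and>
     Linf_norm C f = h ^ (d + 1) / (2 ^ card P * real (d + 1))"
proof -
  define G where "G = (\<lambda>x. indicator C x * pyramid h (x :: real^'n))"
  define f where "f = mixed_primitive G"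
  define F where "F = h ^ (d + 1) / (2 ^ card P * real (d + 1))"
  have C: "open C" unfolding C_def by (rule orthant_cone_open)
  have G: "integrable lborel G" unfolding G_def C_def by (rule integral_pyramid_cone(1)[OF h])
  have "(1 / 2) ^ d * (\<integral>x. \<bar>G x\<bar> \<partial>lborel) = F"
  proof -
    have "\<bar>G x\<bar> = G x" for x using pyramid_bounds[OF h, of x] by (simp add: G_def)
    then have "(\<integral>x. \<bar>G x\<bar> \<partial>lborel) = 2 ^ (d - card P) * h ^ (d + 1) / real (d + 1)"
      using integral_pyramid_cone(2)[OF h, of P] by (simp add: G_def C_def d_def)
    moreover have "(2::real) ^ d = 2 ^ (d - card P) * 2 ^ card P"
      using card_mono[of UNIV P] by (simp add: power_add[symmetric] d_def)
    ultimately show ?thesis by (simp add: F_def power_one_over)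
  qed
  then have fF: "\<bar>f x\<bar> \<le> F" for x using abs_mixed_primitive_le[OF G, of x] by (simp add: f_def d_def)
  have fm: "f \<in> borel_measurable borel" unfolding f_def using G by (intro mixed_primitive_measurable) auto
  have gb: "\<bar>pyramid h x\<bar> \<le> h" for x :: "real^'n" using pyramid_bounds[OF h, of x] by simp
  have gm: "(pyramid h :: real^'n \<Rightarrow> real) \<in> borel_measurable borel" by simp
  have um: "pyramid_grad h i \<in> borel_measurable borel" for i :: 'n by simp
  have mixed: "has_mixed_deriv C f (pyramid h)"
    unfolding has_mixed_deriv_def
  proof (intro allI impI, elim conjE)
    fix "is" :: "'n list" assume "is": "distinct is" "set is = UNIV"
    show "has_distr_deriv C is f (pyramid h)"
    proof (rule has_distr_deriv_lborelI[OF C fm fF gm gb])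
      fix \<phi> assume \<phi>: "\<phi> \<in> test_functions C"
      have "(\<lambda>x. G x * \<phi> x) = (\<lambda>x. pyramid h x * \<phi> x)"
      proof
        show "G x * \<phi> x = pyramid h x * \<phi> x" for x
          using test_functions_outside[OF \<phi>, of x] by (cases "x \<in> C") (auto simp: G_def)
      qed
      then show "(\<integral>x. f x * iter_partial is \<phi> x \<partial>lborel) = (- 1) ^ length is * (\<integral>x. pyramid h x * \<phi> x \<partial>lborel)"
        using mixed_primitive_weak_deriv[OF G \<phi> "is"] by (simp add: f_def)
    qed
  qed
  have gL: "pyramid h \<in> Linf C" by (rule bounded_borel_on(3)[OF gm gb])
  have uL: "pyramid_grad h i \<in> Linf C" for i by (rule bounded_borel_on(3)[OF um abs_pyramid_grad_le])
  have grad: "has_distr_deriv C [i] (pyramid h) (pyramid_grad h i)" for i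
    by (rule has_distr_deriv_lborelI[OF C gm gb um abs_pyramid_grad_le]) (simp add: pyramid_weak_grad[OF h])
  have fL: "f \<in> Linf C" "Linf_norm C f \<le> F" using bounded_borel_on(3,4)[OF fm fF] by auto
  have fW: "f \<in> W_mixed_grad C"
    using fL gL uL grad mixed unfolding W_mixed_grad_def W1_inf_def by blast
  define M where "M = mixed_deriv C f"
  define U where "U i x = distr_grad C M x $ i" for i x
  note rep = mixed_deriv_representative[OF C mixed gL uL grad, folded M_def, folded U_def]
  have M: "Linf_norm C M = h" using rep(3) Linf_norm_pyramid[OF h, of P] by (simp add: C_def)
  define L where "L = Linf_norm C (\<lambda>x. \<Sum>i\<in>UNIV. \<bar>U i x\<bar>)"
  have sL: "(\<lambda>x. \<Sum>i\<in>UNIV. \<bar>U i x\<bar>) \<in> Linf C" by (rule Linf_sum_abs[OF rep(6)])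
  have "L \<le> 1" unfolding L_def
  proof (rule Linf_normI(2))
    show "(\<lambda>x. \<Sum>i\<in>UNIV. \<bar>U i x\<bar>) \<in> borel_measurable (lebesgue_on C)" using sL by (simp add: Linf_def)
    have "AE x in lebesgue. \<forall>i j. i \<noteq> j \<longrightarrow> \<bar>(x :: real^'n) $ i\<bar> \<noteq> \<bar>x $ j\<bar>"
      using AE_completion[OF AE_generic_point[of h]] by eventually_elim auto
    then have gen: "AE x in lebesgue_on C. \<forall>i j. i \<noteq> j \<longrightarrow> \<bar>(x :: real^'n) $ i\<bar> \<noteq> \<bar>x $ j\<bar>"
      using C by (subst AE_restrict_space_iff) (auto elim!: eventually_mono)
    have "AE x in lebesgue_on C. \<forall>i\<in>UNIV. pyramid_grad h i x = U i x"
      by (rule AE_ball_countable'[OF rep(5)]) (simp add: countable_finite)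
    with gen show "AE x in lebesgue_on C. \<bar>\<Sum>i\<in>UNIV. \<bar>U i x\<bar>\<bar> \<le> 1"
    proof eventually_elim
      case (elim x)
      then show ?case using sum_pyramid_grad_le_1[of x h] by (simp add: sum_nonneg)
    qed
  qed simp
  define a where "a = h * (real d / real (d + 1))"
  define b where "b = 2 ^ card P / h ^ d"
  have pos: "0 < a" "0 < b" using h by (auto simp: a_def b_def d_def)
  have "b * F = h / real (d + 1)" using h by (simp add: b_def F_def)
  then have "a + b * F = h" by (simp add: a_def field_simps)
  moreover have "h \<le> a * L + b * Linf_norm C f"
  proof -
    have "AE x in lebesgue_on C. (\<Sum>i\<in>UNIV. \<bar>U i x\<bar>) \<le> L"
      using Linf_AE[OF sL] unfolding L_def by eventually_elim (simp add: sum_nonneg)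
    moreover have "0 \<le> L" unfolding L_def by (rule Linf_norm_nonneg)
    ultimately show ?thesis
      using landau_kolmogorov_additive[of f P M U L h, folded C_def d_def, OF fL(1) rep(2,1) rep(6) rep(4) _ _ h] M
      by (simp add: a_def b_def)
  qed
  moreover have "a * L \<le> a * 1" "b * Linf_norm C f \<le> b * F"
    using pos \<open>L \<le> 1\<close> fL(2) by (intro mult_left_mono; simp)+
  ultimately have "a * L = a * 1" "b * Linf_norm C f = b * F" by linarith+
  then have "L = 1" "Linf_norm C f = F" using pos by simp_all
  then show ?thesis
    using fW M by (intro bexI[of _ f]) (simp_all add: M_def[symmetric] dual_norm_open_cube L_def U_def F_def)
qed

section \<open>The Landau-Kolmogorov inequality on cones\<close>

theorem theorem5:
  fixes P :: "'n::finite set" and m d :: nat and K C :: "(real^'n) set"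
  assumes d: "d = CARD('n)"
    and K: "K = open_cube"
    and m: "m = card P"
    and C: "C = orthant_cone P"
  shows
    "(\<forall>x. body_norm K x = Max (range (\<lambda>i. \<bar>x $ i\<bar>))) \<and>
     (\<forall>z. dual_norm K z = (\<Sum>i\<in>UNIV. \<bar>z $ i\<bar>)) \<and>
     (\<forall>f\<in>W_mixed_grad C.
        mixed_deriv C f \<in> Linf C \<and>
        (\<forall>h>0. Linf_norm C (mixed_deriv C f)
           \<le> h * (real d / real (d + 1)) *
               Linf_norm C (\<lambda>x. dual_norm K (distr_grad C (mixed_deriv C f) x))
             + 2 ^ m / h ^ d * Linf_norm C f) \<and>
        Linf_norm C (mixed_deriv C f)
          \<le> (2 ^ m * real (d + 1) * Linf_norm C f) powr (1 / real (d + 1)) *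
            Linf_norm C (\<lambda>x. dual_norm K (distr_grad C (mixed_deriv C f) x))
              powr (real d / real (d + 1))) \<and>
     (m = 0 \<or> m = 1 \<longrightarrow>
        (\<forall>h>0. \<exists>f\<in>W_mixed_grad C.
           0 < Linf_norm C f \<and>
           0 < Linf_norm C (\<lambda>x. dual_norm K (distr_grad C (mixed_deriv C f) x)) \<and>
           Linf_norm C (mixed_deriv C f)
             = h * (real d / real (d + 1)) *
                 Linf_norm C (\<lambda>x. dual_norm K (distr_grad C (mixed_deriv C f) x))
               + 2 ^ m / h ^ d * Linf_norm C f) \<and>
        (\<exists>f\<in>W_mixed_grad C.
           0 < Linf_norm C f \<and>
           0 < Linf_norm C (\<lambda>x. dual_norm K (distr_grad C (mixed_deriv C f) x)) \<and>
           Linf_norm C (mixed_deriv C f)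
             = (2 ^ m * real (d + 1) * Linf_norm C f) powr (1 / real (d + 1)) *
               Linf_norm C (\<lambda>x. dual_norm K (distr_grad C (mixed_deriv C f) x))
                 powr (real d / real (d + 1))))"
proof (intro conjI ballI impI)
  let ?N = "\<lambda>f. Linf_norm C (\<lambda>x. dual_norm K (distr_grad C (mixed_deriv C f) x))"
  have openC: "open C" unfolding C by (rule orthant_cone_open)
  have d0: "0 < d" by (simp add: d)
  show "\<forall>x. body_norm K x = Max (range (\<lambda>i. \<bar>x $ i\<bar>))"
    by (simp add: K body_norm_open_cube infnorm_eq_Max_cart)
  show "\<forall>z. dual_norm K z = (\<Sum>i\<in>UNIV. \<bar>z $ i\<bar>)"
    by (simp add: K dual_norm_open_cube)
  {
    fix f assume "f \<in> W_mixed_grad C"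
    then obtain g where f: "f \<in> Linf C" and "g \<in> W1_inf C" and mixed: "has_mixed_deriv C f g"
      unfolding W_mixed_grad_def by blast
    then obtain u where g: "g \<in> Linf C" and u: "\<And>i. u i \<in> Linf C" "\<And>i. has_distr_deriv C [i] g (u i)"
      unfolding W1_inf_def by (auto, metis)
    note rep = mixed_deriv_representative[OF openC mixed g u]
    show "mixed_deriv C f \<in> Linf C" by (rule rep(2))
    have N: "?N f = Linf_norm C (\<lambda>x. \<Sum>i\<in>UNIV. \<bar>distr_grad C (mixed_deriv C f) x $ i\<bar>)"
      by (simp add: K dual_norm_open_cube)
    have grad_le: "AE x in lebesgue_on C. (\<Sum>i\<in>UNIV. \<bar>distr_grad C (mixed_deriv C f) x $ i\<bar>) \<le> ?N f"
      using Linf_AE[OF Linf_sum_abs[OF rep(6)]] unfolding N by eventually_elim (simp add: sum_nonneg)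
    have add: "Linf_norm C (mixed_deriv C f) \<le> h * (real d / real (d + 1)) * ?N f + 2 ^ m / h ^ d * Linf_norm C f"
      if "0 < h" for h
      using landau_kolmogorov_additive[of f P "mixed_deriv C f" "\<lambda>i x. distr_grad C (mixed_deriv C f) x $ i" "?N f" h,
          folded C d m, OF f rep(2,1) rep(6) rep(4) grad_le Linf_norm_nonneg that] .
    then show "\<forall>h>0. Linf_norm C (mixed_deriv C f) \<le> h * (real d / real (d + 1)) * ?N f + 2 ^ m / h ^ d * Linf_norm C f"
      by blast
    have "Linf_norm C (mixed_deriv C f) \<le>
       (real (d + 1) * (2 ^ m * Linf_norm C f)) powr (1 / real (d + 1)) * ?N f powr (real d / real (d + 1))"
      by (rule optimise_additive_inequality[OF d0 Linf_norm_nonneg]) (use add in \<open>auto simp: Linf_norm_nonneg\<close>)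
    then show "Linf_norm C (mixed_deriv C f) \<le>
       (2 ^ m * real (d + 1) * Linf_norm C f) powr (1 / real (d + 1)) * ?N f powr (real d / real (d + 1))"
      by (simp only: mult_ac)
  }
  have extremal: "\<exists>f\<in>W_mixed_grad C. Linf_norm C (mixed_deriv C f) = h \<and> ?N f = 1 \<and>
      Linf_norm C f = h ^ (d + 1) / (2 ^ m * real (d + 1))" if "0 < h" for h
    using extremal_function[OF that, of P] unfolding C d m K .
  show "\<forall>h>0. \<exists>f\<in>W_mixed_grad C. 0 < Linf_norm C f \<and> 0 < ?N f \<and>
     Linf_norm C (mixed_deriv C f) = h * (real d / real (d + 1)) * ?N f + 2 ^ m / h ^ d * Linf_norm C f"
  proof (intro allI impI)
    fix h :: real assume h: "0 < h"
    have "2 ^ m / h ^ d * (h ^ (d + 1) / (2 ^ m * real (d + 1))) = h / real (d + 1)"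
      using h by simp
    then have "h * (real d / real (d + 1)) * 1 + 2 ^ m / h ^ d * (h ^ (d + 1) / (2 ^ m * real (d + 1))) = h"
      using h by (simp add: field_simps)
    moreover have "0 < h ^ (d + 1) / (2 ^ m * real (d + 1))" using h by simp
    ultimately show "\<exists>f\<in>W_mixed_grad C. 0 < Linf_norm C f \<and> 0 < ?N f \<and>
       Linf_norm C (mixed_deriv C f) = h * (real d / real (d + 1)) * ?N f + 2 ^ m / h ^ d * Linf_norm C f"
      using extremal[OF h] by (metis zero_less_one)
  qed
  obtain f where f: "f \<in> W_mixed_grad C" "Linf_norm C (mixed_deriv C f) = 1" "?N f = 1"
    "Linf_norm C f = 1 / (2 ^ m * real (d + 1))"
    using extremal[of 1] by auto
  show "\<exists>f\<in>W_mixed_grad C. 0 < Linf_norm C f \<and> 0 < ?N f \<and>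
     Linf_norm C (mixed_deriv C f) =
       (2 ^ m * real (d + 1) * Linf_norm C f) powr (1 / real (d + 1)) * ?N f powr (real d / real (d + 1))"
    by (rule bexI[OF _ f(1)]) (simp add: f(2-4))
qed

end
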